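(* Let $1\le k\le d$ be integers and let $M\subset\mathbb R^d$ be a nondegenerate smooth submanifold of dimension $k$. Then $$\dim\big(\mathrm{BA}_M(\psi_{c(k,d)})\big)=k,$$ where $\dim$ denotes Hausdorff dimension. Consequently, no Dirichlet function for intrinsic approximation on $M$ decays faster than $\psi_{c(k,d)}$; that is, there is no Dirichlet function $\phi$ for intrinsic approximation on $M$ such that $\phi(t)/\psi_{c(k,d)}(t)\to 0$ as $t\to\infty$.
   Context: $\mathbb N=\{1,2,\dots\}$, $\mathbb N_0=\mathbb N\cup\{0\}$. $\mathbb R^d$ carries the distance $\mathrm{dist}$ given by the max norm. Height: for $\mathbf r\in\mathbb Q^d$ write $\mathbf r=\mathbf p/q$ in reduced form ($\mathbf p\in\mathbb Z^d$, $q\in\mathbb N$, no common factor of $q$ and all the coordinates of $\mathbf p$); $H(\mathbf r):=q$. For $c>0$, $\psi_c(t):=t^{-c}$. For $\psi:(0,\infty)\to(0,\infty)$, $$\mathrm{BA}_M(\psi)=\{\mathbf x\in M:\exists\, c_{\mathbf x}>0 \text{ such that } \mathrm{dist}(\mathbf x,\mathbf r)\ge c_{\mathbf x}\,\psi(H(\mathbf r))\ \text{ for all } \mathbf r\in\mathbb Q^d\cap M\}.$$ A function $\psi:(0,\infty)\to(0,\infty)$ is a Dirichlet function for intrinsic approximation on $M$ if for every $\mathbf x\in M$ there exist a constant $C_{\mathbf x}$ and a sequence $(\mathbf r_n)_{n\in\mathbb N}$ in $\mathbb Q^d\cap M$ such that $\mathbf r_n\to\mathbf x$ and $\mathrm{dist}(\mathbf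 x,\mathbf r_n)\le C_{\mathbf x}\psi(H(\mathbf r_n))$ for all $n$. The constant $c(k,d)$: let $[n,m]:=\binom{n+m}{m}$. Let $n_{k,d}\in\mathbb N$ be maximal such that $d=[k-1,1]+[k-1,2]+\dots+[k-1,n_{k,d}]+m_{k,d}$ for some $m_{k,d}\ge 0$, and let $m_{k,d}$ be the unique integer satisfying this. Put $N_{k,d}:=1[k-1,1]+2[k-1,2]+\dots+n_{k,d}[k-1,n_{k,d}]+(n_{k,d}+1)m_{k,d}$ and $c(k,d):=(d+1)/N_{k,d}$. Nondegeneracy: for $\mathbf x\in M$, $j\in\mathbb N$ and a local parameterization $\Phi:U\to M$ ($U\subset\mathbb R^k$ open) with $\Phi(\mathbf v)=\mathbf x$, let $T^{(j)}_{\mathbf x}(M)=\mathrm{Span}\{\partial^\alpha\Phi(\mathbf v):\alpha\in\mathbb N_0^k,\ 0<|\alpha|\le j\}\subset\mathbb R^d$. A point $\mathbf x\in M$ is $D$-nondegenerate if $T^{(D)}_{\mathbf x}(M)=\mathbb R^d$, and nondegenerate if it is $D$-nondegenerate for some $D\in\mathbb N$. $M$ is nondegenerate if some point of $M$ is nondegenerate. *)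

theory Defs
  imports "HOL-Analysis.Analysis"
begin

section \<open>The max norm distance, rational points and heights\<close>

text \<open>The library's \<open>dist\<close> on \<open>real ^ 'd\<close> is Euclidean; \<open>infnorm\<close> is the max norm.\<close>

definition max_dist :: "real ^ 'd \<Rightarrow> real ^ 'd \<Rightarrow> real" where
  "max_dist x y = infnorm (x - y)"

definition rat_points :: "(real ^ 'd) set" where
  "rat_points = {r. \<forall>i. r $ i \<in> \<rat>}"

definition is_reduced_form :: "real ^ 'd \<Rightarrow> ('d \<Rightarrow> int) \<Rightarrow> nat \<Rightarrow> bool" where
  "is_reduced_form r p q \<longleftrightarrow>
     q > 0 \<and> (\<forall>i. r $ i = of_int (p i) / of_nat q) \<and> Gcd (insert (int q) (range p)) = 1"

definition height :: "real ^ 'd \<Rightarrow> nat" where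
  "height r = (THE q. \<exists>p. is_reduced_form r p q)"


section \<open>Badly approximable points and Dirichlet functions\<close>

definition psi :: "real \<Rightarrow> real \<Rightarrow> real" where
  "psi c t = t powr (- c)"

definition BA :: "(real ^ 'd) set \<Rightarrow> (real \<Rightarrow> real) \<Rightarrow> (real ^ 'd) set" where
  "BA M \<psi> = {x \<in> M. \<exists>c>0. \<forall>r \<in> rat_points \<inter> M. max_dist x r \<ge> c * \<psi> (real (height r))}"

text \<open>Functions \<open>(0,\<infinity>) \<rightarrow> (0,\<infinity>)\<close> are functions on \<open>real\<close> that are positive at
  positive arguments; values at other arguments are never used.\<close>

definition dirichlet_function :: "(real ^ 'd) set \<Rightarrow> (real \<Rightarrow> real) \<Rightarrow> bool" where
  "dirichlet_function M \<psi> \<longleftrightarrow>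
     (\<forall>t>0. \<psi> t > 0) \<and>
     (\<forall>x\<in>M. \<exists>C. \<exists>r :: nat \<Rightarrow> real ^ 'd.
        (\<forall>n. r n \<in> rat_points \<inter> M) \<and> r \<longlonglongrightarrow> x \<and>
        (\<forall>n. max_dist x (r n) \<le> C * \<psi> (real (height (r n)))))"


section \<open>The exponent \<open>c(k,d)\<close>\<close>

definition br :: "nat \<Rightarrow> nat \<Rightarrow> nat" where
  "br n m = (n + m) choose m"

definition n_kd :: "nat \<Rightarrow> nat \<Rightarrow> nat" where
  "n_kd k d = (GREATEST n. n \<ge> 1 \<and> (\<exists>m. d = (\<Sum>j=1..n. br (k - 1) j) + m))"

definition m_kd :: "nat \<Rightarrow> nat \<Rightarrow> nat" where
  "m_kd k d = (THE m. d = (\<Sum>j=1..n_kd k d. br (k - 1) j) + m)"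

definition N_kd :: "nat \<Rightarrow> nat \<Rightarrow> nat" where
  "N_kd k d = (\<Sum>j=1..n_kd k d. j * br (k - 1) j) + (n_kd k d + 1) * m_kd k d"

definition c_kd :: "nat \<Rightarrow> nat \<Rightarrow> real" where
  "c_kd k d = (real d + 1) / real (N_kd k d)"


section \<open>Hausdorff dimension\<close>

text \<open>Everything is relative to an explicit distance function \<open>\<delta>\<close>. The diameter is an
  extended real, so that it is \<open>\<infinity>\<close> (and not a junk value) for unbounded sets.\<close>

definition ediam :: "('a \<Rightarrow> 'a \<Rightarrow> real) \<Rightarrow> 'a set \<Rightarrow> ennreal" where
  "ediam \<delta> A = (SUP x\<in>A. SUP y\<in>A. ennreal (\<delta> x y))"

definition hausdorff_content :: "('a \<Rightarrow> 'a \<Rightarrow> real) \<Rightarrow> real \<Rightarrow> real \<Rightarrow> 'a set \<Rightarrow> ennreal" where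
  "hausdorff_content \<delta> s \<epsilon> A =
     (INF U \<in> {U :: nat \<Rightarrow> 'a set. A \<subseteq> (\<Union>n. U n) \<and> (\<forall>n. ediam \<delta> (U n) \<le> ennreal \<epsilon>)}.
        \<Sum>n. ennreal (enn2real (ediam \<delta> (U n)) powr s))"

definition hausdorff_measure :: "('a \<Rightarrow> 'a \<Rightarrow> real) \<Rightarrow> real \<Rightarrow> 'a set \<Rightarrow> ennreal" where
  "hausdorff_measure \<delta> s A = (SUP \<epsilon>\<in>{0<..}. hausdorff_content \<delta> s \<epsilon> A)"

text \<open>Only exponents \<open>s > 0\<close> enter, where \<open>0 powr s = 0\<close> is the right value for the
  diameter-zero sets of a cover; this does not affect the infimum.\<close>

definition hausdorff_dim :: "('a \<Rightarrow> 'a \<Rightarrow> real) \<Rightarrow> 'a set \<Rightarrow> ereal" where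
  "hausdorff_dim \<delta> A = Inf {ereal s | s. s > 0 \<and> hausdorff_measure \<delta> s A = 0}"


section \<open>Smooth submanifolds and nondegeneracy\<close>

definition partial_deriv ::
    "'k::finite \<Rightarrow> (real ^ 'k \<Rightarrow> 'b::real_normed_vector) \<Rightarrow> real ^ 'k \<Rightarrow> 'b" where
  "partial_deriv i f x = vector_derivative (\<lambda>t. f (x + t *\<^sub>R axis i 1)) (at 0)"

text \<open>\<open>iter_partial [i\<^sub>1, \<dots>, i\<^sub>m] f\<close> is \<open>\<partial>\<^sub>i\<^sub>1 \<cdots> \<partial>\<^sub>i\<^sub>m f\<close>. For smooth \<open>f\<close> this is
  \<open>\<partial>\<^sup>\<alpha> f\<close> where \<open>\<alpha>\<close> counts the occurrences of each index, so \<open>|\<alpha>| = m\<close>, and every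
  multi-index arises from some list.\<close>

definition iter_partial ::
    "'k::finite list \<Rightarrow> (real ^ 'k \<Rightarrow> 'b::real_normed_vector) \<Rightarrow> real ^ 'k \<Rightarrow> 'b" where
  "iter_partial is f = foldr partial_deriv is f"

text \<open>\<open>C\<^sup>\<infinity>\<close> on an open set: all iterated partial derivatives are differentiable (hence
  exist to every order and are continuous).\<close>

definition smooth_on :: "(real ^ 'k::finite) set \<Rightarrow> (real ^ 'k \<Rightarrow> 'b::real_normed_vector) \<Rightarrow> bool" where
  "smooth_on U f \<longleftrightarrow> (\<forall>is. iter_partial is f differentiable_on U)"

definition local_parameterization ::
    "(real ^ 'd) set \<Rightarrow> (real ^ 'k) set \<Rightarrow> (real ^ 'k \<Rightarrow> real ^ 'd) \<Rightarrow> bool" where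
  "local_parameterization M U \<Phi> \<longleftrightarrow>
     open U \<and> smooth_on U \<Phi> \<and> (\<forall>v\<in>U. inj (frechet_derivative \<Phi> (at v))) \<and>
     openin (top_of_set M) (\<Phi> ` U) \<and> (\<exists>\<Theta>. homeomorphism U (\<Phi> ` U) \<Phi> \<Theta>)"

text \<open>The dimension \<open>k\<close> is passed as the index type \<open>'k\<close>, i.e. \<open>k = CARD('k)\<close>.\<close>

definition smooth_submanifold :: "'k::finite itself \<Rightarrow> (real ^ 'd) set \<Rightarrow> bool" where
  "smooth_submanifold (_ :: 'k itself) M \<longleftrightarrow>
     (\<forall>x\<in>M. \<exists>(U :: (real ^ 'k) set) \<Phi>. local_parameterization M U \<Phi> \<and> x \<in> \<Phi> ` U)"

definition osculating_space ::
    "nat \<Rightarrow> (real ^ 'k \<Rightarrow> real ^ 'd) \<Rightarrow> real ^ 'k \<Rightarrow> (real ^ 'd) set" where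
  "osculating_space j \<Phi> v = span {iter_partial is \<Phi> v | is. 0 < length is \<and> length is \<le> j}"

text \<open>By the chain rule the space \<open>T\<^sup>(\<^sup>j\<^sup>)\<^sub>x(M) = osculating_space j \<Phi> v\<close> does not depend on the
  local parameterization \<open>\<Phi>\<close> with \<open>\<Phi> v = x\<close>, so any one of them may be used.\<close>

definition D_nondegenerate_at :: "'k::finite itself \<Rightarrow> (real ^ 'd) set \<Rightarrow> nat \<Rightarrow> real ^ 'd \<Rightarrow> bool" where
  "D_nondegenerate_at (_ :: 'k itself) M D x \<longleftrightarrow>
     (\<exists>(U :: (real ^ 'k) set) \<Phi> v. local_parameterization M U \<Phi> \<and> v \<in> U \<and> \<Phi> v = x \<and>
        osculating_space D \<Phi> v = UNIV)"

definition nondegenerate_at :: "'k::finite itself \<Rightarrow> (real ^ 'd) set \<Rightarrow> real ^ 'd \<Rightarrow> bool" where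
  "nondegenerate_at K M x \<longleftrightarrow> (\<exists>D\<ge>1. D_nondegenerate_at K M D x)"

definition nondegenerate :: "'k::finite itself \<Rightarrow> (real ^ 'd) set \<Rightarrow> bool" where
  "nondegenerate K M \<longleftrightarrow> (\<exists>x\<in>M. nondegenerate_at K M x)"

end

theory Submission
  imports Defs "HOL-Library.Multiset"
begin

text \<open>Rational points \<open>\<Phi>(u\<^sub>0), \<dots>, \<Phi>(u\<^sub>d)\<close> of height at most \<open>T\<close> in general position give a
  determinant of the vectors \<open>(1, \<Phi>(u\<^sub>i))\<close> of absolute value at least \<open>T\<^sup>-\<^sup>(\<^sup>d\<^sup>+\<^sup>1\<^sup>)\<close>. If the \<open>u\<^sub>i\<close>
  lie in a cube of side \<open>\<rho>\<close>, expanding the rows by Taylor's formula shows that this determinant is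
  \<open>O(\<rho>\<^sup>N)\<close> with \<open>N = N_kd k d\<close>, because two rows may not use the same monomial. Hence the rational
  points of height at most a constant times \<open>\<rho>\<close> to the power \<open>-1 / c_kd k d\<close> lie on one hyperplane.
  By nondegeneracy, the zero set of \<open>L \<bullet> \<Phi> - b\<close> comes close to only a small proportion of the
  \<open>m\<^sup>k\<close> subcubes of a small cube, uniformly in the hyperplane. Descending through nested subcubes
  that stay away from these zero sets produces badly approximable points. At each step at least half
  of the subcubes are allowed, so for \<open>s < k\<close> one can choose the subcube that meets
  least of a given cover \<open>(U\<^sub>i)\<close> with small \<open>\<Sum>\<^sub>i (diam U\<^sub>i)\<^sup>s\<close>, and the limit point escapes the cover.
  A badly approximable point is irrational, so heights of rational points converging to it tend to
  infinity, which rules out a faster Dirichlet function.\<close>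

section \<open>Partial derivatives and Taylor's formula\<close>

text \<open>The hyperplane that carries the rational points changes with the cube and the scale and
  cannot be controlled, so the number of subcubes per step has to be fixed before the cube, the
  scale and the hyperplane. This forces scale-invariant bounds: for a cube of side \<rho> a
  derivative of order l enters only multiplied by the l-th power of \<rho>, and is compared with a
  common size A that may be tiny. Nondegeneracy supplies a derivative of bounded order that
  dominates after such a rescaling, and the counting is an induction on that order. The exponent is
  adapted to \<open>psi\<close>: heights up to T are controlled at scale \<rho> when
  \<open>psi c T\<close> is comparable to \<rho>. So at scale \<rho> all rational points y with
  \<rho> \<le> \<tau> * \<open>psi c (height y)\<close> are treated at once, and every point is met
  at a scale comparable to the distance demanded of it. No measure is constructed on the limit set;
  the weight of a cover is followed directly through the nested cubes. The upper bound for the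
  dimension is separate: \<open>BA\<close> is contained in M, and M is covered by countably many
  Lipschitz images of k-dimensional cubes, which are null for every exponent above k.\<close>

lemma has_derivative_partial_deriv:
  fixes f :: "real ^ 'k::finite \<Rightarrow> 'b::real_normed_vector"
  assumes "(f has_derivative f') (at x)"
  shows "partial_deriv i f x = f' (axis i 1)"
proof -
  have "((\<lambda>t::real. x + t *\<^sub>R axis i (1::real)) has_derivative (\<lambda>t. t *\<^sub>R axis i 1)) (at 0)"
    by (auto intro!: derivative_eq_intros)
  moreover have "(f has_derivative f') (at (x + 0 *\<^sub>R axis i (1::real)))"
    using assms by simp
  ultimately have "((f \<circ> (\<lambda>t::real. x + t *\<^sub>R axis i (1::real))) has_derivative f' \<circ> (\<lambda>t. t *\<^sub>R axis i 1)) (at 0)"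
    by (rule diff_chain_at)
  then have "((\<lambda>t::real. f (x + t *\<^sub>R axis i (1::real))) has_vector_derivative f' (axis i 1)) (at 0)"
    unfolding has_vector_derivative_def o_def
    using linear_simps(5)[OF has_derivative_bounded_linear[OF assms]] by simp
  then show ?thesis
    unfolding partial_deriv_def by (rule vector_derivative_at)
qed

lemma frechet_derivative_eq_sum_partial:
  fixes f :: "real ^ 'k::finite \<Rightarrow> 'b::real_normed_vector"
  assumes "(f has_derivative f') (at x)"
  shows "f' h = (\<Sum>i\<in>UNIV. (h $ i) *\<^sub>R partial_deriv i f x)"
proof -
  interpret bounded_linear f' using assms by (rule has_derivative_bounded_linear)
  have "h = (\<Sum>i\<in>UNIV. (h $ i) *\<^sub>R axis i 1)"
    using basis_expansion[of h] by (simp add: scalar_mult_eq_scaleR)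
  then have "f' h = (\<Sum>i\<in>UNIV. (h $ i) *\<^sub>R f' (axis i 1))"
    by (metis (mono_tags, lifting) sum scaleR sum.cong)
  then show ?thesis
    by (simp add: has_derivative_partial_deriv[OF assms])
qed

lemma iter_partial_Nil [simp]: "iter_partial [] f = f"
  and iter_partial_Cons: "iter_partial (i # is) f = partial_deriv i (iter_partial is f)"
  and iter_partial_snoc: "iter_partial (is @ [i]) f = iter_partial is (partial_deriv i f)"
  by (simp_all add: iter_partial_def)

lemma smooth_on_differentiable_at:
  assumes "smooth_on U f" "open U" "x \<in> U"
  shows "iter_partial is f differentiable at x"
  using assms unfolding smooth_on_def
  by (meson differentiable_on_eq_differentiable_at)

lemma smooth_on_partial_deriv:
  "smooth_on U f \<Longrightarrow> smooth_on U (partial_deriv i f)"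
  unfolding smooth_on_def by (metis iter_partial_snoc)

lemma smooth_on_iter_continuous:
  assumes "smooth_on U f" "open U"
  shows "continuous_on U (iter_partial is f)"
  using assms by (simp add: smooth_on_def differentiable_imp_continuous_on)

lemma iter_partial_bounded_linear:
  fixes f :: "real ^ 'k::finite \<Rightarrow> 'b::real_normed_vector"
  assumes "bounded_linear T" "smooth_on U f" "open U" "x \<in> U"
  shows "iter_partial is (\<lambda>y. T (f y)) x = T (iter_partial is f x)"
  using assms(4)
proof (induction "is" arbitrary: x)
  case (Cons i "is")
  obtain f' where f': "(iter_partial is f has_derivative f') (at x)"
    using smooth_on_differentiable_at[OF assms(2,3) Cons.prems] unfolding differentiable_def by blast
  then have "((\<lambda>y. T (iter_partial is f y)) has_derivative (\<lambda>h. T (f' h))) (at x)"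
    by (rule bounded_linear.has_derivative[OF assms(1)])
  then have "(iter_partial is (\<lambda>y. T (f y)) has_derivative (\<lambda>h. T (f' h))) (at x)"
    by (rule has_derivative_transform_within_open[OF _ assms(3) Cons.prems]) (simp add: Cons.IH)
  then show ?case
    using f' by (simp add: iter_partial_Cons has_derivative_partial_deriv)
qed simp

lemma smooth_on_bounded_linear:
  fixes f :: "real ^ 'k::finite \<Rightarrow> 'b::real_normed_vector"
  assumes "bounded_linear T" "smooth_on U f" "open U"
  shows "smooth_on U (\<lambda>y. T (f y))"
  unfolding smooth_on_def
proof (intro allI)
  fix "is" :: "'k list"
  have "(\<lambda>y. T (iter_partial is f y)) differentiable_on U"
    using assms(2) bounded_linear.has_derivative[OF assms(1)]
    unfolding smooth_on_def differentiable_on_def differentiable_def by fast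
  then show "iter_partial is (\<lambda>y. T (f y)) differentiable_on U"
    unfolding differentiable_on_def differentiable_def
    using has_derivative_transform[where s = U and f = "\<lambda>y. T (iter_partial is f y)"
        and g = "iter_partial is (\<lambda>y. T (f y))"] iter_partial_bounded_linear[OF assms, of _ "is"]
    by blast
qed

text \<open>\<open>vector_derivative\<close> is a choice among the values that satisfy
  \<open>has_vector_derivative\<close>, and subtracting a constant leaves that predicate unchanged.
  So the functions agree at every point, differentiable or not.\<close>

lemma partial_deriv_diff_const:
  fixes f :: "real ^ 'k::finite \<Rightarrow> 'b::real_normed_vector"
  shows   "partial_deriv i (\<lambda>y. f y - c) = partial_deriv i f"
proof -
  have "((\<lambda>t. g t - c) has_vector_derivative D) F \<longleftrightarrow> (g has_vector_derivative D) F" for g :: "real \<Rightarrow> 'b" and D F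
    using has_vector_derivative_diff[OF _ has_vector_derivative_const, of g D F c]
      has_vector_derivative_add[OF _ has_vector_derivative_const, of "\<lambda>t. g t - c" D F c] by auto
  then show ?thesis
    unfolding partial_deriv_def vector_derivative_def by simp
qed

text \<open>The last index of the list is differentiated first, and this already removes the
  constant.\<close>

lemma iter_partial_diff_const:
  fixes f :: "real ^ 'k::finite \<Rightarrow> 'b::real_normed_vector"
  assumes "is \<noteq> []"
  shows "iter_partial is (\<lambda>y. f y - c) = iter_partial is f"
  using assms by (cases "is" rule: rev_cases) (simp_all add: iter_partial_snoc partial_deriv_diff_const)

lemma smooth_on_diff_const:
  fixes f :: "real ^ 'k::finite \<Rightarrow> 'b::real_normed_vector"
  assumes "smooth_on U f"
  shows "smooth_on U (\<lambda>y. f y - c)"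
  unfolding smooth_on_def
proof (intro allI)
  fix "is" :: "'k list"
  have "(\<lambda>y. f y - c) differentiable_on U"
    using assms[unfolded smooth_on_def, rule_format, of "[]"] by (auto intro: differentiable_on_diff)
  then show "iter_partial is (\<lambda>y. f y - c) differentiable_on U"
    using assms unfolding smooth_on_def by (cases "is = []") (simp_all add: iter_partial_diff_const)
qed

lemma mvt_partial:
  fixes f :: "real ^ 'k::finite \<Rightarrow> real"
  assumes diff: "\<And>z. z \<in> closed_segment y x \<Longrightarrow> f differentiable at z"
  shows "\<exists>z\<in>closed_segment y x. f x - f y = (\<Sum>i\<in>UNIV. (x $ i - y $ i) * partial_deriv i f z)"
proof -
  have "\<exists>t\<in>{0<..<1::real}. f (y + 1 *\<^sub>R (x - y)) - f (y + 0 *\<^sub>R (x - y)) =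
      (\<lambda>h. frechet_derivative f (at (y + t *\<^sub>R (x - y))) (h *\<^sub>R (x - y))) (1 - 0)"
  proof (rule mvt_simple)
    fix t :: real assume "0 \<le> t" "t \<le> 1"
    then have "y + t *\<^sub>R (x - y) \<in> closed_segment y x"
      by (auto simp: in_segment algebra_simps)
    then have 1: "(f has_derivative frechet_derivative f (at (y + t *\<^sub>R (x - y)))) (at (y + t *\<^sub>R (x - y)))"
      using diff frechet_derivative_works by blast
    have 2: "((\<lambda>t. y + t *\<^sub>R (x - y)) has_derivative (\<lambda>h. h *\<^sub>R (x - y))) (at t)"
      by (auto intro!: derivative_eq_intros)
    show "((\<lambda>t. f (y + t *\<^sub>R (x - y))) has_derivative
        (\<lambda>h. frechet_derivative f (at (y + t *\<^sub>R (x - y))) (h *\<^sub>R (x - y)))) (at t within {0..1})"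
      using diff_chain_at[OF 2 1] by (auto simp: o_def intro: has_derivative_at_withinI)
  qed simp
  then obtain t where t: "0 < t" "t < 1" and eq: "f x - f y = frechet_derivative f (at (y + t *\<^sub>R (x - y))) (x - y)"
    by auto
  define z where "z = y + t *\<^sub>R (x - y)"
  have z: "z \<in> closed_segment y x"
    using t unfolding z_def by (auto simp: in_segment algebra_simps intro!: exI[of _ t])
  then have "(f has_derivative frechet_derivative f (at z)) (at z)"
    using diff frechet_derivative_works by blast
  from frechet_derivative_eq_sum_partial[OF this, of "x - y"] show ?thesis
    using z eq by (auto simp: z_def intro!: bexI[of _ z])
qed

lemma abs_diff_le_partial:
  fixes f :: "real ^ 'k::finite \<Rightarrow> real"
  assumes "convex S" "x \<in> S" "y \<in> S"
    and diff: "\<And>z. z \<in> S \<Longrightarrow> f differentiable at z"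
    and bnd: "\<And>i z. z \<in> S \<Longrightarrow> \<bar>partial_deriv i f z\<bar> \<le> C"
  shows "\<bar>f x - f y\<bar> \<le> C * (\<Sum>i\<in>UNIV. \<bar>x $ i - y $ i\<bar>)"
proof -
  have seg: "closed_segment y x \<subseteq> S" using assms(1-3) closed_segment_subset by blast
  then obtain z where zS: "z \<in> S" and eq: "f x - f y = (\<Sum>i\<in>UNIV. (x $ i - y $ i) * partial_deriv i f z)"
    using mvt_partial[of y x f] diff by blast
  have "\<bar>f x - f y\<bar> \<le> (\<Sum>i\<in>UNIV. \<bar>x $ i - y $ i\<bar> * C)"
    unfolding eq by (rule order_trans[OF sum_abs]) (auto simp: abs_mult intro!: sum_mono mult_left_mono bnd zS)
  then show ?thesis by (simp add: sum_distrib_left mult.commute)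
qed

section \<open>Taylor's formula in several variables, indexed by multisets\<close>

definition monomial :: "real ^ 'k::finite \<Rightarrow> 'k multiset \<Rightarrow> real" where
  "monomial h \<alpha> = (\<Prod>i\<in>#\<alpha>. h $ i)"

text \<open>Multi-indices are multisets of coordinates. Summing over all orderings of a multi-index avoids
  the symmetry of mixed partial derivatives.\<close>

definition taylor_coeff :: "(real ^ 'k::finite \<Rightarrow> real) \<Rightarrow> real ^ 'k \<Rightarrow> 'k multiset \<Rightarrow> real" where
  "taylor_coeff f v \<alpha> = (\<Sum>is | mset is = \<alpha>. iter_partial is f v) / fact (size \<alpha>)"

lemma finite_lists_length: "finite {is :: 'k::finite list. length is = m}"
  using finite_lists_length_eq[of "UNIV :: 'k set" m] by simp

lemma card_lists_length: "card {is :: 'k::finite list. length is = m} = CARD('k) ^ m"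
  using card_lists_length_eq[of "UNIV :: 'k set" m] by simp

lemma sum_lists_Suc:
  fixes g :: "'k::finite list \<Rightarrow> 'a::comm_monoid_add"
  shows "(\<Sum>is | length is = Suc m. g is) = (\<Sum>i\<in>UNIV. \<Sum>is | length is = m. g (i # is))"
proof -
  have "(\<Sum>i\<in>UNIV. \<Sum>is | length is = m. g (i # is)) = (\<Sum>p\<in>UNIV \<times> {is. length is = m}. g (fst p # snd p))"
    by (simp add: sum.cartesian_product case_prod_beta)
  also have "\<dots> = (\<Sum>is | length is = Suc m. g is)"
  proof (rule sum.reindex_bij_witness[of _ "\<lambda>is. (hd is, tl is)" "\<lambda>p. fst p # snd p"])
  qed (auto simp: length_Suc_conv)
  finally show ?thesis by simp
qed

lemma finite_multisets_size_le: "finite {\<alpha> :: 'k::finite multiset. size \<alpha> \<le> n}"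
proof -
  have "{\<alpha> :: 'k multiset. size \<alpha> \<le> n} = (\<Union>m\<in>{..n}. multisets_of_size UNIV m)"
    by (auto simp: multisets_of_size_def)
  then show ?thesis by (simp add: finite_multisets_of_size)
qed

lemma abs_monomial_le:
  assumes "\<And>i. \<bar>h $ i\<bar> \<le> \<eta>"
  shows "\<bar>monomial h \<alpha>\<bar> \<le> \<eta> ^ size \<alpha>"
proof (induction \<alpha>)
  case (add i \<alpha>)
  have "0 \<le> \<eta>" using assms[of i] by linarith
  then show ?case using add assms[of i]
    by (simp add: monomial_def abs_mult mult_mono)
qed (simp add: monomial_def)

text \<open>\<open>G m\<close> is the m-th derivative of f along the line, kept as a sum over words
  in the coordinates. Differentiating once more prepends a letter to each word, so mixed partial
  derivatives never have to be exchanged.\<close>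

lemma line_deriv_iter:
  fixes f :: "real ^ 'k::finite \<Rightarrow> real"
  assumes "smooth_on U f" "open U" "v + t *\<^sub>R h \<in> U"
  defines "G \<equiv> \<lambda>m t. \<Sum>is | length is = m. monomial h (mset is) * iter_partial is f (v + t *\<^sub>R h)"
  shows "DERIV (G m) t :> G (Suc m) t"
proof -
  have 1: "((\<lambda>t. iter_partial is f (v + t *\<^sub>R h)) has_derivative
      (\<lambda>s. s * (\<Sum>i\<in>UNIV. h $ i * iter_partial (i # is) f (v + t *\<^sub>R h)))) (at t)" for "is"
  proof -
    have d: "(iter_partial is f has_derivative frechet_derivative (iter_partial is f) (at (v + t *\<^sub>R h))) (at (v + t *\<^sub>R h))"
      using smooth_on_differentiable_at[OF assms(1-3)] frechet_derivative_works by blast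
    have "((\<lambda>t. v + t *\<^sub>R h) has_derivative (\<lambda>s. s *\<^sub>R h)) (at t)"
      by (auto intro!: derivative_eq_intros)
    from diff_chain_at[OF this d] show ?thesis
      using frechet_derivative_eq_sum_partial[OF d]
      by (simp add: o_def iter_partial_Cons sum_distrib_left mult.assoc)
  qed
  have "(G m has_derivative (\<lambda>s. \<Sum>is | length is = m. monomial h (mset is) *
      (s * (\<Sum>i\<in>UNIV. h $ i * iter_partial (i # is) f (v + t *\<^sub>R h))))) (at t)"
    unfolding G_def by (intro has_derivative_sum has_derivative_mult_right 1)
  moreover have "(\<Sum>is | length is = m. monomial h (mset is) *
      (s * (\<Sum>i\<in>UNIV. h $ i * iter_partial (i # is) f (v + t *\<^sub>R h)))) = G (Suc m) t * s" for s
    unfolding G_def sum_lists_Suc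
    by (subst sum.swap) (simp add: monomial_def sum_distrib_left sum_distrib_right mult_ac)
  ultimately show ?thesis by (simp add: has_field_derivative_def)
qed

lemma sum_lists_group_mset:
  "(\<Sum>is | length is = m. monomial h (mset is) * iter_partial is f v) =
   (\<Sum>\<alpha> | size \<alpha> = m. monomial h \<alpha> * (\<Sum>is | mset is = \<alpha>. iter_partial is f v))"
proof -
  have "finite {\<alpha> :: 'k::finite multiset. size \<alpha> = m}"
    by (rule finite_subset[OF _ finite_multisets_size_le[of m]]) auto
  then have "(\<Sum>is | length is = m. monomial h (mset is) * iter_partial is f v) =
    (\<Sum>\<alpha> | size \<alpha> = m. \<Sum>is | is \<in> {is. length is = m} \<and> mset is = \<alpha>. monomial h (mset is) * iter_partial is f v)"
    by (subst sum.group) (auto intro: finite_lists_length)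
  also have "\<dots> = (\<Sum>\<alpha> | size \<alpha> = m. monomial h \<alpha> * (\<Sum>is | mset is = \<alpha>. iter_partial is f v))"
    by (rule sum.cong[OF refl]) (auto simp: sum_distrib_left intro!: sum.cong)
  finally show ?thesis .
qed

text \<open>This is the one-variable Maclaurin formula along the segment, with words of equal
  content collected into one monomial. The remainder has one term for each word of length
  \<open>Suc n\<close>, which accounts for the power of \<open>CARD('k)\<close>; its factorial is
  simply bounded below by 1.\<close>

theorem taylor_multi:
  fixes f :: "real ^ 'k::finite \<Rightarrow> real"
  assumes "smooth_on U f" "open U"
    and seg: "\<And>t. 0 \<le> t \<Longrightarrow> t \<le> 1 \<Longrightarrow> v + t *\<^sub>R h \<in> U"
    and bnd: "\<And>t is. 0 \<le> t \<Longrightarrow> t \<le> 1 \<Longrightarrow> length is = Suc n \<Longrightarrow> \<bar>iter_partial is f (v + t *\<^sub>R h)\<bar> \<le> C"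
    and h: "\<And>i. \<bar>h $ i\<bar> \<le> \<eta>"
  shows "\<bar>f (v + h) - (\<Sum>\<alpha> | size \<alpha> \<le> n. monomial h \<alpha> * taylor_coeff f v \<alpha>)\<bar>
    \<le> C * (real CARD('k) * \<eta>) ^ Suc n"
proof -
  define G where "G = (\<lambda>m t. \<Sum>is | length is = m. monomial h (mset is) * iter_partial is f (v + t *\<^sub>R h))"
  have D: "\<forall>m t. m < Suc n \<and> 0 \<le> t \<and> t \<le> 1 \<longrightarrow> DERIV (G m) t :> G (Suc m) t"
    unfolding G_def using line_deriv_iter[OF assms(1,2) seg] by blast
  obtain t where t: "0 < t" "t < 1"
    and eq: "G 0 1 = (\<Sum>m<Suc n. G m 0 / fact m * 1 ^ m) + G (Suc n) t / fact (Suc n) * 1 ^ Suc n"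
    using Maclaurin[OF _ _ refl D] by auto
  have G01: "G 0 1 = f (v + h)"
    unfolding G_def by (simp add: monomial_def)
  have "(\<Sum>m<Suc n. G m 0 / fact m * 1 ^ m) = (\<Sum>m\<le>n. \<Sum>\<alpha> | size \<alpha> = m. monomial h \<alpha> * taylor_coeff f v \<alpha>)"
    unfolding lessThan_Suc_atMost
  proof (rule sum.cong[OF refl])
    fix m
    have "G m 0 / fact m * 1 ^ m =
        (\<Sum>\<alpha> | size \<alpha> = m. monomial h \<alpha> * (\<Sum>is | mset is = \<alpha>. iter_partial is f v)) / fact m"
      unfolding G_def using sum_lists_group_mset[where m = m and h = h and f = f and v = v] by simp
    also have "\<dots> = (\<Sum>\<alpha> | size \<alpha> = m. monomial h \<alpha> * taylor_coeff f v \<alpha>)"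
      unfolding sum_divide_distrib by (rule sum.cong[OF refl]) (simp add: taylor_coeff_def)
    finally show "G m 0 / fact m * 1 ^ m = (\<Sum>\<alpha> | size \<alpha> = m. monomial h \<alpha> * taylor_coeff f v \<alpha>)" .
  qed
  also have "\<dots> = (\<Sum>\<alpha> | size \<alpha> \<le> n. monomial h \<alpha> * taylor_coeff f v \<alpha>)"
  proof -
    have "(\<Sum>m\<le>n. \<Sum>\<alpha> | \<alpha> \<in> {\<alpha>. size \<alpha> \<le> n} \<and> size \<alpha> = m. monomial h \<alpha> * taylor_coeff f v \<alpha>) =
        (\<Sum>\<alpha> | size \<alpha> \<le> n. monomial h \<alpha> * taylor_coeff f v \<alpha>)"
      by (rule sum.group) (auto intro: finite_multisets_size_le)
    moreover have "{\<alpha>. \<alpha> \<in> {\<alpha> :: 'k multiset. size \<alpha> \<le> n} \<and> size \<alpha> = m} = {\<alpha>. size \<alpha> = m}" if "m \<le> n" for m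
      using that by auto
    ultimately show ?thesis by simp
  qed
  finally have "f (v + h) - (\<Sum>\<alpha> | size \<alpha> \<le> n. monomial h \<alpha> * taylor_coeff f v \<alpha>) = G (Suc n) t / fact (Suc n)"
    using eq G01 by simp
  moreover have "\<bar>G (Suc n) t / fact (Suc n)\<bar> \<le> \<bar>G (Suc n) t\<bar>"
  proof -
    have "1 \<le> (fact (Suc n) :: real)" by (rule fact_ge_1)
    then show ?thesis
      using divide_left_mono[of 1 "fact (Suc n)" "\<bar>G (Suc n) t\<bar>"] by (simp add: abs_divide del: fact_Suc)
  qed
  moreover have "\<bar>G (Suc n) t\<bar> \<le> C * (real CARD('k) * \<eta>) ^ Suc n"
  proof -
    have "\<bar>monomial h (mset is) * iter_partial is f (v + t *\<^sub>R h)\<bar> \<le> \<eta> ^ Suc n * C"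
      if "length is = Suc n" for "is"
    proof -
      have "\<bar>monomial h (mset is)\<bar> \<le> \<eta> ^ Suc n"
        using abs_monomial_le[of h \<eta> "mset is"] h that by simp
      moreover have "\<bar>iter_partial is f (v + t *\<^sub>R h)\<bar> \<le> C"
        using bnd t that by auto
      ultimately show ?thesis
        unfolding abs_mult by (intro mult_mono) auto
    qed
    then have "\<bar>G (Suc n) t\<bar> \<le> (\<Sum>is | length (is :: 'k list) = Suc n. \<eta> ^ Suc n * C)"
      unfolding G_def by (intro order_trans[OF sum_abs] sum_mono) auto
    also have "\<dots> = C * (real CARD('k) * \<eta>) ^ Suc n"
      by (simp add: card_lists_length power_mult_distrib mult_ac del: power_Suc)
    finally show ?thesis .
  qed
  ultimately show ?thesis by linarith
qed

section \<open>Rational points in a small cube lie on a hyperplane\<close>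

lemma abs_det_le:
  fixes A :: "real ^ 'n ^ 'n::finite"
  assumes "\<And>i j. \<bar>A $ i $ j\<bar> \<le> B i"
  shows "\<bar>det A\<bar> \<le> fact CARD('n) * (\<Prod>i\<in>UNIV. B i)"
proof -
  have "\<bar>det A\<bar> \<le> (\<Sum>p | p permutes (UNIV :: 'n set). \<Prod>i\<in>UNIV. B i)"
    unfolding det_def
  proof (intro order_trans[OF sum_abs] sum_mono)
    fix p :: "'n \<Rightarrow> 'n"
    have "\<bar>of_int (sign p)\<bar> = (1::real)"
      by (simp add: sign_def)
    then show "\<bar>of_int (sign p) * (\<Prod>i\<in>UNIV. A $ i $ p i)\<bar> \<le> (\<Prod>i\<in>UNIV. B i)"
      by (simp add: abs_mult abs_prod prod_mono assms)
  qed
  also have "\<dots> = fact CARD('n) * (\<Prod>i\<in>UNIV. B i)"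
    by (simp add: card_permutations[OF refl])
  finally show ?thesis .
qed

text \<open>Multilinearity in all rows at once: f records which summand is taken from each
  row.\<close>

lemma det_rows_sum:
  fixes a :: "'n::finite \<Rightarrow> 'b \<Rightarrow> 'a::comm_ring_1 ^ 'n"
  assumes "finite S"
  shows "det (\<chi> i. sum (a i) S) = (\<Sum>f | \<forall>i. f i \<in> S. det (\<chi> i. a i (f i)))"
proof -
  have PiE: "{f. \<forall>i. f i \<in> S} = PiE (UNIV :: 'n set) (\<lambda>_. S)"
    by (auto simp: PiE_def)
  have "det (\<chi> i. sum (a i) S) = (\<Sum>p | p permutes (UNIV :: 'n set).
      of_int (sign p) * (\<Sum>f\<in>PiE UNIV (\<lambda>_. S). \<Prod>i\<in>UNIV. a i (f i) $ p i))"
    unfolding det_def by (simp add: sum_component prod_sum_PiE assms)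
  also have "\<dots> = (\<Sum>f | \<forall>i. f i \<in> S. det (\<chi> i. a i (f i)))"
    unfolding det_def PiE sum_distrib_left by (subst sum.swap) simp
  finally show ?thesis .
qed

text \<open>\<open>Some \<alpha>\<close> stands for a Taylor term and \<open>None\<close> for the
  remainder. The value is the power of \<rho> that the corresponding summand of a row contributes in
  a cube of size \<rho>.\<close>

fun opt_deg :: "nat \<Rightarrow> 'k multiset option \<Rightarrow> nat" where
  "opt_deg n None = Suc n"
| "opt_deg n (Some \<alpha>) = size \<alpha>"

lemma card_multisets_size:
  "card {\<alpha> :: 'k::finite multiset. size \<alpha> = j} = br (CARD('k) - 1) j"
proof -
  have "0 < CARD('k)" by simp
  then have "CARD('k) + j - 1 = CARD('k) - 1 + j" by linarith
  then show ?thesis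
    using card_multisets_of_size[of "UNIV :: 'k set" j] by (simp add: multisets_of_size_def br_def)
qed

text \<open>The sum \<open>\<Sum>\<^sub>i (n + 1 - deg \<sigma>\<^sub>i)\<close> runs over distinct multi-indices, so it is at most the same sum
  over all multi-indices of size at most \<open>n\<close>.\<close>

lemma sum_opt_deg_ge:
  fixes \<sigma> :: "'e::finite \<Rightarrow> 'k::finite multiset option"
  assumes range: "\<And>i. opt_deg n (\<sigma> i) \<le> Suc n"
    and inj: "\<And>i j \<alpha>. \<sigma> i = Some \<alpha> \<Longrightarrow> \<sigma> j = Some \<alpha> \<Longrightarrow> i = j"
    and card: "CARD('e) = Suc ((\<Sum>j=1..n. br (CARD('k) - 1) j) + m)"
  shows "(\<Sum>j=1..n. j * br (CARD('k) - 1) j) + Suc n * m \<le> (\<Sum>i\<in>UNIV. opt_deg n (\<sigma> i))"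
proof -
  let ?b = "br (CARD('k) - 1)"
  let ?I = "{i. \<sigma> i \<noteq> None}"
  have "(\<Sum>i\<in>UNIV. Suc n - opt_deg n (\<sigma> i)) = (\<Sum>i\<in>?I. Suc n - opt_deg n (\<sigma> i))"
    by (rule sum.mono_neutral_right) auto
  also have "\<dots> = (\<Sum>i\<in>?I. Suc n - size (the (\<sigma> i)))"
    by (intro sum.cong) auto
  also have "\<dots> = (\<Sum>\<alpha>\<in>(\<lambda>i. the (\<sigma> i)) ` ?I. Suc n - size \<alpha>)"
    by (subst sum.reindex) (auto intro!: inj_onI dest: inj)
  also have "\<dots> \<le> (\<Sum>\<alpha> | size (\<alpha> :: 'k multiset) \<le> Suc n. Suc n - size \<alpha>)"
  proof (rule sum_mono2)
    show "(\<lambda>i. the (\<sigma> i)) ` ?I \<subseteq> {\<alpha>. size \<alpha> \<le> Suc n}"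
    proof clarify
      fix i \<alpha> assume "\<sigma> i = Some \<alpha>"
      then show "size (the (\<sigma> i)) \<le> Suc n" using range[of i] by simp
    qed
  qed (auto intro: finite_multisets_size_le)
  also have "\<dots> = (\<Sum>j\<le>Suc n. \<Sum>\<alpha> | \<alpha> \<in> {\<alpha> :: 'k multiset. size \<alpha> \<le> Suc n} \<and> size \<alpha> = j. Suc n - size \<alpha>)"
    by (rule sum.group[symmetric]) (auto intro: finite_multisets_size_le)
  also have "\<dots> = (\<Sum>j\<le>Suc n. (Suc n - j) * ?b j)"
  proof (rule sum.cong[OF refl])
    fix j assume "j \<in> {..Suc n}"
    then have "{\<alpha>. \<alpha> \<in> {\<alpha> :: 'k multiset. size \<alpha> \<le> Suc n} \<and> size \<alpha> = j} = {\<alpha>. size \<alpha> = j}" by auto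
    then show "(\<Sum>\<alpha> | \<alpha> \<in> {\<alpha> :: 'k multiset. size \<alpha> \<le> Suc n} \<and> size \<alpha> = j. Suc n - size \<alpha>) = (Suc n - j) * ?b j"
      using card_multisets_size[where 'k = 'k, of j] by (simp add: mult.commute)
  qed
  \<comment> \<open>The empty multi-index contributes \<open>Suc n\<close>. This is balanced by the
    extra 1 in \<open>card\<close>, which is there because d+1 rows are used for d
    coordinates.\<close>
  also have "\<dots> = Suc n + (\<Sum>j=1..n. (Suc n - j) * ?b j)"
    by (simp add: atMost_atLeast0 sum.atLeast_Suc_atMost br_def)
  finally have 1: "(\<Sum>i\<in>UNIV. Suc n - opt_deg n (\<sigma> i)) \<le> Suc n + (\<Sum>j=1..n. (Suc n - j) * ?b j)" .
  have "(\<Sum>i\<in>UNIV. Suc n - opt_deg n (\<sigma> i)) + (\<Sum>i\<in>UNIV. opt_deg n (\<sigma> i)) = (\<Sum>i\<in>(UNIV :: 'e set). Suc n)"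
    unfolding sum.distrib[symmetric] using range by (intro sum.cong) auto
  also have "\<dots> = Suc ((\<Sum>j=1..n. ?b j) + m) * Suc n"
    by (simp only: sum_constant card of_nat_id)
  finally have 2: "(\<Sum>i\<in>UNIV. Suc n - opt_deg n (\<sigma> i)) + (\<Sum>i\<in>UNIV. opt_deg n (\<sigma> i)) = Suc n + Suc n * (\<Sum>j=1..n. ?b j) + Suc n * m"
    by (simp only: mult_Suc mult.commute[of _ "Suc n"] distrib_left) (simp add: algebra_simps)
  have 3: "(\<Sum>j=1..n. (Suc n - j) * ?b j) + (\<Sum>j=1..n. j * ?b j) = Suc n * (\<Sum>j=1..n. ?b j)"
    unfolding sum.distrib[symmetric] sum_distrib_left
    by (rule sum.cong[OF refl]) (auto simp: add_mult_distrib[symmetric] simp del: mult_Suc)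
  show ?thesis using 1 2 3 by linarith
qed

text \<open>After expansion, a choice of summands \<sigma> contributes \<rho> to the power of the
  sum of the degrees in \<sigma>. Choices that repeat a monomial vanish, and
  \<open>sum_opt_deg_ge\<close> bounds the exponent below for the others; \<rho> \<le> 1 turns this
  into an upper bound. The constant is the number of choices times a crude Leibniz bound.\<close>

lemma det_taylor_rows_le:
  fixes c :: "'k::finite multiset \<Rightarrow> real ^ 'e::finite" and h :: "'e \<Rightarrow> real ^ 'k" and R :: "'e \<Rightarrow> real ^ 'e"
  assumes h: "\<And>i j. \<bar>h i $ j\<bar> \<le> \<rho>" and \<rho>: "0 \<le> \<rho>" "\<rho> \<le> 1" and K: "0 \<le> K"
    and c: "\<And>\<alpha> j. size \<alpha> \<le> n \<Longrightarrow> \<bar>c \<alpha> $ j\<bar> \<le> K"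
    and R: "\<And>i j. \<bar>R i $ j\<bar> \<le> K * \<rho> ^ Suc n"
    and card: "CARD('e) = Suc ((\<Sum>j=1..n. br (CARD('k) - 1) j) + m)"
  defines "S \<equiv> insert None (Some ` {\<alpha> :: 'k multiset. size \<alpha> \<le> n})"
  shows "\<bar>det (\<chi> i. (\<Sum>\<alpha> | size \<alpha> \<le> n. monomial (h i) \<alpha> *\<^sub>R c \<alpha>) + R i)\<bar>
    \<le> real (card {\<sigma> :: 'e \<Rightarrow> 'k multiset option. \<forall>i. \<sigma> i \<in> S}) * (fact CARD('e) * K ^ CARD('e))
        * \<rho> ^ ((\<Sum>j=1..n. j * br (CARD('k) - 1) j) + Suc n * m)"
proof -
  let ?N = "(\<Sum>j=1..n. j * br (CARD('k) - 1) j) + Suc n * m"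
  define u where "u = (\<lambda>i \<beta>. case \<beta> of None \<Rightarrow> 1 | Some \<alpha> \<Rightarrow> monomial (h i) \<alpha>)"
  define b where "b = (\<lambda>i \<beta>. case \<beta> of None \<Rightarrow> R i | Some \<alpha> \<Rightarrow> c \<alpha>)"
  have finS: "finite S" unfolding S_def by (simp add: finite_multisets_size_le)
  have row: "(\<Sum>\<alpha> | size \<alpha> \<le> n. monomial (h i) \<alpha> *\<^sub>R c \<alpha>) + R i = (\<Sum>\<beta>\<in>S. u i \<beta> *s b i \<beta>)" for i
    unfolding S_def
    by (subst sum.insert)
      (auto simp: finite_multisets_size_le sum.reindex u_def b_def scalar_mult_eq_scaleR)
  have "det (\<chi> i. (\<Sum>\<alpha> | size \<alpha> \<le> n. monomial (h i) \<alpha> *\<^sub>R c \<alpha>) + R i) =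
     (\<Sum>\<sigma> | \<forall>i. \<sigma> i \<in> S. det (\<chi> i. u i (\<sigma> i) *s b i (\<sigma> i)))"
    unfolding row by (rule det_rows_sum[OF finS])
  also have "\<bar>\<dots>\<bar> \<le> (\<Sum>\<sigma> | \<forall>i. \<sigma> (i :: 'e) \<in> S. (fact CARD('e) * K ^ CARD('e)) * \<rho> ^ ?N)"
  proof (intro order_trans[OF sum_abs] sum_mono)
    fix \<sigma> assume "\<sigma> \<in> {\<sigma> :: 'e \<Rightarrow> 'k multiset option. \<forall>i. \<sigma> i \<in> S}"
    then have \<sigma>: "\<sigma> i \<in> S" for i by simp
    show "\<bar>det (\<chi> i. u i (\<sigma> i) *s b i (\<sigma> i))\<bar> \<le> (fact CARD('e) * K ^ CARD('e)) * \<rho> ^ ?N"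
    proof (cases "\<exists>i j \<alpha>. \<sigma> i = Some \<alpha> \<and> \<sigma> j = Some \<alpha> \<and> i \<noteq> j")
      case True
      then obtain i j \<alpha> where "\<sigma> i = Some \<alpha>" "\<sigma> j = Some \<alpha>" and ij: "i \<noteq> j" by blast
      \<comment> \<open>The coefficient vector \<open>c \<alpha>\<close> does not depend on the row,
        so a repeated monomial gives two equal rows once the scalars are pulled out. Remainders do
        depend on the row and may be repeated.\<close>
      then have "row i (\<chi> i. b i (\<sigma> i)) = row j (\<chi> i. b i (\<sigma> i))"
        by (simp add: row_def b_def)
      from det_identical_rows[OF ij this] show ?thesis
        using K \<rho> by (simp add: det_rows_mul)
    next
      case False
      \<comment> \<open>Monomials carry their power of \<rho> in the scalar u, remainders carry it
        in the vector b; w isolates the latter.\<close>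
      define w where "w = (\<lambda>i. case \<sigma> i of None \<Rightarrow> \<rho> ^ Suc n | Some \<alpha> \<Rightarrow> 1)"
      have deg: "opt_deg n (\<sigma> i) \<le> Suc n" for i
        using \<sigma>[of i] unfolding S_def by auto
      have "\<bar>b i (\<sigma> i) $ j\<bar> \<le> K * w i" for i j
        using \<sigma>[of i] R[of i j] c unfolding S_def w_def b_def by auto
      then have "\<bar>det (\<chi> i. b i (\<sigma> i))\<bar> \<le> fact CARD('e) * (\<Prod>i\<in>UNIV. K * w i)"
        by (intro abs_det_le) simp
      moreover have w: "\<bar>\<Prod>i\<in>UNIV. u i (\<sigma> i)\<bar> * (\<Prod>i\<in>UNIV. w i) \<le> \<rho> ^ ?N"
      proof -
        have w0: "0 \<le> w i" for i unfolding w_def using \<rho> by (auto split: option.split)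
        have "\<bar>u i (\<sigma> i)\<bar> * w i \<le> \<rho> ^ opt_deg n (\<sigma> i)" for i
          unfolding u_def w_def using abs_monomial_le[of "h i" \<rho>] h by (auto split: option.split)
        then have "(\<Prod>i\<in>UNIV. \<bar>u i (\<sigma> i)\<bar> * w i) \<le> (\<Prod>i\<in>UNIV. \<rho> ^ opt_deg n (\<sigma> i))"
          using w0 by (intro prod_mono) auto
        also have "\<dots> = \<rho> ^ (\<Sum>i\<in>UNIV. opt_deg n (\<sigma> i))"
          by (simp add: power_sum)
        also have "\<dots> \<le> \<rho> ^ ?N"
          using False by (intro power_decreasing sum_opt_deg_ge[OF deg _ card] \<rho>) auto
        finally show ?thesis by (simp add: prod.distrib abs_prod)
      qed
      ultimately have "\<bar>\<Prod>i\<in>UNIV. u i (\<sigma> i)\<bar> * \<bar>det (\<chi> i. b i (\<sigma> i))\<bar>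
          \<le> \<bar>\<Prod>i\<in>UNIV. u i (\<sigma> i)\<bar> * (fact CARD('e) * (\<Prod>i\<in>UNIV. K * w i))"
        by (intro mult_left_mono) auto
      also have "\<dots> = fact CARD('e) * K ^ CARD('e) * (\<bar>\<Prod>i\<in>UNIV. u i (\<sigma> i)\<bar> * (\<Prod>i\<in>UNIV. w i))"
        by (simp add: prod.distrib)
      also have "\<dots> \<le> (fact CARD('e) * K ^ CARD('e)) * \<rho> ^ ?N"
        using K w by (intro mult_left_mono) auto
      finally show ?thesis by (simp add: det_rows_mul abs_mult)
    qed
  qed
  finally show ?thesis by (simp add: mult.assoc)
qed

section \<open>Reduced forms and heights\<close>

lemma is_reduced_form_dvd:
  assumes "is_reduced_form r p q" "is_reduced_form r p' q'"
  shows "q dvd q'"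
proof -
  \<comment> \<open>Cross-multiplying shows that q divides q' times each of q and the numerators,
    hence q' times their gcd, which is 1. By symmetry two reduced denominators agree, so
    \<open>height\<close> is well defined.\<close>
  have "int q dvd int q' * z" if z: "z \<in> insert (int q) (range p)" for z
  proof (cases "z = int q")
    case False
    then obtain i where i: "z = p i" using z by blast
    have "of_int (p i) / real q = of_int (p' i) / real q'" "q > 0" "q' > 0"
      using assms unfolding is_reduced_form_def by metis+
    then have "of_int (int q' * p i) = (of_int (int q * p' i) :: real)"
      by (simp add: field_simps)
    then have "int q' * p i = int q * p' i" by linarith
    then show ?thesis using i by simp
  qed simp
  then have "int q dvd Gcd ((*) (int q') ` insert (int q) (range p))"
    by (intro Gcd_greatest) blast
  also have "\<dots> = int q' * 1"
    using assms(1) unfolding is_reduced_form_def by (subst Gcd_mult) simp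
  finally show ?thesis by simp
qed

lemma reduced_form_exists:
  fixes r :: "real ^ 'd"
  assumes "r \<in> rat_points"
  shows "\<exists>p q. is_reduced_form r p q"
proof -
  have "\<forall>i. \<exists>a b. b > 0 \<and> r $ i = of_int a / of_nat b"
  proof
    fix i
    have "r $ i \<in> \<rat>" using assms by (simp add: rat_points_def)
    then obtain a b where "b > 0" "r $ i = of_int a / of_int b"
      using Rats_cases' by metis
    then show "\<exists>a b. b > 0 \<and> r $ i = of_int a / of_nat b"
      by (intro exI[of _ a] exI[of _ "nat b"]) simp
  qed
  then obtain a b where ab: "\<And>i. b i > 0" "\<And>i. r $ i = of_int (a i) / of_nat (b i)"
    by metis
  define Q where "Q = (\<Prod>i\<in>UNIV. b i)"
  have Q0: "Q > 0" unfolding Q_def by (intro prod_pos) (use ab in auto)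
  have Qi: "\<exists>z. real Q * r $ i = of_int z" for i
  proof -
    have "b i dvd Q" unfolding Q_def by (intro dvd_prodI) auto
    then obtain c where "Q = b i * c" by (auto simp: dvd_def)
    then have "real Q * r $ i = of_int (int c * a i)"
      using ab(1)[of i] unfolding ab(2)[of i] by simp
    then show ?thesis by blast
  qed
  \<comment> \<open>The least common denominator of the coordinates. Dividing it by the gcd g of q
    and the numerators gives another common denominator, so minimality forces g = 1.\<close>
  define q where "q = (LEAST q. q > 0 \<and> (\<forall>i. \<exists>z. real q * r $ i = of_int z))"
  have q: "q > 0 \<and> (\<forall>i. \<exists>z. real q * r $ i = of_int z)"
    unfolding q_def by (rule LeastI[of _ Q]) (use Q0 Qi in blast)
  have q_le: "q \<le> q'" if "q' > 0 \<and> (\<forall>i. \<exists>z. real q' * r $ i = of_int z)" for q'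
    unfolding q_def using that by (rule Least_le)
  obtain p where p: "\<And>i. real q * r $ i = of_int (p i)" using q by metis
  define g where "g = Gcd (insert (int q) (range p))"
  have g0: "g \<ge> 0" unfolding g_def by simp
  have gp: "g dvd p i" for i unfolding g_def by (rule Gcd_dvd) simp
  have "g dvd int q" unfolding g_def by (rule Gcd_dvd) simp
  then obtain q' where q': "int q = g * q'" by (auto simp: dvd_def)
  then have "g > 0" "q' > 0"
    using q g0 by (metis of_nat_0_less_iff mult_zero_left order_le_less less_irrefl, metis of_nat_0_less_iff g0 zero_less_mult_pos order_le_less mult_zero_left less_irrefl)
  have "real (nat q') * r $ i = of_int (p i div g)" for i
  proof -
    obtain c where c: "p i = g * c" using gp[of i] by (auto simp: dvd_def)
    have "real q = of_int g * of_int q'" using q' by (metis of_int_mult of_int_of_nat_eq)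
    then have "of_int g * (of_int q' * r $ i) = (of_int g * of_int c :: real)"
      using p[of i] c by (simp add: mult.assoc)
    then show ?thesis using \<open>g > 0\<close> \<open>q' > 0\<close> c by simp
  qed
  then have "q \<le> nat q'" using \<open>q' > 0\<close> by (intro q_le) auto
  then have "g * q' \<le> q'" using q' \<open>q' > 0\<close> by linarith
  then have "g = 1" using \<open>g > 0\<close> \<open>q' > 0\<close> by (simp add: mult_le_cancel_right2)
  then have "is_reduced_form r p q"
    using q p unfolding is_reduced_form_def g_def by (auto simp: field_simps)
  then show ?thesis by blast
qed

lemma height_reduced:
  fixes r :: "real ^ 'd"
  assumes "r \<in> rat_points"
  shows "\<exists>p. is_reduced_form r p (height r)"
proof -
  obtain p q where pq: "is_reduced_form r p q" using reduced_form_exists[OF assms] by blast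
  have "q' = q" if "\<exists>p. is_reduced_form r p q'" for q'
    using that is_reduced_form_dvd pq dvd_antisym by metis
  then show ?thesis
    unfolding height_def using pq by (rule_tac theI[where P = "\<lambda>q. \<exists>p. is_reduced_form r p q"]) blast+
qed

lemma height_pos: "r \<in> rat_points \<Longrightarrow> 0 < height r"
  using height_reduced unfolding is_reduced_form_def by metis

text \<open>This integrality is used twice: to make the determinants below integers, and to confine
  points of bounded height to a closed lattice.\<close>

lemma height_mult_Ints:
  assumes "r \<in> rat_points"
  shows "real (height r) * r $ i \<in> \<int>"
proof -
  obtain p where "is_reduced_form r p (height r)" using height_reduced[OF assms] by blast
  then have "real (height r) * r $ i = of_int (p i)"
    unfolding is_reduced_form_def by simp
  then show ?thesis by simp
qed

section \<open>The decomposition behind the exponent\<close>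

lemma br_pos: "0 < br n m"
  by (simp add: br_def)

text \<open>\<open>GREATEST\<close> and \<open>THE\<close> in the definitions return meaningful
  values here: n = 1 is a candidate because \<open>br (k - 1) 1 = k\<close> and k \<le> d, and every
  candidate is at most d because all summands are positive.\<close>

lemma kd_decomposition:
  assumes "1 \<le> k" "k \<le> d"
  shows "n_kd k d \<ge> 1" "d = (\<Sum>j=1..n_kd k d. br (k - 1) j) + m_kd k d" "N_kd k d \<ge> 1"
proof -
  let ?P = "\<lambda>n. n \<ge> 1 \<and> (\<exists>m. d = (\<Sum>j=1..n. br (k - 1) j) + m)"
  have "br (k - 1) 1 = k" using assms by (simp add: br_def)
  then have "?P 1" using assms by (auto simp: le_iff_add)
  moreover have "n \<le> d" if "?P n" for n
  proof -
    have "n = (\<Sum>j=1..n. 1)" by simp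
    also have "\<dots> \<le> (\<Sum>j=1..n. br (k - 1) j)"
      by (intro sum_mono) (simp add: Suc_leI br_pos)
    finally show ?thesis using that by auto
  qed
  ultimately have P: "?P (n_kd k d)"
    unfolding n_kd_def by (intro GreatestI_nat[of ?P 1 d]) auto
  then show 1: "n_kd k d \<ge> 1" by simp
  obtain m where m: "d = (\<Sum>j=1..n_kd k d. br (k - 1) j) + m" using P by blast
  have "m_kd k d = m"
    unfolding m_kd_def by (rule the_equality) (use m in linarith)+
  then show "d = (\<Sum>j=1..n_kd k d. br (k - 1) j) + m_kd k d" using m by simp
  have "1 * br (k - 1) 1 \<le> (\<Sum>j=1..n_kd k d. j * br (k - 1) j)"
    by (rule member_le_sum) (use 1 in auto)
  then show "N_kd k d \<ge> 1"
    unfolding N_kd_def using br_pos[of "k - 1" 1] by linarith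
qed

section \<open>The simplex lemma\<close>

definition sball :: "real ^ 'k \<Rightarrow> real \<Rightarrow> (real ^ 'k) set" where
  "sball v \<rho> = {x. \<forall>i. \<bar>x $ i - v $ i\<bar> \<le> \<rho>}"

text \<open>Homogeneous coordinates: points lie on a common affine hyperplane as soon as their lifts
  fail to span the whole space. The type \<open>'d option\<close> provides the d+1
  coordinates.\<close>

definition lift_affine :: "real ^ 'd \<Rightarrow> real ^ ('d option)" where
  "lift_affine y = (\<chi> a. case a of None \<Rightarrow> 1 | Some j \<Rightarrow> y $ j)"

lemma det_lift_affine_le:
  fixes \<Phi> :: "real ^ 'k::finite \<Rightarrow> real ^ 'd::finite"
  assumes sm: "smooth_on U \<Phi>" and U: "open U"
    and kd: "CARD('k) \<le> CARD('d)" and C0: "0 \<le> C0"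
    and bnd: "\<And>is x j. x \<in> W \<Longrightarrow> length is \<le> Suc (n_kd CARD('k) CARD('d)) \<Longrightarrow> \<bar>iter_partial is \<Phi> x $ j\<bar> \<le> C0"
    and W: "W \<subseteq> U"
  shows "\<exists>C>0. \<forall>v \<rho> u. 0 \<le> \<rho> \<longrightarrow> \<rho> \<le> 1 \<longrightarrow> sball v \<rho> \<subseteq> W \<longrightarrow> (\<forall>a. u a \<in> sball v \<rho>) \<longrightarrow>
     \<bar>det (\<chi> a. lift_affine (\<Phi> (u a)))\<bar> \<le> C * \<rho> ^ N_kd CARD('k) CARD('d)"
proof -
  let ?k = "CARD('k)" and ?d = "CARD('d)"
  define n m where "n = n_kd ?k ?d" and "m = m_kd ?k ?d"
  have k1: "1 \<le> ?k" by (simp add: Suc_leI)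
  note decomp = kd_decomposition[OF k1 kd, folded n_def m_def]
  have card: "CARD('d option) = Suc ((\<Sum>j=1..n. br (?k - 1) j) + m)"
    using decomp(2) by simp
  \<comment> \<open>A Taylor coefficient sums over at most \<open>CARD('k) ^ Suc n\<close> words,
    and the same number is the constant of the remainder in \<open>taylor_multi\<close>. The summand
    1 serves the constant coordinate.\<close>
  define K where "K = 1 + C0 * real ?k ^ Suc n"
  have K: "0 \<le> K" unfolding K_def using C0 by simp
  define D where "D = real (card {\<sigma> :: 'd option \<Rightarrow> 'k multiset option. \<forall>i. \<sigma> i \<in> insert None (Some ` {\<alpha>. size \<alpha> \<le> n})})
      * (fact CARD('d option) * K ^ CARD('d option))"
  have D: "0 \<le> D" unfolding D_def using K by simp
  have comp: "iter_partial is (\<lambda>x. \<Phi> x $ j) x = iter_partial is \<Phi> x $ j" if "x \<in> U" for "is" x j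
    using iter_partial_bounded_linear[OF bounded_linear_vec_nth sm U that] by simp
  have smj: "smooth_on U (\<lambda>x. \<Phi> x $ j)" for j
    using smooth_on_bounded_linear[OF bounded_linear_vec_nth sm U] by simp
  have "\<bar>det (\<chi> a. lift_affine (\<Phi> (u a)))\<bar> \<le> D * \<rho> ^ N_kd ?k ?d"
    if \<rho>: "0 \<le> \<rho>" "\<rho> \<le> 1" and sub: "sball v \<rho> \<subseteq> W" and u: "\<forall>a. u a \<in> sball v \<rho>"
    for v \<rho> and u :: "'d option \<Rightarrow> real ^ 'k"
  proof -
    define h where "h = (\<lambda>a. u a - v)"
    \<comment> \<open>The \<open>None\<close> entry is the Taylor expansion of the constant function
      1, whose remainder vanishes, so all d+1 coordinates can be treated alike.\<close>
    define c :: "'k multiset \<Rightarrow> real ^ ('d option)" where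
      "c = (\<lambda>\<alpha>. \<chi> e. case e of None \<Rightarrow> (if \<alpha> = {#} then 1 else 0) | Some j \<Rightarrow> taylor_coeff (\<lambda>x. \<Phi> x $ j) v \<alpha>)"
    define R where "R = (\<lambda>a. lift_affine (\<Phi> (u a)) - (\<Sum>\<alpha> | size \<alpha> \<le> n. monomial (h a) \<alpha> *\<^sub>R c \<alpha>))"
    have h: "\<bar>h a $ i\<bar> \<le> \<rho>" for a i
      using u unfolding h_def sball_def by simp
    have vW: "v \<in> W" using sub \<rho> by (auto simp: sball_def)
    have cb: "\<bar>c \<alpha> $ e\<bar> \<le> K" if \<alpha>: "size \<alpha> \<le> n" for \<alpha> e
    proof (cases e)
      case (Some j)
      have "\<bar>taylor_coeff (\<lambda>x. \<Phi> x $ j) v \<alpha>\<bar> \<le> \<bar>\<Sum>is | mset is = \<alpha>. iter_partial is (\<lambda>x. \<Phi> x $ j) v\<bar> / 1"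
        unfolding taylor_coeff_def abs_divide by (intro divide_left_mono) (auto simp: fact_ge_1)
      also have "\<dots> \<le> (\<Sum>is | mset is = \<alpha>. C0)"
        unfolding div_by_1
      proof (intro order_trans[OF sum_abs] sum_mono)
        fix "is" assume "is \<in> {is. mset is = \<alpha>}"
        then have "length is \<le> Suc n" using \<alpha> by (metis mem_Collect_eq size_mset le_SucI)
        then show "\<bar>iter_partial is (\<lambda>x. \<Phi> x $ j) v\<bar> \<le> C0"
          using bnd[OF vW] comp vW W unfolding n_def by (metis subsetD)
      qed
      also have "\<dots> = real (card {is. mset is = \<alpha>}) * C0" by simp
      also have "\<dots> \<le> real (?k ^ Suc n) * C0"
      proof (intro mult_right_mono C0)
        have "card {is. mset is = \<alpha>} \<le> card {is :: 'k list. length is = size \<alpha>}"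
          by (intro card_mono finite_lists_length) auto
        also have "\<dots> \<le> ?k ^ Suc n"
          unfolding card_lists_length using \<alpha> by (intro power_increasing) (auto simp: Suc_leI)
        finally show "real (card {is. mset is = \<alpha>}) \<le> real (?k ^ Suc n)" by (rule of_nat_mono)
      qed
      finally show ?thesis unfolding K_def c_def Some by (simp add: mult.commute)
    qed (simp add: c_def K_def C0)
    have Rb: "\<bar>R a $ e\<bar> \<le> K * \<rho> ^ Suc n" for a e
    proof (cases e)
      case None
      have "(\<Sum>\<alpha> | size \<alpha> \<le> n. monomial (h a) \<alpha> * (if \<alpha> = {#} then 1 else 0)) =
          (\<Sum>\<alpha> \<in> {{#}}. monomial (h a) \<alpha> * (if \<alpha> = {#} then 1 else 0))"
        by (rule sum.mono_neutral_right) (auto simp: finite_multisets_size_le)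
      also have "\<dots> = 1" by (simp add: monomial_def)
      finally have "R a $ e = 0"
        unfolding R_def c_def None by (simp add: lift_affine_def sum_component)
      then show ?thesis using K \<rho> by simp
    next
      case (Some j)
      have seg: "v + t *\<^sub>R h a \<in> W" if "0 \<le> t" "t \<le> 1" for t
      proof -
        have "\<bar>t * h a $ i\<bar> \<le> 1 * \<rho>" for i
          unfolding abs_mult using h that by (intro mult_mono) auto
        then show ?thesis using sub unfolding sball_def by auto
      qed
      have "\<bar>\<Phi> (v + h a) $ j - (\<Sum>\<alpha> | size \<alpha> \<le> n. monomial (h a) \<alpha> * taylor_coeff (\<lambda>x. \<Phi> x $ j) v \<alpha>)\<bar>
          \<le> C0 * (real ?k * \<rho>) ^ Suc n"
      proof (rule taylor_multi[OF smj U])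
        show "v + t *\<^sub>R h a \<in> U" if "0 \<le> t" "t \<le> 1" for t using seg that W by blast
        show "\<bar>iter_partial is (\<lambda>x. \<Phi> x $ j) (v + t *\<^sub>R h a)\<bar> \<le> C0"
          if "0 \<le> t" "t \<le> 1" "length is = Suc n" for t "is"
          using comp seg[OF that(1,2)] bnd that W unfolding n_def by (metis subsetD order_refl)
      qed (rule h)
      also have "\<dots> \<le> K * \<rho> ^ Suc n"
        unfolding K_def power_mult_distrib mult.assoc[symmetric]
        by (intro mult_right_mono) (use \<rho> in auto)
      finally show ?thesis
        unfolding R_def c_def Some h_def by (simp add: lift_affine_def sum_component)
    qed
    have "\<bar>det (\<chi> a. (\<Sum>\<alpha> | size \<alpha> \<le> n. monomial (h a) \<alpha> *\<^sub>R c \<alpha>) + R a)\<bar> \<le> D * \<rho> ^ N_kd ?k ?d"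
      unfolding D_def N_kd_def n_def[symmetric] m_def[symmetric] Suc_eq_plus1[symmetric]
      by (rule det_taylor_rows_le[OF h \<rho> K cb Rb card])
    then show ?thesis unfolding R_def by simp
  qed
  then have "\<forall>v \<rho> u. 0 \<le> \<rho> \<longrightarrow> \<rho> \<le> 1 \<longrightarrow> sball v \<rho> \<subseteq> W \<longrightarrow> (\<forall>a. u a \<in> sball v \<rho>) \<longrightarrow>
     \<bar>det (\<chi> a. lift_affine (\<Phi> (u a)))\<bar> \<le> (D + 1) * \<rho> ^ N_kd ?k ?d"
    by (meson order_trans mult_right_mono less_add_one order_less_imp_le zero_le_power)
  then show ?thesis using D by (intro exI[of _ "D + 1"]) auto
qed

text \<open>Multiplying each row by the height of its point clears the denominators. The result is
  an integer determinant of absolute value below 1.\<close>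

lemma det_lift_affine_eq_0:
  fixes r :: "'d option \<Rightarrow> real ^ 'd::finite"
  assumes rat: "\<And>a. r a \<in> rat_points" and ht: "\<And>a. real (height (r a)) \<le> T"
    and small: "\<bar>det (\<chi> a. lift_affine (r a))\<bar> * T ^ Suc CARD('d) < 1"
  shows "det (\<chi> a. lift_affine (r a)) = 0"
proof -
  let ?H = "\<lambda>a. real (height (r a))"
  let ?A = "\<chi> a. ?H a *s lift_affine (r a)"
  have H0: "0 < ?H a" for a using height_pos[OF rat] by simp
  have "?A $ a $ b \<in> \<int>" for a b
    using height_mult_Ints[OF rat] by (cases b) (auto simp: lift_affine_def)
  then have "det ?A \<in> \<int>"
    unfolding det_def by (intro Ints_sum Ints_mult Ints_prod) auto
  moreover have det: "det ?A = (\<Prod>a\<in>UNIV. ?H a) * det (\<chi> a. lift_affine (r a))"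
    by (rule det_rows_mul)
  moreover have "\<bar>(\<Prod>a\<in>UNIV. ?H a) * det (\<chi> a. lift_affine (r a))\<bar> < 1"
  proof -
    have "(\<Prod>a\<in>UNIV. ?H a) \<le> (\<Prod>a\<in>(UNIV :: 'd option set). T)"
      using ht by (intro prod_mono) auto
    then have "(\<Prod>a\<in>UNIV. ?H a) \<le> T ^ Suc CARD('d)" by simp
    moreover have "0 < (\<Prod>a\<in>UNIV. ?H a)" by (intro prod_pos) (use H0 in auto)
    ultimately have "\<bar>(\<Prod>a\<in>UNIV. ?H a) * det (\<chi> a. lift_affine (r a))\<bar>
        \<le> \<bar>det (\<chi> a. lift_affine (r a))\<bar> * T ^ Suc CARD('d)"
      unfolding abs_mult by (subst mult.commute, intro mult_left_mono) auto
    then show ?thesis using small by linarith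
  qed
  ultimately have "(\<Prod>a\<in>UNIV. ?H a) * det (\<chi> a. lift_affine (r a)) = 0"
    using Ints_nonzero_abs_less1 by metis
  moreover have "(\<Prod>a\<in>UNIV. ?H a) \<noteq> 0" using H0 by (simp add: less_imp_neq[symmetric])
  ultimately show ?thesis by simp
qed

text \<open>If the lifts of S spanned the whole space, a basis taken from them would form a matrix
  with nonzero determinant. So some nonzero z is orthogonal to all lifts, and its components other
  than \<open>None\<close> give the normal vector.\<close>

lemma affine_hyperplane_if_det_0:
  fixes S :: "(real ^ 'd::finite) set"
  assumes det: "\<And>r :: 'd option \<Rightarrow> real ^ 'd. (\<And>a. r a \<in> S) \<Longrightarrow> det (\<chi> a. lift_affine (r a)) = 0"
  shows "\<exists>L b. norm L = 1 \<and> (\<forall>y\<in>S. L \<bullet> y = b)"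
proof -
  have "span (lift_affine ` S) \<noteq> UNIV"
  proof
    assume sp: "span (lift_affine ` S) = UNIV"
    obtain B where B: "B \<subseteq> lift_affine ` S" "independent B" "lift_affine ` S \<subseteq> span B" "card B = dim (lift_affine ` S)"
      using basis_exists[of "lift_affine ` S"] by metis
    have "dim (lift_affine ` S) = DIM(real ^ 'd option)"
      using sp dim_eq_full by blast
    then have cB: "card B = CARD('d option)" using B(4) by simp
    have "finite B" using B(2) independent_imp_finite by blast
    then obtain f where f: "bij_betw f (UNIV :: 'd option set) B"
      using finite_same_card_bij[of "UNIV :: 'd option set" B] cB by auto
    have "\<forall>a. \<exists>y\<in>S. f a = lift_affine y"
      using bij_betw_imp_surj_on[OF f] B(1) by blast
    then obtain r where r: "\<And>a. r a \<in> S" "\<And>a. f a = lift_affine (r a)" by metis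
    have "rows (\<chi> a. lift_affine (r a)) = B"
      using bij_betw_imp_surj_on[OF f] unfolding rows_def row_def by (auto simp: r(2)[symmetric] vec_lambda_eta)
    moreover have "span B = UNIV" using sp B(3) by (metis span_minimal subspace_span top.extremum_uniqueI)
    ultimately have "det (\<chi> a. lift_affine (r a)) \<noteq> 0"
      using matrix_left_invertible_span_rows invertible_left_inverse invertible_det_nz by metis
    then show False using det[of r] r(1) by blast
  qed
  then obtain z where z: "z \<noteq> 0" "\<And>x. x \<in> lift_affine ` S \<Longrightarrow> z \<bullet> x = 0"
    using span_not_UNIV_orthogonal span_base by metis
  define L where "L = (\<chi> j. z $ Some j)"
  have inner: "z $ None + L \<bullet> y = 0" if "y \<in> S" for y
  proof -
    have "z \<bullet> lift_affine y = z $ None + L \<bullet> y"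
      unfolding inner_vec_def L_def lift_affine_def
      by (simp add: UNIV_option_conv sum.reindex)
    then show ?thesis using z(2) that by simp
  qed
  show ?thesis
  proof (cases "L = 0")
    \<comment> \<open>Then z is concentrated in the component \<open>None\<close>, where every lift
      equals 1. This is possible only for empty S, and any unit vector will do.\<close>
    case True
    have "z $ None \<noteq> 0"
    proof
      assume "z $ None = 0"
      moreover have "z $ Some j = 0" for j using True unfolding L_def by (simp add: vec_eq_iff)
      ultimately have "z $ a = 0" for a by (cases a) auto
      then show False using z(1) by (simp add: vec_eq_iff)
    qed
    then have "S = {}" using inner True by auto
    then show ?thesis by (intro exI[of _ "axis undefined 1"]) simp
  next
    case False
    have "(L /\<^sub>R norm L) \<bullet> y = - z $ None / norm L" if "y \<in> S" for y
    proof -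
      have "L \<bullet> y = - z $ None" using inner[OF that] by linarith
      then show ?thesis by (simp add: divide_inverse)
    qed
    then show ?thesis using False by (intro exI[of _ "L /\<^sub>R norm L"] exI[of _ "- z $ None / norm L"]) auto
  qed
qed

text \<open>The upper bound for the determinants comes from smoothness, the lower bound for nonzero
  ones from the heights. The smallness condition makes the two incompatible, so all determinants
  vanish.\<close>

theorem simplex_lemma:
  fixes \<Phi> :: "real ^ 'k::finite \<Rightarrow> real ^ 'd::finite"
  assumes "smooth_on U \<Phi>" "open U" "CARD('k) \<le> CARD('d)" "0 \<le> C0"
    and "\<And>is x j. x \<in> W \<Longrightarrow> length is \<le> Suc (n_kd CARD('k) CARD('d)) \<Longrightarrow> \<bar>iter_partial is \<Phi> x $ j\<bar> \<le> C0"
    and "W \<subseteq> U"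
  obtains C where "C > 0"
    "\<And>v \<rho> T. 0 < \<rho> \<Longrightarrow> \<rho> \<le> 1 \<Longrightarrow> sball v \<rho> \<subseteq> W \<Longrightarrow> 0 \<le> T \<Longrightarrow>
      C * \<rho> ^ N_kd CARD('k) CARD('d) * T ^ Suc CARD('d) < 1 \<Longrightarrow>
      \<exists>L b. norm L = 1 \<and> (\<forall>u\<in>sball v \<rho>. \<Phi> u \<in> rat_points \<longrightarrow> real (height (\<Phi> u)) \<le> T \<longrightarrow> L \<bullet> \<Phi> u = b)"
proof -
  obtain C where C: "C > 0" and det: "\<And>v \<rho> u. 0 \<le> \<rho> \<Longrightarrow> \<rho> \<le> 1 \<Longrightarrow> sball v \<rho> \<subseteq> W \<Longrightarrow> (\<And>a. u a \<in> sball v \<rho>) \<Longrightarrow>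
     \<bar>det (\<chi> a. lift_affine (\<Phi> (u a)))\<bar> \<le> C * \<rho> ^ N_kd CARD('k) CARD('d)"
    using det_lift_affine_le[OF assms(1-6)] by metis
  show thesis
  proof (rule that[OF C])
    fix v \<rho> T
    assume \<rho>: "0 < \<rho>" "\<rho> \<le> 1" "sball v \<rho> \<subseteq> W" and T: "0 \<le> T"
      and small: "C * \<rho> ^ N_kd CARD('k) CARD('d) * T ^ Suc CARD('d) < 1"
    let ?S = "{y. \<exists>u\<in>sball v \<rho>. y = \<Phi> u \<and> \<Phi> u \<in> rat_points \<and> real (height (\<Phi> u)) \<le> T}"
    have "\<exists>L b. norm L = 1 \<and> (\<forall>y\<in>?S. L \<bullet> y = b)"
    proof (rule affine_hyperplane_if_det_0)
      fix r :: "'d option \<Rightarrow> real ^ 'd" assume "\<And>a. r a \<in> ?S"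
      then obtain u where u: "\<And>a. u a \<in> sball v \<rho>" "\<And>a. r a = \<Phi> (u a)"
        "\<And>a. r a \<in> rat_points" "\<And>a. real (height (r a)) \<le> T"
        unfolding mem_Collect_eq by metis
      have "\<bar>det (\<chi> a. lift_affine (r a))\<bar> \<le> C * \<rho> ^ N_kd CARD('k) CARD('d)"
        using det[of \<rho> v u] \<rho> u(1) by (simp add: u(2)[symmetric])
      then have "\<bar>det (\<chi> a. lift_affine (r a))\<bar> * T ^ Suc CARD('d) \<le> C * \<rho> ^ N_kd CARD('k) CARD('d) * T ^ Suc CARD('d)"
        using T by (intro mult_right_mono) auto
      then have "\<bar>det (\<chi> a. lift_affine (r a))\<bar> * T ^ Suc CARD('d) < 1"
        using small by linarith
      then show "det (\<chi> a. lift_affine (r a)) = 0"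
        by (rule det_lift_affine_eq_0[OF u(3,4)])
    qed
    then show "\<exists>L b. norm L = 1 \<and> (\<forall>u\<in>sball v \<rho>. \<Phi> u \<in> rat_points \<longrightarrow> real (height (\<Phi> u)) \<le> T \<longrightarrow> L \<bullet> \<Phi> u = b)"
      by blast
  qed
qed

section \<open>Small values on the cells of a grid\<close>

definition cube :: "real ^ 'k \<Rightarrow> real \<Rightarrow> (real ^ 'k) set" where
  "cube v \<rho> = {x. \<forall>i. v $ i \<le> x $ i \<and> x $ i \<le> v $ i + \<rho>}"

definition grid :: "nat \<Rightarrow> ('k \<Rightarrow> nat) set" where
  "grid N = {f. \<forall>i. f i < N}"

definition subcorner :: "real ^ 'k \<Rightarrow> real \<Rightarrow> nat \<Rightarrow> ('k \<Rightarrow> nat) \<Rightarrow> real ^ 'k" where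
  "subcorner v \<rho> N f = (\<chi> i. v $ i + real (f i) * (\<rho> / real N))"

text \<open>The threshold shrinks like the cell side: if \<rho> times the gradient of F has size
  \<tau>, then F changes by about \<tau> / N across a cell. So these are, up to constants, the cells
  that the zero set of F can come close to.\<close>

definition near_zero_cells :: "real \<Rightarrow> real ^ 'k \<Rightarrow> real \<Rightarrow> nat \<Rightarrow> (real ^ 'k \<Rightarrow> real) \<Rightarrow> ('k \<Rightarrow> nat) set" where
  "near_zero_cells \<tau> v \<rho> N F = {f \<in> grid N. \<exists>x\<in>cube (subcorner v \<rho> N f) (\<rho> / real N). \<bar>F x\<bar> \<le> \<tau> / real N}"

lemma convex_cube: "convex (cube v \<rho>)"
proof -
  have "cube v \<rho> = cbox v (v + (\<chi> i. \<rho>))"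
    unfolding cube_def by (auto simp: mem_box_cart)
  then show ?thesis by simp
qed

lemma card_funs:
  fixes S :: "'k::finite \<Rightarrow> nat set"
  shows "card {f. \<forall>i. f i \<in> S i} = (\<Prod>i\<in>UNIV. card (S i))"
proof -
  have "{f. \<forall>i. f i \<in> S i} = PiE UNIV S" by (auto simp: PiE_def)
  then show ?thesis by (simp add: card_PiE)
qed

lemma finite_funs:
  fixes S :: "'k::finite \<Rightarrow> nat set"
  assumes "\<And>i. finite (S i)"
  shows "finite {f. \<forall>i. f i \<in> S i}"
proof -
  have "{f. \<forall>i. f i \<in> S i} = PiE UNIV S" by (auto simp: PiE_def)
  then show ?thesis using assms by (simp add: finite_PiE)
qed

lemma finite_grid: "finite (grid N :: ('k::finite \<Rightarrow> nat) set)"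
  using finite_funs[of "\<lambda>_. {..<N}"] by (simp add: grid_def)

lemma card_grid: "card (grid N :: ('k::finite \<Rightarrow> nat) set) = N ^ CARD('k)"
  using card_funs[of "\<lambda>_::'k. {..<N}"] by (simp add: grid_def)

lemma subcell_subset:
  fixes v :: "real ^ 'k::finite"
  assumes "0 < \<rho>" "0 < M" "0 < m"
  shows "cube (subcorner v \<rho> (M * m) f) (\<rho> / real (M * m)) \<subseteq> cube (subcorner v \<rho> M (\<lambda>i. f i div m)) (\<rho> / real M)"
proof
  fix x assume x: "x \<in> cube (subcorner v \<rho> (M * m) f) (\<rho> / real (M * m))"
  define \<delta> where "\<delta> = \<rho> / real (M * m)"
  have \<delta>: "\<delta> > 0" "\<rho> / real M = real m * \<delta>" using assms unfolding \<delta>_def by auto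
  show "x \<in> cube (subcorner v \<rho> M (\<lambda>i. f i div m)) (\<rho> / real M)"
    unfolding cube_def mem_Collect_eq
  proof
    fix i
    have "f i = f i div m * m + f i mod m" by simp
    then have 1: "real (f i) = real (f i div m) * real m + real (f i mod m)"
      by (metis of_nat_add of_nat_mult)
    have "f i mod m + 1 \<le> m" using assms(3) by (simp add: Suc_leI)
    then have 2: "real (f i mod m) + 1 \<le> real m" by linarith
    have "real (f i mod m) * \<delta> + \<delta> \<le> real m * \<delta>" "0 \<le> real (f i mod m) * \<delta>"
      using mult_right_mono[OF 2, of \<delta>] \<delta>(1) by (auto simp: algebra_simps)
    moreover have "v $ i + real (f i) * \<delta> \<le> x $ i" "x $ i \<le> v $ i + real (f i) * \<delta> + \<delta>"
      using x unfolding cube_def subcorner_def \<delta>_def[symmetric] by auto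
    moreover have "real (f i) * \<delta> = real (f i div m) * (real m * \<delta>) + real (f i mod m) * \<delta>"
      unfolding 1 by (simp add: algebra_simps)
    ultimately show "subcorner v \<rho> M (\<lambda>i. f i div m) $ i \<le> x $ i \<and> x $ i \<le> subcorner v \<rho> M (\<lambda>i. f i div m) $ i + \<rho> / real M"
      unfolding subcorner_def \<delta>(2) vec_lambda_beta by linarith
  qed
qed

lemma subcell_subset_cube:
  fixes v :: "real ^ 'k::finite"
  assumes "0 < \<rho>" "0 < N" "f \<in> grid N"
  shows "cube (subcorner v \<rho> N f) (\<rho> / real N) \<subseteq> cube v \<rho>"
proof -
  have "f i div N = 0" for i using assms(3) by (simp add: grid_def)
  then show ?thesis
    using subcell_subset[of \<rho> 1 N v f] assms by (simp add: subcorner_def vec_lambda_eta)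
qed

lemma card_fibers_le:
  assumes "finite S" "\<And>y. y \<in> g ` S \<Longrightarrow> card {x \<in> S. g x = y} \<le> R" "g ` S \<subseteq> T" "finite T"
  shows "card S \<le> R * card T"
proof -
  have "card S = (\<Sum>y\<in>g ` S. card {x \<in> S. g x = y})"
    using sum.image_gen[OF assms(1), of "\<lambda>_. 1::nat" g] by simp
  also have "\<dots> \<le> R * card (g ` S)"
    using sum_bounded_above[of "g ` S" "\<lambda>y. card {x \<in> S. g x = y}" R] assms(2) by (simp add: mult.commute)
  also have "\<dots> \<le> R * card T"
    by (intro mult_left_mono card_mono assms) simp
  finally show ?thesis .
qed

lemma card_diam_le:
  fixes S :: "nat set"
  assumes "\<And>a b. a \<in> S \<Longrightarrow> b \<in> S \<Longrightarrow> a \<le> b + R"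
  shows "card S \<le> R + 1"
proof (cases "S = {}")
  case False
  define a where "a = (LEAST a. a \<in> S)"
  have a: "a \<in> S" unfolding a_def using False by (auto intro: LeastI)
  have "S \<subseteq> {a..a + R}"
    using assms[OF _ a] Least_le[of "\<lambda>a. a \<in> S"] unfolding a_def by auto
  from card_mono[OF _ this] show ?thesis by simp
qed simp

text \<open>By the mean value theorem in direction \<open>i\<close>, two cells of the same column with small values of
  \<open>F\<close> cannot be far apart where \<open>\<partial>\<^sub>iF\<close> is not small.\<close>

lemma column_bound:
  fixes F :: "real ^ 'k::finite \<Rightarrow> real"
  assumes pos: "0 < \<rho>" "0 < A" "0 < K" "0 < \<Lambda>" "0 < M" "0 < m" and U: "open U" "smooth_on U F" "cube v \<rho> \<subseteq> U"
    and bnd: "\<And>j x. x \<in> cube v \<rho> \<Longrightarrow> \<rho> * \<bar>partial_deriv j F x\<bar> \<le> \<Lambda> * A"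
    and f: "f \<in> near_zero_cells (K * A) v \<rho> (M * m) F" "f' \<in> near_zero_cells (K * A) v \<rho> (M * m) F"
    and ff': "\<And>j. j \<noteq> i \<Longrightarrow> f j = f' j" "f i div m = f' i div m"
    and far: "(\<lambda>j. f j div m) \<notin> near_zero_cells (K * (A / \<rho>)) v \<rho> M (partial_deriv i F)"
  shows "real (f i) \<le> real (f' i) + (1 + (2 * K + real CARD('k) * \<Lambda>) * real M / K)"
proof -
  let ?k = "real CARD('k)" and ?N = "M * m"
  define \<delta> where "\<delta> = \<rho> / real ?N"
  have N: "0 < ?N" using pos by simp
  have \<delta>: "0 < \<delta>" unfolding \<delta>_def using pos by simp
  obtain x where x: "x \<in> cube (subcorner v \<rho> ?N f) \<delta>" "\<bar>F x\<bar> \<le> K * A / real ?N" and fg: "f \<in> grid ?N"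
    using f(1) unfolding near_zero_cells_def \<delta>_def by blast
  obtain x' where x': "x' \<in> cube (subcorner v \<rho> ?N f') \<delta>" "\<bar>F x'\<bar> \<le> K * A / real ?N"
    using f(2) unfolding near_zero_cells_def \<delta>_def by blast
  define Q where "Q = cube (subcorner v \<rho> M (\<lambda>j. f j div m)) (\<rho> / real M)"
  have gg: "(\<lambda>j. f j div m) \<in> grid M"
    using fg unfolding grid_def by (auto simp: less_mult_imp_div_less)
  have div_eq: "(\<lambda>j. f' j div m) = (\<lambda>j. f j div m)" using ff' by metis
  have xQ: "x \<in> Q" "x' \<in> Q"
    using subcell_subset[of \<rho> M m v f] subcell_subset[of \<rho> M m v f'] x(1) x'(1) pos div_eq
    unfolding Q_def \<delta>_def by auto
  have Qv: "Q \<subseteq> cube v \<rho>" unfolding Q_def by (rule subcell_subset_cube[OF pos(1,5) gg])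
  \<comment> \<open>A corner between x and x'. From x to y only coordinate i changes, so the mean
    value theorem involves only the i-th partial derivative. From y to x' the other coordinates
    change by at most one fine side, because f and f' agree there, so F is still small at y. Both
    moves stay in the coarse cell Q.\<close>
  define y where "y = (\<chi> j. if j = i then x' $ i else x $ j)"
  have yQ: "y \<in> Q" using xQ unfolding Q_def cube_def y_def by simp
  have diff: "F differentiable at z" if "z \<in> Q" for z
    using smooth_on_differentiable_at[OF U(2,1), of z "[]"] that Qv U(3) by auto
  have "\<bar>F y - F x'\<bar> \<le> (\<Lambda> * A / \<rho>) * (\<Sum>j\<in>UNIV. \<bar>y $ j - x' $ j\<bar>)"
  proof (rule abs_diff_le_partial[OF _ yQ xQ(2) diff])
    show "convex Q" unfolding Q_def by (rule convex_cube)
    show "\<bar>partial_deriv j F z\<bar> \<le> \<Lambda> * A / \<rho>" if "z \<in> Q" for j z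
      using bnd[of z j] that Qv pos(1) by (auto simp: field_simps)
  qed
  also have "\<dots> \<le> (\<Lambda> * A / \<rho>) * (\<Sum>j\<in>(UNIV :: 'k set). \<delta>)"
  proof (intro mult_left_mono sum_mono)
    fix j
    show "\<bar>y $ j - x' $ j\<bar> \<le> \<delta>"
      using x(1) x'(1) ff'(1)[of j] \<delta> unfolding cube_def y_def subcorner_def
      by (auto simp: abs_le_iff dest!: spec[of _ j])
  qed (use pos in auto)
  also have "\<dots> = ?k * \<Lambda> * A / real ?N" unfolding \<delta>_def using pos by simp
  finally have 1: "\<bar>F y\<bar> \<le> K * A / real ?N + ?k * \<Lambda> * A / real ?N" using x'(2) by linarith
  have segQ: "closed_segment x y \<subseteq> Q"
    using xQ(1) yQ convex_cube closed_segment_subset unfolding Q_def by blast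
  then obtain z where z: "z \<in> Q" "F y - F x = (\<Sum>j\<in>UNIV. (y $ j - x $ j) * partial_deriv j F z)"
    using mvt_partial[of x y F] diff by blast
  have "(\<Sum>j\<in>UNIV. (y $ j - x $ j) * partial_deriv j F z) = (\<Sum>j\<in>{i}. (y $ j - x $ j) * partial_deriv j F z)"
    by (rule sum.mono_neutral_right) (auto simp: y_def)
  then have "F y - F x = (x' $ i - x $ i) * partial_deriv i F z" using z(2) by (simp add: y_def)
  then have "\<bar>x' $ i - x $ i\<bar> * \<bar>partial_deriv i F z\<bar> = \<bar>F y - F x\<bar>"
    by (simp add: abs_mult)
  then have "\<bar>x' $ i - x $ i\<bar> * \<bar>partial_deriv i F z\<bar> \<le> 2 * (K * A / real ?N) + ?k * \<Lambda> * A / real ?N"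
  proof -
    have "\<bar>a - b\<bar> \<le> 2 * t + w" if "\<bar>a\<bar> \<le> t + w" "\<bar>b\<bar> \<le> t" for a b t w :: real using that by linarith
    from this[OF 1 x(2)] \<open>_ = \<bar>F y - F x\<bar>\<close> show ?thesis by simp
  qed
  moreover have "K * (A / \<rho>) / real M \<le> \<bar>partial_deriv i F z\<bar>"
    using far gg z(1) unfolding near_zero_cells_def Q_def by force
  ultimately have "\<bar>x' $ i - x $ i\<bar> * (K * (A / \<rho>) / real M) \<le> 2 * (K * A / real ?N) + ?k * \<Lambda> * A / real ?N"
    by (meson order_trans mult_left_mono abs_ge_zero)
  also have "\<dots> = (2 * K + ?k * \<Lambda>) * real M / K * \<delta> * (K * (A / \<rho>) / real M)"
    unfolding \<delta>_def using pos by (simp add: field_simps)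
  finally have 2: "\<bar>x' $ i - x $ i\<bar> \<le> (2 * K + ?k * \<Lambda>) * real M / K * \<delta>"
    by (rule mult_right_le_imp_le) (use pos in simp)
  \<comment> \<open>The points may lie anywhere in their cells, which costs one cell side.\<close>
  have "(real (f i) - real (f' i) - 1) * \<delta> \<le> \<bar>x' $ i - x $ i\<bar>"
    using x(1) x'(1) unfolding cube_def subcorner_def \<delta>_def[symmetric]
    by (auto simp: algebra_simps dest!: spec[of _ i])
  then have "(real (f i) - real (f' i) - 1) * \<delta> \<le> (2 * K + ?k * \<Lambda>) * real M / K * \<delta>" using 2 by linarith
  from mult_right_le_imp_le[OF this \<delta>] show ?thesis by linarith
qed


text \<open>The fine cells are split by their coarse parent. Parents on which the partial derivative
  comes close to zero are few by \<open>coarse\<close>, and all their children are counted. Under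
  any other parent, \<open>column_bound\<close> leaves boundedly many cells in each column of
  direction i; these columns are a dimension fewer, and \<open>fine\<close> makes their total small.
  Each kind uses half of \<epsilon>.\<close>

lemma near_zero_cells_step:
  fixes F :: "real ^ 'k::finite \<Rightarrow> real"
  assumes pos: "0 < \<rho>" "0 < A" "0 < K" "0 < \<Lambda>" "0 < M" "0 < m" and U: "open U" "smooth_on U F" "cube v \<rho> \<subseteq> U"
    and bnd: "\<And>j x. x \<in> cube v \<rho> \<Longrightarrow> \<rho> * \<bar>partial_deriv j F x\<bar> \<le> \<Lambda> * A"
    and coarse: "real (card (near_zero_cells (K * (A / \<rho>)) v \<rho> M (partial_deriv i F))) \<le> \<epsilon> / 2 * real M ^ CARD('k)"
    and fine: "(3 + (2 * K + real CARD('k) * \<Lambda>) * real M / K) * real M \<le> \<epsilon> / 2 * real (M * m)"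
  shows "real (card (near_zero_cells (K * A) v \<rho> (M * m) F)) \<le> \<epsilon> * real (M * m) ^ CARD('k)"
proof -
  let ?k = "CARD('k)" and ?N = "M * m"
  let ?C = "near_zero_cells (K * (A / \<rho>)) v \<rho> M (partial_deriv i F)"
  let ?S = "near_zero_cells (K * A) v \<rho> ?N F"
  let ?q = "\<lambda>f j. f j div m"
  define S1 where "S1 = {f \<in> ?S. ?q f \<in> ?C}"
  define S2 where "S2 = {f \<in> ?S. ?q f \<notin> ?C}"
  \<comment> \<open>The bound of \<open>column_bound\<close>, rounded up. Indices within R of each
    other number at most R + 1, which explains the 3 in \<open>fine\<close>.\<close>
  define R where "R = nat \<lceil>1 + (2 * K + real ?k * \<Lambda>) * real M / K\<rceil>"
  have S: "?S \<subseteq> grid ?N" "?C \<subseteq> grid M" by (auto simp: near_zero_cells_def)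
  have fin: "finite ?S" "finite ?C" "finite S1" "finite S2"
    using finite_subset[OF S(1) finite_grid] finite_subset[OF S(2) finite_grid] unfolding S1_def S2_def by auto
  have "card S1 \<le> m ^ ?k * card ?C"
  proof (rule card_fibers_le[where g = ?q])
    fix g
    have "{f \<in> S1. ?q f = g} \<subseteq> {f. \<forall>j. f j \<in> {g j * m..<g j * m + m}}"
      using pos(6) by (auto intro: div_times_less_eq_dividend) (metis dividend_less_div_times add.commute)
    from card_mono[OF finite_funs this] show "card {f \<in> S1. ?q f = g} \<le> m ^ ?k"
      unfolding card_funs by simp
  qed (use fin in \<open>auto simp: S1_def\<close>)
  then have "real (card S1) \<le> real m ^ ?k * real (card ?C)" by (metis of_nat_le_iff of_nat_mult of_nat_power)
  also have "\<dots> \<le> real m ^ ?k * (\<epsilon> / 2 * real M ^ ?k)" using coarse by (intro mult_left_mono) auto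
  finally have 1: "real (card S1) \<le> \<epsilon> / 2 * real ?N ^ ?k" by (simp add: power_mult_distrib mult_ac)
  \<comment> \<open>Coarsening only the i-th index labels the pieces of columns inside one coarse
    cell, so the fibres of this map are the sets to which \<open>column_bound\<close>
    applies.\<close>
  have "card S2 \<le> (R + 1) * card {f :: 'k \<Rightarrow> nat. \<forall>j. f j \<in> {..<(if j = i then M else ?N)}}"
  proof (rule card_fibers_le[where g = "\<lambda>f. f(i := f i div m)"])
    fix g
    let ?T = "{f \<in> S2. f(i := f i div m) = g}"
    have T: "f j = f' j" if "f \<in> ?T" "f' \<in> ?T" "j \<noteq> i" for f f' j
    proof -
      have "(f(i := f i div m)) j = (f'(i := f' i div m)) j" using that(1,2) by simp
      then show ?thesis using that(3) by simp
    qed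
    have T': "f i div m = f' i div m" if "f \<in> ?T" "f' \<in> ?T" for f f'
    proof -
      have "(f(i := f i div m)) i = (f'(i := f' i div m)) i" using that by simp
      then show ?thesis by simp
    qed
    have "card ?T = card ((\<lambda>f. f i) ` ?T)"
    proof (rule card_image[symmetric], rule inj_onI)
      fix f f' assume "f \<in> ?T" "f' \<in> ?T" "f i = f' i"
      then show "f = f'" using T[of f f'] by (metis ext)
    qed
    also have "\<dots> \<le> R + 1"
    proof (rule card_diam_le)
      fix a b assume "a \<in> (\<lambda>f. f i) ` ?T" "b \<in> (\<lambda>f. f i) ` ?T"
      then obtain f f' where f: "f \<in> ?T" "f' \<in> ?T" and ab: "a = f i" "b = f' i" by blast
      have "real (f i) \<le> real (f' i) + (1 + (2 * K + real ?k * \<Lambda>) * real M / K)"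
      proof (rule column_bound[OF pos U bnd])
        show "f \<in> ?S" "f' \<in> ?S" "?q f \<notin> ?C" using f by (auto simp: S2_def)
        show "f j = f' j" if "j \<noteq> i" for j using T[OF f that] .
        show "f i div m = f' i div m" by (rule T'[OF f])
      qed
      then show "a \<le> b + R" unfolding ab R_def by linarith
    qed
    finally show "card ?T \<le> R + 1" .
  next
    show "(\<lambda>f. f(i := f i div m)) ` S2 \<subseteq> {f. \<forall>j. f j \<in> {..<(if j = i then M else ?N)}}"
      using S(1) unfolding S2_def grid_def by (auto simp: less_mult_imp_div_less)
  qed (rule fin, rule finite_funs, simp)
  also have "card {f :: 'k \<Rightarrow> nat. \<forall>j. f j \<in> {..<(if j = i then M else ?N)}} = M * ?N ^ (?k - 1)"
  proof -
    have "(\<Prod>j\<in>UNIV. if j = i then M else ?N) = M * (\<Prod>j\<in>UNIV - {i}. ?N)"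
      by (subst prod.remove[of _ i]) (auto intro!: prod.cong)
    also have "\<dots> = M * ?N ^ (?k - 1)" by (simp add: card_Diff_singleton)
    finally show ?thesis unfolding card_funs card_lessThan .
  qed
  finally have "real (card S2) \<le> real ((R + 1) * (M * ?N ^ (?k - 1)))" by (simp only: of_nat_le_iff)
  also have "\<dots> = ((real R + 1) * real M) * real ?N ^ (?k - 1)" by (simp only: of_nat_mult of_nat_add of_nat_power of_nat_1 mult.assoc)
  also have "\<dots> \<le> (\<epsilon> / 2 * real ?N) * real ?N ^ (?k - 1)"
  proof (intro mult_right_mono order_trans[OF _ fine])
    have "0 \<le> 1 + (2 * K + real ?k * \<Lambda>) * real M / K" using pos by simp
    then have "real R \<le> 2 + (2 * K + real ?k * \<Lambda>) * real M / K" unfolding R_def by linarith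
    then show "real R + 1 \<le> 3 + (2 * K + real ?k * \<Lambda>) * real M / K" by linarith
  qed auto
  also have "\<dots> = \<epsilon> / 2 * real ?N ^ ?k"
    using power_minus_mult[of ?k "real ?N"] by (simp add: mult_ac)
  finally have 2: "real (card S2) \<le> \<epsilon> / 2 * real ?N ^ ?k" .
  have "?S = S1 \<union> S2" unfolding S1_def S2_def by blast
  then have "real (card ?S) \<le> real (card S1) + real (card S2)"
    using card_Un_le[of S1 S2] by (metis of_nat_add of_nat_le_iff)
  also have "\<dots> \<le> \<epsilon> * real ?N ^ ?k" using add_mono[OF 1 2] by simp
  finally show ?thesis .
qed

text \<open>Induction on the order of the derivative that is bounded below. The innermost index i is
  split off: \<open>partial_deriv i F\<close> satisfies the same hypotheses with A / \<rho> for A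
  and a derivative of smaller order bounded below, and \<open>near_zero_cells_step\<close> passes
  back to F. As the hypotheses keep their constants under this change, N depends only on those
  constants and on j.\<close>

theorem near_zero_cells_few:
  fixes K \<Lambda> \<kappa> :: real
  assumes K: "0 < K" and \<Lambda>: "0 < \<Lambda>" and \<kappa>: "0 < \<kappa>" and \<epsilon>: "0 < \<epsilon>"
  shows "\<exists>N\<ge>N1. N \<ge> 1 \<and> (\<forall>v \<rho> A (F :: real ^ 'k::finite \<Rightarrow> real) is U. 0 < \<rho> \<longrightarrow> 0 < A \<longrightarrow> open U \<longrightarrow> smooth_on U F \<longrightarrow>
      cube v \<rho> \<subseteq> U \<longrightarrow> length is \<le> j \<longrightarrow>
      (\<forall>is' x. 1 \<le> length is' \<longrightarrow> length is' \<le> j \<longrightarrow> x \<in> cube v \<rho> \<longrightarrow> \<rho> ^ length is' * \<bar>iter_partial is' F x\<bar> \<le> \<Lambda> * A) \<longrightarrow>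
      (\<forall>x\<in>cube v \<rho>. \<kappa> * A \<le> \<rho> ^ length is * \<bar>iter_partial is F x\<bar>) \<longrightarrow>
      real (card (near_zero_cells (K * A) v \<rho> N F)) \<le> \<epsilon> * real N ^ CARD('k))"
  using \<epsilon>
proof (induction j arbitrary: \<epsilon> N1)
  \<comment> \<open>With F itself bounded below by \<kappa> * A, no value can fall under the
    threshold once N exceeds K / \<kappa>.\<close>
  have base: "near_zero_cells (K * A) v \<rho> N F = {}"
    if N: "K / \<kappa> < real N" "0 < N" and "0 < \<rho>" "0 < A" and F: "\<forall>x\<in>cube v \<rho>. \<kappa> * A \<le> \<bar>F x\<bar>"
    for v \<rho> A N and F :: "real ^ 'k \<Rightarrow> real"
  proof -
    have "K < \<kappa> * real N" using N(1) \<kappa> by (simp add: divide_less_eq mult.commute)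
    then have "K * A < \<kappa> * real N * A" using \<open>0 < A\<close> by (rule mult_strict_right_mono)
    then have "K * A / real N < \<kappa> * A" using N(2) by (simp add: divide_less_eq mult_ac)
    then show ?thesis
      using F subcell_subset_cube[OF \<open>0 < \<rho>\<close> N(2)] unfolding near_zero_cells_def by fastforce
  qed
  {
    case 0
    let ?N = "max N1 (nat \<lfloor>K / \<kappa>\<rfloor> + 1)"
    have "K / \<kappa> < real ?N" "0 < ?N" by linarith+
    then show ?case
      using base 0 by (intro exI[of _ ?N]) auto
  next
    case (Suc j)
    obtain M where M: "M \<ge> 1" and IH: "\<And>v \<rho> A (F :: real ^ 'k::finite \<Rightarrow> real) is U. 0 < \<rho> \<Longrightarrow> 0 < A \<Longrightarrow> open U \<Longrightarrow> smooth_on U F \<Longrightarrow>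
      cube v \<rho> \<subseteq> U \<Longrightarrow> length is \<le> j \<Longrightarrow>
      (\<And>is' x. 1 \<le> length is' \<Longrightarrow> length is' \<le> j \<Longrightarrow> x \<in> cube v \<rho> \<Longrightarrow> \<rho> ^ length is' * \<bar>iter_partial is' F x\<bar> \<le> \<Lambda> * A) \<Longrightarrow>
      (\<And>x. x\<in>cube v \<rho> \<Longrightarrow> \<kappa> * A \<le> \<rho> ^ length is * \<bar>iter_partial is F x\<bar>) \<Longrightarrow>
      real (card (near_zero_cells (K * A) v \<rho> M F)) \<le> \<epsilon> / 2 * real M ^ CARD('k)"
      using Suc.IH[of "\<epsilon> / 2" 1] Suc.prems by (auto simp: half_gt_zero)
    \<comment> \<open>One N has to serve every list of length at most \<open>Suc j\<close>.
      Exceeding K / \<kappa> settles the empty list, the last summand gives \<open>fine\<close> for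
      the nonempty ones, and N1 is the required lower bound.\<close>
    define m where "m = N1 + nat \<lfloor>K / \<kappa>\<rfloor> + 1 + nat \<lceil>2 * (3 + (2 * K + real CARD('k) * \<Lambda>) * real M / K) / \<epsilon>\<rceil>"
    have m0: "0 < m" unfolding m_def by simp
    have mM: "m \<le> M * m" using M by simp
    have N1: "N1 \<le> M * m" using mM unfolding m_def by linarith
    have NK: "K / \<kappa> < real (M * m)"
    proof -
      have "K / \<kappa> < real m" unfolding m_def by linarith
      also have "\<dots> \<le> real (M * m)" using mM by (rule of_nat_mono)
      finally show ?thesis .
    qed
    have "2 * (3 + (2 * K + real CARD('k) * \<Lambda>) * real M / K) / \<epsilon> \<le> real m" unfolding m_def by linarith
    then have "3 + (2 * K + real CARD('k) * \<Lambda>) * real M / K \<le> \<epsilon> / 2 * real m"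
      using Suc.prems by (simp add: field_simps)
    then have fine: "(3 + (2 * K + real CARD('k) * \<Lambda>) * real M / K) * real M \<le> \<epsilon> / 2 * real (M * m)"
      using mult_right_mono[of _ _ "real M"] by (fastforce simp: mult_ac)
    show ?case
    proof (intro exI[of _ "M * m"] conjI allI impI)
      fix v :: "real ^ 'k" and \<rho> A F "is" U
      assume pos: "0 < \<rho>" "0 < A" and U: "open U" "smooth_on U F" "cube v \<rho> \<subseteq> U"
        and len: "length is \<le> Suc j"
        and up: "\<forall>is' x. 1 \<le> length is' \<longrightarrow> length is' \<le> Suc j \<longrightarrow> x \<in> cube v \<rho> \<longrightarrow> \<rho> ^ length is' * \<bar>iter_partial is' F x\<bar> \<le> \<Lambda> * A"
        and low: "\<forall>x\<in>cube v \<rho>. \<kappa> * A \<le> \<rho> ^ length is * \<bar>iter_partial is F x\<bar>"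
      show "real (card (near_zero_cells (K * A) v \<rho> (M * m) F)) \<le> \<epsilon> * real (M * m) ^ CARD('k)"
      proof (cases "is" rule: rev_cases)
        case Nil
        then have "near_zero_cells (K * A) v \<rho> (M * m) F = {}"
          using base[OF NK _ pos] low M m0 by simp
        then show ?thesis using Suc.prems by simp
      next
        case (snoc is0 i)
        show ?thesis
        proof (rule near_zero_cells_step[OF pos K \<Lambda> _ m0 U _ _ fine])
          show "0 < M" using M by simp
          show "\<rho> * \<bar>partial_deriv j F x\<bar> \<le> \<Lambda> * A" if "x \<in> cube v \<rho>" for j x
            using up[rule_format, of "[j]" x] that by (simp add: iter_partial_Cons)
          show "real (card (near_zero_cells (K * (A / \<rho>)) v \<rho> M (partial_deriv i F))) \<le> \<epsilon> / 2 * real M ^ CARD('k)"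
          proof (rule IH[OF pos(1) _ U(1) smooth_on_partial_deriv[OF U(2)] U(3)])
            show "0 < A / \<rho>" using pos by simp
            show "length is0 \<le> j" using len snoc by simp
            show "\<rho> ^ length is' * \<bar>iter_partial is' (partial_deriv i F) x\<bar> \<le> \<Lambda> * (A / \<rho>)"
              if "1 \<le> length is'" "length is' \<le> j" "x \<in> cube v \<rho>" for is' x
              using up[rule_format, of "is' @ [i]" x] that pos by (simp add: iter_partial_snoc field_simps)
            show "\<kappa> * (A / \<rho>) \<le> \<rho> ^ length is0 * \<bar>iter_partial is0 (partial_deriv i F) x\<bar>"
              if "x \<in> cube v \<rho>" for x
              using low that pos snoc by (simp add: iter_partial_snoc field_simps)
          qed
        qed
      qed
    qed (use N1 M m0 in auto)
  }
qed

section \<open>Uniform nondegeneracy\<close>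

lemma convex_sball: "convex (sball v \<rho>)"
proof -
  have "sball v \<rho> = cbox (v - (\<chi> i. \<rho>)) (v + (\<chi> i. \<rho>))"
    unfolding sball_def by (auto simp: mem_box_cart abs_le_iff algebra_simps)
  then show ?thesis by simp
qed

lemma finite_lists_between: "finite {is :: 'k::finite list. 1 \<le> length is \<and> length is \<le> D}"
  by (rule finite_subset[OF _ finite_lists_length_le[of "UNIV :: 'k set" D]]) auto

text \<open>A unit vector orthogonal to all derivatives up to order D at v0 would be orthogonal to
  the whole space. Compactness of the sphere makes this quantitative at v0, and continuity of the
  finitely many derivatives extends it to nearby v.\<close>

lemma nondegenerate_uniform:
  fixes \<Phi> :: "real ^ 'k::finite \<Rightarrow> real ^ 'd::finite"
  assumes sm: "smooth_on U \<Phi>" and U: "open U" and v0: "v0 \<in> U" and nd: "osculating_space D \<Phi> v0 = UNIV"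
  obtains \<kappa> r where "0 < \<kappa>" "0 < r"
    "\<And>v L. dist v v0 < r \<Longrightarrow> norm L = 1 \<Longrightarrow>
      \<exists>is. 1 \<le> length is \<and> length is \<le> D \<and> \<kappa> \<le> \<bar>L \<bullet> iter_partial is \<Phi> v\<bar>"
proof -
  define I where "I = {is :: 'k list. 1 \<le> length is \<and> length is \<le> D}"
  have finI: "finite I" unfolding I_def by (rule finite_lists_between)
  define q where "q = (\<lambda>L. \<Sum>is\<in>I. \<bar>L \<bullet> iter_partial is \<Phi> v0\<bar>)"
  have "compact (sphere (0 :: real ^ 'd) 1)" "sphere (0 :: real ^ 'd) 1 \<noteq> {}" by auto
  moreover have "continuous_on (sphere 0 1) q"
    unfolding q_def by (intro continuous_intros)
  ultimately obtain L0 where L0: "L0 \<in> sphere 0 1" "\<And>L. L \<in> sphere 0 1 \<Longrightarrow> q L0 \<le> q L"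
    using continuous_attains_inf by metis
  have "0 < q L0"
  proof (rule ccontr)
    assume "\<not> 0 < q L0"
    moreover have "0 \<le> q L0" unfolding q_def by (simp add: sum_nonneg)
    ultimately have "q L0 = 0" by linarith
    then have *: "L0 \<bullet> iter_partial is \<Phi> v0 = 0" if "is \<in> I" for "is"
      using that finI unfolding q_def by (simp add: sum_nonneg_eq_0_iff)
    have "L0 \<in> span {iter_partial is \<Phi> v0 | is. 0 < length is \<and> length is \<le> D}"
      using nd unfolding osculating_space_def by simp
    then have "orthogonal L0 L0"
    proof (rule orthogonal_to_span)
      fix x assume "x \<in> {iter_partial is \<Phi> v0 | is. 0 < length is \<and> length is \<le> D}"
      then obtain "is" where "x = iter_partial is \<Phi> v0" "0 < length is" "length is \<le> D" by blast
      then show "orthogonal L0 x" using *[of "is"] unfolding I_def orthogonal_def by (simp add: Suc_leI)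
    qed
    then show False using L0(1) by (simp add: orthogonal_def)
  qed
  have cI: "0 < real (card I)"
    using \<open>0 < q L0\<close> finI unfolding q_def by (cases "I = {}") (auto simp: card_gt_0_iff)
  \<comment> \<open>The minimum of q is spread over \<open>card I\<close> terms, so some term is at
    least 2 * \<kappa> at v0; one \<kappa> is given up in moving to v.\<close>
  define \<kappa> where "\<kappa> = q L0 / (2 * real (card I))"
  have \<kappa>: "0 < \<kappa>" unfolding \<kappa>_def using \<open>0 < q L0\<close> cI by simp
  have "\<forall>is\<in>I. \<forall>\<^sub>F v in nhds v0. dist (iter_partial is \<Phi> v) (iter_partial is \<Phi> v0) < \<kappa>"
  proof
    fix "is" assume "is \<in> I"
    have "isCont (iter_partial is \<Phi>) v0"
      using smooth_on_iter_continuous[OF sm U] U v0 continuous_on_eq_continuous_at by blast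
    then show "\<forall>\<^sub>F v in nhds v0. dist (iter_partial is \<Phi> v) (iter_partial is \<Phi> v0) < \<kappa>"
      unfolding isCont_def using \<kappa> by (intro tendstoD) (auto simp: tendsto_at_iff_tendsto_nhds)
  qed
  then have "\<forall>\<^sub>F v in nhds v0. \<forall>is\<in>I. dist (iter_partial is \<Phi> v) (iter_partial is \<Phi> v0) < \<kappa>"
    using finI by (simp add: eventually_ball_finite)
  then obtain r where r: "0 < r" "\<And>v is. dist v v0 < r \<Longrightarrow> is \<in> I \<Longrightarrow> dist (iter_partial is \<Phi> v) (iter_partial is \<Phi> v0) < \<kappa>"
    unfolding eventually_nhds_metric by blast
  show thesis
  proof (rule that[OF \<kappa> r(1)])
    fix v and L :: "real ^ 'd" assume v: "dist v v0 < r" and L: "norm L = 1"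
    have "\<exists>is\<in>I. 2 * \<kappa> \<le> \<bar>L \<bullet> iter_partial is \<Phi> v0\<bar>"
    proof (rule ccontr)
      assume "\<not> ?thesis"
      then have "q L < real (card I) * (2 * \<kappa>)"
        unfolding q_def using cI by (intro sum_bounded_above_strict) auto
      also have "\<dots> = q L0" unfolding \<kappa>_def using cI by simp
      finally show False using L0(2)[of L] L by simp
    qed
    then obtain "is" where is_I: "is \<in> I" and ge: "2 * \<kappa> \<le> \<bar>L \<bullet> iter_partial is \<Phi> v0\<bar>" by blast
    have "\<bar>L \<bullet> (iter_partial is \<Phi> v - iter_partial is \<Phi> v0)\<bar> \<le> norm L * norm (iter_partial is \<Phi> v - iter_partial is \<Phi> v0)"
      by (rule Cauchy_Schwarz_ineq2)
    also have "\<dots> < \<kappa>" using r(2)[OF v is_I] L by (simp add: dist_norm)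
    finally have "\<kappa> \<le> \<bar>L \<bullet> iter_partial is \<Phi> v\<bar>" using ge by (simp add: inner_diff_right)
    then show "\<exists>is. 1 \<le> length is \<and> length is \<le> D \<and> \<kappa> \<le> \<bar>L \<bullet> iter_partial is \<Phi> v\<bar>"
      using is_I unfolding I_def by blast
  qed
qed

text \<open>The derivative is chosen to maximise \<open>\<sigma>\<^sup>l \<bar>\<partial>\<^sub>i\<^sub>s g(v)\<bar>\<close>, \<open>l\<close> the length of \<open>is\<close>. With \<open>\<sigma>\<close> a large
  multiple of \<open>\<rho>\<close>, high orders are favoured, so that the chosen derivative varies by at most half of
  its value.\<close>

lemma dominating_derivative:
  fixes g :: "real ^ 'k::finite \<Rightarrow> real"
  assumes U: "open U" "smooth_on U g" "sball v (2 * \<rho>) \<subseteq> U" and \<rho>: "0 < \<rho>"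
  defines "\<sigma> \<equiv> 8 * real CARD('k) * \<rho>"
  assumes \<sigma>: "\<sigma> \<le> 1" "\<sigma> * C \<le> 2 * \<kappa>" and \<kappa>: "0 < \<kappa>"
    and up: "\<And>is x. x \<in> sball v (2 * \<rho>) \<Longrightarrow> length is = Suc D \<Longrightarrow> \<bar>iter_partial is g x\<bar> \<le> C"
    and low: "1 \<le> length is0" "length is0 \<le> D" "\<kappa> \<le> \<bar>iter_partial is0 g v\<bar>"
  obtains B "is" where "0 < B" "1 \<le> length is" "length is \<le> D"
    "\<And>x. x \<in> sball v (2 * \<rho>) \<Longrightarrow> B / 2 \<le> \<sigma> ^ length is * \<bar>iter_partial is g x\<bar>"
    "\<And>is' x. 1 \<le> length is' \<Longrightarrow> length is' \<le> D \<Longrightarrow> x \<in> sball v (2 * \<rho>) \<Longrightarrow> \<sigma> ^ length is' * \<bar>iter_partial is' g x\<bar> \<le> 2 * B"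
proof -
  let ?k = "real CARD('k)"
  have k: "0 < ?k" by simp
  have \<sigma>0: "0 < \<sigma>" unfolding \<sigma>_def using \<rho> k by simp
  define I where "I = {is :: 'k list. 1 \<le> length is \<and> length is \<le> D}"
  have finI: "finite I" unfolding I_def by (rule finite_lists_between)
  have is0: "is0 \<in> I" unfolding I_def using low by simp
  define w where "w = (\<lambda>is. \<sigma> ^ length is * \<bar>iter_partial is g v\<bar>)"
  define B where "B = Max (w ` I)"
  have wB: "w is \<le> B" if "is \<in> I" for "is" unfolding B_def using finI that by simp
  have "B \<in> w ` I" unfolding B_def using finI is0 by (intro Max_in) auto
  then obtain "is" where isI: "is \<in> I" and Bis: "B = w is" by blast
  have BD: "\<sigma> ^ D * \<kappa> \<le> B"
  proof -
    have "\<sigma> ^ D \<le> \<sigma> ^ length is0" using low(2) \<sigma>(1) \<sigma>0 by (intro power_decreasing) auto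
    then have "\<sigma> ^ D * \<kappa> \<le> w is0" unfolding w_def using low(3) \<kappa> \<sigma>0 by (intro mult_mono) auto
    then show ?thesis using wB[OF is0] by linarith
  qed
  then have B0: "0 < B" using \<sigma>0 \<kappa> by (meson less_le_trans mult_pos_pos zero_less_power)
  have diff: "iter_partial is' g differentiable at z" if "z \<in> sball v (2 * \<rho>)" for is' z
    using smooth_on_differentiable_at[OF U(2,1)] that U(3) by blast
  have vs: "v \<in> sball v (2 * \<rho>)" using \<rho> by (simp add: sball_def)
  \<comment> \<open>Origin of the 8 in \<sigma>: coordinates differ by at most 2 * \<rho>, so the
    sum of their differences is at most \<sigma> / 4. Against a bound 2 * B at the next order this
    leaves a variation of B / 2.\<close>
  have var: "\<sigma> ^ length is' * \<bar>iter_partial is' g x - iter_partial is' g v\<bar> \<le> B / 2"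
    if x: "x \<in> sball v (2 * \<rho>)" and bd: "\<And>is'' y. length is'' = Suc (length is') \<Longrightarrow> y \<in> sball v (2 * \<rho>) \<Longrightarrow> \<sigma> ^ length is'' * \<bar>iter_partial is'' g y\<bar> \<le> 2 * B"
    for is' x
  proof -
    let ?l = "length is'"
    have "\<bar>iter_partial is' g x - iter_partial is' g v\<bar> \<le> (2 * B / \<sigma> ^ Suc ?l) * (\<Sum>i\<in>UNIV. \<bar>x $ i - v $ i\<bar>)"
    proof (rule abs_diff_le_partial[OF convex_sball x vs diff])
      fix i z assume "z \<in> sball v (2 * \<rho>)"
      then have "\<sigma> ^ Suc ?l * \<bar>partial_deriv i (iter_partial is' g) z\<bar> \<le> 2 * B"
        using bd[of "i # is'" z] by (simp add: iter_partial_Cons)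
      then show "\<bar>partial_deriv i (iter_partial is' g) z\<bar> \<le> 2 * B / \<sigma> ^ Suc ?l"
        using \<sigma>0 by (simp add: pos_le_divide_eq mult.commute)
    qed auto
    also have "\<dots> \<le> (2 * B / \<sigma> ^ Suc ?l) * (\<Sum>i\<in>(UNIV :: 'k set). 2 * \<rho>)"
      using x B0 \<sigma>0 by (intro mult_left_mono sum_mono) (auto simp: sball_def)
    also have "\<dots> = (2 * B / \<sigma> ^ Suc ?l) * (\<sigma> / 4)" unfolding \<sigma>_def by simp
    also have "\<dots> = B / 2 / \<sigma> ^ ?l" using \<sigma>0 by simp
    finally show ?thesis using \<sigma>0 by (simp add: pos_le_divide_eq mult.commute)
  qed
  \<comment> \<open>Downward induction on the order \<open>Suc D - l\<close>. At order D + 1 the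
    bound follows from C, since \<sigma> * C \<le> 2 * \<kappa> and B is at least \<kappa> times the
    D-th power of \<sigma>. Below that, the value at v is at most B by maximality and the variation
    at most B / 2.\<close>
  have upB: "\<sigma> ^ length is' * \<bar>iter_partial is' g x\<bar> \<le> 2 * B"
    if "l \<le> D" "length is' = Suc D - l" "x \<in> sball v (2 * \<rho>)" for is' x l
    using that
  proof (induction l arbitrary: is' x)
    case 0
    have "\<sigma> ^ length is' * \<bar>iter_partial is' g x\<bar> \<le> \<sigma> ^ Suc D * C"
      using up[OF 0(3)] 0(2) \<sigma>0 by (simp del: power_Suc)
    also have "\<dots> = \<sigma> ^ D * (\<sigma> * C)" by simp
    also have "\<dots> \<le> \<sigma> ^ D * (2 * \<kappa>)" using \<sigma>0 \<sigma>(2) by (intro mult_left_mono) auto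
    also have "\<dots> \<le> 2 * B" using BD by simp
    finally show ?case .
  next
    case (Suc l)
    have "\<sigma> ^ length is' * \<bar>iter_partial is' g x - iter_partial is' g v\<bar> \<le> B / 2"
    proof (rule var[OF Suc.prems(3)])
      fix is'' :: "'k list" and y assume "length is'' = Suc (length is')" "y \<in> sball v (2 * \<rho>)"
      then show "\<sigma> ^ length is'' * \<bar>iter_partial is'' g y\<bar> \<le> 2 * B"
        using Suc.prems by (intro Suc.IH) auto
    qed
    moreover have "is' \<in> I" unfolding I_def using Suc.prems by auto
    then have "\<sigma> ^ length is' * \<bar>iter_partial is' g v\<bar> \<le> B" using wB unfolding w_def by blast
    moreover have "\<sigma> ^ length is' * \<bar>iter_partial is' g x\<bar> \<le> \<sigma> ^ length is' * (\<bar>iter_partial is' g x - iter_partial is' g v\<bar> + \<bar>iter_partial is' g v\<bar>)"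
      using \<sigma>0 by (intro mult_left_mono) auto
    ultimately show ?case using B0 unfolding distrib_left by linarith
  qed
  have upB': "\<sigma> ^ length is' * \<bar>iter_partial is' g x\<bar> \<le> 2 * B"
    if "1 \<le> length is'" "length is' \<le> Suc D" "x \<in> sball v (2 * \<rho>)" for is' x
    using upB[of "Suc D - length is'" is' x] that by auto
  show thesis
  proof (rule that[OF B0])
    show "1 \<le> length is" "length is \<le> D" using isI unfolding I_def by auto
    show "B / 2 \<le> \<sigma> ^ length is * \<bar>iter_partial is g x\<bar>" if x: "x \<in> sball v (2 * \<rho>)" for x
    proof -
      have "\<sigma> ^ length is * \<bar>iter_partial is g x - iter_partial is g v\<bar> \<le> B / 2"
        by (rule var[OF x], rule upB') (use isI in \<open>auto simp: I_def\<close>)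
      moreover have "\<sigma> ^ length is * \<bar>iter_partial is g v\<bar> \<le> \<sigma> ^ length is * (\<bar>iter_partial is g x - iter_partial is g v\<bar> + \<bar>iter_partial is g x\<bar>)"
        using \<sigma>0 by (intro mult_left_mono) auto
      ultimately show ?thesis using Bis unfolding w_def distrib_left by linarith
    qed
  qed (use upB' in auto)
qed

text \<open>The counting theorem is applied to g = L \<bullet> \<Phi> - b, with the maximal weighted
  derivative of g at v in the role of A. That size depends on L, but N and \<rho>0 do not.\<close>

theorem hyperplane_cells_few:
  fixes \<Phi> :: "real ^ 'k::finite \<Rightarrow> real ^ 'd::finite"
  assumes sm: "smooth_on U \<Phi>" and U: "open U" and W: "W \<subseteq> U" and D: "1 \<le> D"
    and C: "\<And>is x. x \<in> W \<Longrightarrow> length is = Suc D \<Longrightarrow> norm (iter_partial is \<Phi> x) \<le> C"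
    and \<kappa>: "0 < \<kappa>" and nd: "\<And>v L. v \<in> W \<Longrightarrow> norm L = 1 \<Longrightarrow>
      \<exists>is. 1 \<le> length is \<and> length is \<le> D \<and> \<kappa> \<le> \<bar>L \<bullet> iter_partial is \<Phi> v\<bar>"
    and \<epsilon>: "0 < \<epsilon>"
  obtains N \<rho>0 where "Nmin \<le> N" "1 \<le> N" "0 < \<rho>0"
    "\<And>v \<rho> L b. 0 < \<rho> \<Longrightarrow> \<rho> \<le> \<rho>0 \<Longrightarrow> sball v (2 * \<rho>) \<subseteq> W \<Longrightarrow> norm L = 1 \<Longrightarrow>
      real (card {f \<in> grid N. \<exists>x\<in>cube (subcorner v \<rho> N f) (\<rho> / real N). \<exists>u\<in>sball v (2 * \<rho>).
        L \<bullet> \<Phi> u = b \<and> u \<in> sball x (\<rho> / real N)}) \<le> \<epsilon> * real N ^ CARD('k)"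
proof -
  let ?k = "real CARD('k)"
  have k: "1 \<le> ?k" by (simp add: Suc_leI)
  then have k8: "1 \<le> 8 * ?k" by linarith
  \<comment> \<open>The dominating derivative is bounded in powers of \<sigma> = 8k\<rho>, the
    counting theorem wants powers of \<rho>. The quotient is at most the D-th power of 8k.\<close>
  define \<kappa>' where "\<kappa>' = 1 / (2 * (8 * ?k) ^ D)"
  have \<kappa>': "0 < \<kappa>'" unfolding \<kappa>'_def using k by simp
  obtain N where N: "N \<ge> Nmin" "N \<ge> 1" and few: "\<And>v \<rho> A (F :: real ^ 'k::finite \<Rightarrow> real) is U. 0 < \<rho> \<Longrightarrow> 0 < A \<Longrightarrow> open U \<Longrightarrow> smooth_on U F \<Longrightarrow>
      cube v \<rho> \<subseteq> U \<Longrightarrow> length is \<le> D \<Longrightarrow>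
      (\<And>is' x. 1 \<le> length is' \<Longrightarrow> length is' \<le> D \<Longrightarrow> x \<in> cube v \<rho> \<Longrightarrow> \<rho> ^ length is' * \<bar>iter_partial is' F x\<bar> \<le> 2 * A) \<Longrightarrow>
      (\<And>x. x\<in>cube v \<rho> \<Longrightarrow> \<kappa>' * A \<le> \<rho> ^ length is * \<bar>iter_partial is F x\<bar>) \<Longrightarrow>
      real (card (near_zero_cells (1 * A) v \<rho> N F)) \<le> \<epsilon> * real N ^ CARD('k)"
    using near_zero_cells_few[where 'k = 'k, of 1 2 \<kappa>' \<epsilon> Nmin D] \<kappa>' \<epsilon> by auto
  \<comment> \<open>Chosen so that \<sigma> satisfies both \<sigma> \<le> 1 and \<sigma> * C \<le> 2
    * \<kappa>; the form \<open>\<bar>C\<bar> + 1\<close> keeps the denominator positive.\<close>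
  define \<rho>0 where "\<rho>0 = min 1 (\<kappa> / (\<bar>C\<bar> + 1)) / (8 * ?k)"
  have \<rho>0: "0 < \<rho>0" unfolding \<rho>0_def using \<kappa> k by (intro divide_pos_pos) auto
  show thesis
  proof (rule that[OF N \<rho>0])
    fix v \<rho> b and L :: "real ^ 'd"
    assume \<rho>: "0 < \<rho>" "\<rho> \<le> \<rho>0" and sub: "sball v (2 * \<rho>) \<subseteq> W" and L: "norm L = 1"
    define g where "g = (\<lambda>x. L \<bullet> \<Phi> x - b)"
    define \<sigma> where "\<sigma> = 8 * ?k * \<rho>"
    have vW: "v \<in> W" using sub \<rho> by (auto simp: sball_def)
    have smL: "smooth_on U (\<lambda>x. L \<bullet> \<Phi> x)"
      by (rule smooth_on_bounded_linear[OF bounded_linear_inner_right sm U])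
    then have smg: "smooth_on U g" unfolding g_def by (rule smooth_on_diff_const)
    have dg: "iter_partial is g x = L \<bullet> iter_partial is \<Phi> x" if "is \<noteq> []" "x \<in> U" for "is" x
      unfolding g_def using iter_partial_diff_const[OF that(1)]
        iter_partial_bounded_linear[OF bounded_linear_inner_right sm U that(2)] by metis
    obtain is0 where is0: "1 \<le> length is0" "length is0 \<le> D" "\<kappa> \<le> \<bar>L \<bullet> iter_partial is0 \<Phi> v\<bar>"
      using nd[OF vW L] by blast
    have \<sigma>_le: "\<sigma> \<le> min 1 (\<kappa> / (\<bar>C\<bar> + 1))"
      using \<rho>(2) k unfolding \<rho>0_def \<sigma>_def by (simp add: field_simps)
    have \<sigma>0: "0 < \<sigma>" unfolding \<sigma>_def using \<rho> k by simp
    have \<sigma>C: "\<sigma> * C \<le> 2 * \<kappa>"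
    proof -
      have "\<sigma> * C \<le> \<sigma> * (\<bar>C\<bar> + 1)" using \<sigma>0 by (intro mult_left_mono) auto
      also have "\<dots> \<le> \<kappa>" using \<sigma>_le by (simp add: pos_le_divide_eq)
      finally show ?thesis using \<kappa> by linarith
    qed
    have sU: "sball v (2 * \<rho>) \<subseteq> U" using sub W by blast
    have up: "\<bar>iter_partial is g x\<bar> \<le> C" if "x \<in> sball v (2 * \<rho>)" "length is = Suc D" for "is" x
    proof -
      have "iter_partial is g x = L \<bullet> iter_partial is \<Phi> x" using that sU by (intro dg) auto
      also have "\<bar>\<dots>\<bar> \<le> norm L * norm (iter_partial is \<Phi> x)" by (rule Cauchy_Schwarz_ineq2)
      also have "\<dots> \<le> C" using C[of x "is"] that sub L by auto
      finally show ?thesis .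
    qed
    have low: "\<kappa> \<le> \<bar>iter_partial is0 g v\<bar>"
      using is0 dg[of is0 v] vW W by fastforce
    obtain B "is" where B: "0 < B" "1 \<le> length is" "length is \<le> D"
      and lowB: "\<And>x. x \<in> sball v (2 * \<rho>) \<Longrightarrow> B / 2 \<le> \<sigma> ^ length is * \<bar>iter_partial is g x\<bar>"
      and upB: "\<And>is' x. 1 \<le> length is' \<Longrightarrow> length is' \<le> D \<Longrightarrow> x \<in> sball v (2 * \<rho>) \<Longrightarrow> \<sigma> ^ length is' * \<bar>iter_partial is' g x\<bar> \<le> 2 * B"
      using dominating_derivative[OF U smg sU \<rho>(1) _ _ \<kappa> up is0(1,2) low, folded \<sigma>_def] \<sigma>_le \<sigma>C by auto
    have cs: "cube v \<rho> \<subseteq> sball v (2 * \<rho>)"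
      using \<rho> by (auto simp: cube_def sball_def abs_le_iff) (smt (verit))+
    have "real (card (near_zero_cells (1 * B) v \<rho> N g)) \<le> \<epsilon> * real N ^ CARD('k)"
    proof (rule few[OF \<rho>(1) B(1) U smg _ B(3)])
      show "cube v \<rho> \<subseteq> U" using cs sU by blast
      show "\<rho> ^ length is' * \<bar>iter_partial is' g x\<bar> \<le> 2 * B" if "1 \<le> length is'" "length is' \<le> D" "x \<in> cube v \<rho>" for is' x
      proof -
        have "1 * \<rho> \<le> 8 * ?k * \<rho>" using \<rho> k by (intro mult_right_mono) linarith+
        then have "\<rho> \<le> \<sigma>" unfolding \<sigma>_def by simp
        then have "\<rho> ^ length is' \<le> \<sigma> ^ length is'" using \<rho> by (intro power_mono) auto
        then have "\<rho> ^ length is' * \<bar>iter_partial is' g x\<bar> \<le> \<sigma> ^ length is' * \<bar>iter_partial is' g x\<bar>"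
          by (intro mult_right_mono) auto
        then show ?thesis using upB[OF that(1,2)] cs that(3) by fastforce
      qed
      show "\<kappa>' * B \<le> \<rho> ^ length is * \<bar>iter_partial is g x\<bar>" if "x \<in> cube v \<rho>" for x
      proof -
        have "(8 * ?k) ^ length is \<le> (8 * ?k) ^ D" by (intro power_increasing B(3) k8)
        then have "\<rho> ^ length is * \<bar>iter_partial is g x\<bar> * (8 * ?k) ^ length is \<le> \<rho> ^ length is * \<bar>iter_partial is g x\<bar> * (8 * ?k) ^ D"
          using \<rho> by (intro mult_left_mono) auto
        moreover have "B / 2 \<le> \<rho> ^ length is * \<bar>iter_partial is g x\<bar> * (8 * ?k) ^ length is"
          using lowB[of x] that cs unfolding \<sigma>_def by (auto simp: power_mult_distrib mult_ac)
        ultimately have "B / 2 \<le> \<rho> ^ length is * \<bar>iter_partial is g x\<bar> * (8 * ?k) ^ D" by linarith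
        then show ?thesis unfolding \<kappa>'_def using k by (simp add: field_simps)
      qed
    qed
    \<comment> \<open>A zero u of g within \<rho> / N of a point x of the cell gives \<bar>g x\<bar>
      \<le> B / (4N) by the first-order bound, which is below the threshold.\<close>
    moreover have "{f \<in> grid N. \<exists>x\<in>cube (subcorner v \<rho> N f) (\<rho> / real N). \<exists>u\<in>sball v (2 * \<rho>).
        L \<bullet> \<Phi> u = b \<and> u \<in> sball x (\<rho> / real N)} \<subseteq> near_zero_cells (1 * B) v \<rho> N g"
    proof clarify
      fix f x u assume f: "f \<in> grid N" and x: "x \<in> cube (subcorner v \<rho> N f) (\<rho> / real N)"
        and u: "u \<in> sball v (2 * \<rho>)" "u \<in> sball x (\<rho> / real N)" and b: "b = L \<bullet> \<Phi> u"
      have xs: "x \<in> sball v (2 * \<rho>)" using subcell_subset_cube[OF \<rho>(1) _ f] x N(2) cs by auto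
      have "\<bar>g x - g u\<bar> \<le> (2 * B / \<sigma>) * (\<Sum>i\<in>UNIV. \<bar>x $ i - u $ i\<bar>)"
      proof (rule abs_diff_le_partial[OF convex_sball xs u(1)])
        fix i z assume z: "z \<in> sball v (2 * \<rho>)"
        show "g differentiable at z" using smooth_on_differentiable_at[OF smg U, of z "[]"] z sU by auto
        show "\<bar>partial_deriv i g z\<bar> \<le> 2 * B / \<sigma>"
          using upB[of "[i]" z] D z \<sigma>0 by (simp add: iter_partial_Cons pos_le_divide_eq mult.commute)
      qed
      also have "\<dots> \<le> (2 * B / \<sigma>) * (\<Sum>i\<in>(UNIV :: 'k set). \<rho> / real N)"
        using u(2) B(1) \<sigma>0 by (intro mult_left_mono sum_mono) (auto simp: sball_def abs_minus_commute)
      also have "\<dots> = B / real N * (1 / 4)" unfolding \<sigma>_def using \<rho> k by simp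
      also have "\<dots> \<le> B / real N * 1" using B(1) by (intro mult_left_mono) auto
      finally have "\<bar>g x\<bar> \<le> 1 * B / real N" unfolding g_def b by simp
      then show "f \<in> near_zero_cells (1 * B) v \<rho> N g"
        unfolding near_zero_cells_def using f x by blast
    qed
    then have "card {f \<in> grid N. \<exists>x\<in>cube (subcorner v \<rho> N f) (\<rho> / real N). \<exists>u\<in>sball v (2 * \<rho>).
        L \<bullet> \<Phi> u = b \<and> u \<in> sball x (\<rho> / real N)} \<le> card (near_zero_cells (1 * B) v \<rho> N g)"
      by (rule card_mono[rotated]) (auto simp: near_zero_cells_def finite_grid)
    ultimately show "real (card {f \<in> grid N. \<exists>x\<in>cube (subcorner v \<rho> N f) (\<rho> / real N). \<exists>u\<in>sball v (2 * \<rho>).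
        L \<bullet> \<Phi> u = b \<and> u \<in> sball x (\<rho> / real N)}) \<le> \<epsilon> * real N ^ CARD('k)"
      by linarith
  qed
qed

section \<open>Escaping a cover through nested cubes\<close>

text \<open>With w i a power of the diameter of E i, this is the cost of the part of the cover that
  can still reach Q. It plays the role that the mass of Q has in a mass distribution
  argument.\<close>

definition hit_weight :: "(nat \<Rightarrow> 'a set) \<Rightarrow> (nat \<Rightarrow> real) \<Rightarrow> 'a set \<Rightarrow> real" where
  "hit_weight E w Q = (\<Sum>i. if E i \<inter> Q = {} then 0 else w i)"

lemma summable_hit:
  fixes w :: "nat \<Rightarrow> real"
  assumes "summable w" "\<And>i. 0 \<le> w i"
  shows "summable (\<lambda>i. if E i \<inter> Q = {} then 0 else w i)"
  by (rule summable_comparison_test'[OF assms(1), of 0]) (simp add: assms(2))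

lemma weight_le_hit_weight:
  assumes "summable w" "\<And>i. 0 \<le> w i" "E i \<inter> Q \<noteq> {}"
  shows "w i \<le> hit_weight E w Q"
  unfolding hit_weight_def
  using sum_le_suminf[OF summable_hit[OF assms(1,2)], of "{i}" E Q] assms by auto

text \<open>Each index can differ by at most 1 from that of one fixed cell that is hit. The strict
  bound on the differences matters, since closed cells whose indices differ by 2 are exactly one
  side apart.\<close>

lemma cells_hit_card:
  fixes E :: "(real ^ 'k::finite) set"
  assumes \<delta>: "0 < \<delta>" "\<delta> = \<rho> / real N"
    and diam: "\<And>x y i. x \<in> E \<Longrightarrow> y \<in> E \<Longrightarrow> \<bar>x $ i - y $ i\<bar> < \<delta>"
  shows "card {f \<in> grid N. E \<inter> cube (subcorner v \<rho> N f) \<delta> \<noteq> {}} \<le> 3 ^ CARD('k)"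
proof (cases "{f \<in> grid N. E \<inter> cube (subcorner v \<rho> N f) \<delta> \<noteq> {}} = {}")
  case False
  then obtain f0 x0 where f0: "x0 \<in> E" "x0 \<in> cube (subcorner v \<rho> N f0) \<delta>" by blast
  have "{f \<in> grid N. E \<inter> cube (subcorner v \<rho> N f) \<delta> \<noteq> {}} \<subseteq> {f. \<forall>i. f i \<in> {f0 i - 1..f0 i + 1}}"
  proof (intro subsetI CollectI allI)
    fix f i assume "f \<in> {f \<in> grid N. E \<inter> cube (subcorner v \<rho> N f) \<delta> \<noteq> {}}"
    then obtain x where x: "x \<in> E" "x \<in> cube (subcorner v \<rho> N f) \<delta>" by blast
    have d: "\<bar>x $ i - x0 $ i\<bar> < \<delta>" by (rule diam[OF x(1) f0(1)])
    have b: "v $ i + real (f i) * \<delta> \<le> x $ i" "x $ i \<le> v $ i + real (f i) * \<delta> + \<delta>"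
      "v $ i + real (f0 i) * \<delta> \<le> x0 $ i" "x0 $ i \<le> v $ i + real (f0 i) * \<delta> + \<delta>"
      using x(2) f0(2) unfolding cube_def subcorner_def \<delta>(2) by auto
    have "real (f i) * \<delta> < (real (f0 i) + 2) * \<delta>" "real (f0 i) * \<delta> < (real (f i) + 2) * \<delta>"
      unfolding distrib_right using d b by linarith+
    then have "real (f i) < real (f0 i) + 2" "real (f0 i) < real (f i) + 2"
      using \<delta>(1) by (simp_all only: mult_less_cancel_right_pos)
    then show "f i \<in> {f0 i - 1..f0 i + 1}" by auto
  qed
  from card_mono[OF finite_funs this]
  have "card {f \<in> grid N. E \<inter> cube (subcorner v \<rho> N f) \<delta> \<noteq> {}} \<le> (\<Prod>i\<in>UNIV. card {f0 i - 1..f0 i + 1})"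
    unfolding card_funs by simp
  also have "\<dots> \<le> (\<Prod>i\<in>(UNIV :: 'k set). 3)" by (intro prod_mono) auto
  finally show ?thesis by simp
next
  case True
  show ?thesis unfolding True by simp
qed

text \<open>Averaging: summed over the cells of G, each set that meets the cube is counted at most
  \<open>3 ^ CARD('k)\<close> times, while G contains at least half of the grid.\<close>

lemma light_cell:
  fixes E :: "nat \<Rightarrow> (real ^ 'k::finite) set" and w :: "nat \<Rightarrow> real"
  assumes w: "summable w" "\<And>i. 0 \<le> w i" and \<rho>: "0 < \<rho>" and N: "0 < N"
    and diam: "\<And>i x y j. E i \<inter> cube v \<rho> \<noteq> {} \<Longrightarrow> x \<in> E i \<Longrightarrow> y \<in> E i \<Longrightarrow> \<bar>x $ j - y $ j\<bar> < \<rho> / real N"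
    and G: "G \<subseteq> grid N" "real N ^ CARD('k) / 2 \<le> real (card G)"
  shows "\<exists>f\<in>G. hit_weight E w (cube (subcorner v \<rho> N f) (\<rho> / real N)) \<le> 2 * 3 ^ CARD('k) / real N ^ CARD('k) * hit_weight E w (cube v \<rho>)"
proof (rule ccontr)
  let ?k = "CARD('k)" and ?c = "\<lambda>f. cube (subcorner v \<rho> N f) (\<rho> / real N)"
  let ?W = "hit_weight E w (cube v \<rho>)"
  assume "\<not> ?thesis"
  then have *: "2 * 3 ^ ?k / real N ^ ?k * ?W < hit_weight E w (?c f)" if "f \<in> G" for f using that not_less by blast
  have W0: "0 \<le> ?W" unfolding hit_weight_def using w by (intro suminf_nonneg summable_hit) auto
  have finG: "finite G" using G(1) finite_grid finite_subset by blast
  have "0 < real N ^ ?k / 2" using N by simp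
  then have G0: "0 < card G" using G(2) by linarith
  then have Gne: "G \<noteq> {}" by auto
  have "3 ^ ?k * ?W = real N ^ ?k / 2 * (2 * 3 ^ ?k / real N ^ ?k * ?W)" using N by simp
  also have "\<dots> \<le> real (card G) * (2 * 3 ^ ?k / real N ^ ?k * ?W)"
    using G(2) W0 by (intro mult_right_mono) auto
  also have "\<dots> = (\<Sum>f\<in>G. 2 * 3 ^ ?k / real N ^ ?k * ?W)" by simp
  also have "\<dots> < (\<Sum>f\<in>G. hit_weight E w (?c f))"
    by (rule sum_strict_mono[OF finG Gne *])
  also have "\<dots> = (\<Sum>i. \<Sum>f\<in>G. if E i \<inter> ?c f = {} then 0 else w i)"
    unfolding hit_weight_def by (rule suminf_sum[symmetric]) (rule summable_hit[OF w])
  also have "\<dots> \<le> (\<Sum>i. 3 ^ ?k * (if E i \<inter> cube v \<rho> = {} then 0 else w i))"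
  proof (rule suminf_le)
    fix i
    have eq: "(\<Sum>f\<in>G. if E i \<inter> ?c f = {} then 0 else w i) = real (card {f \<in> G. E i \<inter> ?c f \<noteq> {}}) * w i"
    proof -
      have "(\<Sum>f\<in>G. if E i \<inter> ?c f = {} then 0 else w i) = (\<Sum>f\<in>{f \<in> G. E i \<inter> ?c f \<noteq> {}}. w i)"
        by (rule sum.mono_neutral_cong_right[OF finG]) auto
      then show ?thesis by simp
    qed
    show "(\<Sum>f\<in>G. if E i \<inter> ?c f = {} then 0 else w i) \<le> 3 ^ ?k * (if E i \<inter> cube v \<rho> = {} then 0 else w i)"
    proof (cases "E i \<inter> cube v \<rho> = {}")
      case True
      then have "E i \<inter> ?c f = {}" if "f \<in> G" for f
        using subcell_subset_cube[OF \<rho> N, of f v] that G(1) by blast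
      then show ?thesis using True by simp
    next
      case False
      have "card {f \<in> G. E i \<inter> ?c f \<noteq> {}} \<le> card {f \<in> grid N. E i \<inter> ?c f \<noteq> {}}"
        using G(1) by (intro card_mono) (auto simp: finite_grid)
      also have "\<dots> \<le> 3 ^ ?k"
        by (rule cells_hit_card[OF _ refl diam[OF False]]) (use \<rho> N in simp)
      finally have "real (card {f \<in> G. E i \<inter> ?c f \<noteq> {}}) \<le> real (3 ^ ?k)"
        by (rule of_nat_mono)
      then have "real (card {f \<in> G. E i \<inter> ?c f \<noteq> {}}) * w i \<le> 3 ^ ?k * w i"
        using w(2)[of i] by (intro mult_right_mono) simp_all
      then show ?thesis unfolding eq if_not_P[OF False] .
    qed
  next
    show "summable (\<lambda>i. \<Sum>f\<in>G. if E i \<inter> ?c f = {} then 0 else w i)"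
      by (rule summable_sum) (rule summable_hit[OF w])
    show "summable (\<lambda>i. 3 ^ ?k * (if E i \<inter> cube v \<rho> = {} then 0 else w i))"
      by (rule summable_mult) (rule summable_hit[OF w])
  qed
  also have "\<dots> = 3 ^ ?k * ?W" unfolding hit_weight_def by (rule suminf_mult) (rule summable_hit[OF w])
  finally show False by simp
qed

lemma powr_less_imp_less:
  fixes a b s :: real
  assumes "a powr s < b powr s" "0 < s" "0 \<le> b"
  shows "a < b"
  using powr_mono2[of s b a] assms by linarith

text \<open>By \<open>light_cell\<close> and \<open>Ns\<close>, passing to a suitable allowed
  subcube divides the weight by at least \<open>real N powr s\<close>. The s-th power of the side
  shrinks by exactly that factor, so the strict bound between them survives every step. A set
  containing the limit point would have d i below every side length, contrary to
  \<open>0 < d i\<close>.\<close>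

theorem escape_cover:
  fixes E :: "nat \<Rightarrow> (real ^ 'k::finite) set" and d :: "nat \<Rightarrow> real"
  assumes s: "0 < s" and N: "2 \<le> N" and Ns: "2 * 3 ^ CARD('k) * real N powr s \<le> real N ^ CARD('k)"
    and \<rho>: "0 < \<rho>" and d: "\<And>i. 0 < d i"
    and diam: "\<And>i x y j. x \<in> E i \<Longrightarrow> y \<in> E i \<Longrightarrow> \<bar>x $ j - y $ j\<bar> \<le> d i"
    and sm: "summable (\<lambda>i. d i powr s)" "(\<Sum>i. d i powr s) < (\<rho> / real N) powr s"
    and bad: "\<And>n v. cube v (\<rho> / real N ^ n) \<subseteq> cube v0 \<rho> \<Longrightarrow> real (card (bad n v)) \<le> real N ^ CARD('k) / 2"
      "\<And>n v. bad n v \<subseteq> grid N"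
  obtains x v where "\<And>n. x \<in> cube (v n) (\<rho> / real N ^ n)" "\<And>i. x \<notin> E i" "\<And>n. cube (v n) (\<rho> / real N ^ n) \<subseteq> cube v0 \<rho>"
    "\<And>n. \<exists>f\<in>grid N - bad n (v n). v (Suc n) = subcorner (v n) (\<rho> / real N ^ n) N f"
proof -
  define w where "w = (\<lambda>i. d i powr s)"
  have w: "summable w" "\<And>i. 0 \<le> w i" unfolding w_def using sm(1) by auto
  define R where "R = (\<lambda>n. \<rho> / real N ^ n)"
  have R0: "0 < R n" for n unfolding R_def using \<rho> N by simp
  have RS: "R n / real N = R (Suc n)" for n unfolding R_def using N by simp
  \<comment> \<open>The bound on the weight forces every set that meets the \<open>n\<close>-th cube to have diameter below
    the next side length, hence to meet at most \<open>3\<^sup>k\<close> of its subcubes.\<close>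
  define P where "P = (\<lambda>n v. cube v (R n) \<subseteq> cube v0 \<rho> \<and> hit_weight E w (cube v (R n)) < R (Suc n) powr s)"
  define S where "S = (\<lambda>n v v'. \<exists>f\<in>grid N - bad n v. v' = subcorner v (R n) N f)"
  have hit: "d i < R (Suc n)" if "P n v" "E i \<inter> cube v (R n) \<noteq> {}" for n v i
  proof (rule powr_less_imp_less[OF _ s])
    show "d i powr s < R (Suc n) powr s"
      using weight_le_hit_weight[OF w, of E i "cube v (R n)"] that unfolding P_def w_def by linarith
  qed (use R0 in \<open>simp add: order_less_imp_le\<close>)
  have "\<exists>v. \<forall>n. P n (v n) \<and> S n (v n) (v (Suc n))"
  proof (rule dependent_nat_choice)
    have "hit_weight E w (cube v0 \<rho>) \<le> (\<Sum>i. w i)"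
      unfolding hit_weight_def by (rule suminf_le) (use w summable_hit[OF w] in auto)
    then show "\<exists>v. P 0 v"
      unfolding P_def using sm(2) by (intro exI[of _ v0]) (simp add: R_def w_def)
  next
    fix v n assume P: "P n v"
    let ?G = "grid N - bad n v"
    have sub: "cube v (R n) \<subseteq> cube v0 \<rho>" using P unfolding P_def by simp
    have "finite (bad n v)" using bad(2) finite_grid finite_subset by blast
    then have "real (card ?G) = real N ^ CARD('k) - real (card (bad n v))"
      using bad(2)[of n v] card_mono[OF finite_grid bad(2)]
      by (simp add: card_Diff_subset card_grid of_nat_diff)
    then have "real N ^ CARD('k) / 2 \<le> real (card ?G)"
      using bad(1)[OF sub[unfolded R_def]] by linarith
    have "\<exists>f\<in>?G. hit_weight E w (cube (subcorner v (R n) N f) (R n / real N)) \<le> 2 * 3 ^ CARD('k) / real N ^ CARD('k) * hit_weight E w (cube v (R n))"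
    proof (rule light_cell[OF w R0])
      fix i x y j assume "E i \<inter> cube v (R n) \<noteq> {}" and xy: "x \<in> E i" "y \<in> E i"
      then have "d i < R n / real N" using hit[OF P] unfolding RS by blast
      then show "\<bar>x $ j - y $ j\<bar> < R n / real N" using diam[OF xy, of j] by linarith
    qed (use N \<open>real N ^ CARD('k) / 2 \<le> real (card ?G)\<close> in auto)
    then obtain f where f: "f \<in> ?G"
      and le: "hit_weight E w (cube (subcorner v (R n) N f) (R n / real N)) \<le> 2 * 3 ^ CARD('k) / real N ^ CARD('k) * hit_weight E w (cube v (R n))"
      by blast
    have "2 * 3 ^ CARD('k) / real N ^ CARD('k) * hit_weight E w (cube v (R n)) < 2 * 3 ^ CARD('k) / real N ^ CARD('k) * R (Suc n) powr s"
      using P N unfolding P_def by (intro mult_strict_left_mono) auto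
    also have "\<dots> \<le> R (Suc (Suc n)) powr s"
    proof -
      have "2 * 3 ^ CARD('k) / real N ^ CARD('k) \<le> 1 / real N powr s"
        using Ns N by (simp add: field_simps)
      then have "2 * 3 ^ CARD('k) / real N ^ CARD('k) * R (Suc n) powr s \<le> 1 / real N powr s * R (Suc n) powr s"
        by (intro mult_right_mono) auto
      also have "\<dots> = R (Suc (Suc n)) powr s"
        unfolding RS[of "Suc n", symmetric] using R0[of "Suc n"] by (simp add: powr_divide)
      finally show ?thesis .
    qed
    finally have "hit_weight E w (cube (subcorner v (R n) N f) (R (Suc n))) < R (Suc (Suc n)) powr s"
      using le unfolding RS by linarith
    moreover have "cube (subcorner v (R n) N f) (R (Suc n)) \<subseteq> cube v (R n)"
      unfolding RS[symmetric] by (rule subcell_subset_cube[OF R0]) (use f N in auto)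
    ultimately have "P (Suc n) (subcorner v (R n) N f)"
      unfolding P_def using sub by simp
    then show "\<exists>v'. P (Suc n) v' \<and> S n v v'" unfolding S_def using f by blast
  qed
  then obtain v where v: "\<And>n. P n (v n)" "\<And>n. S n (v n) (v (Suc n))" by blast
  have step: "cube (v (Suc n)) (R (Suc n)) \<subseteq> cube (v n) (R n)" for n
  proof -
    obtain f where "f \<in> grid N" "v (Suc n) = subcorner (v n) (R n) N f" using v(2)[of n] unfolding S_def by blast
    then show ?thesis using subcell_subset_cube[OF R0, of N f "v n" n] N unfolding RS by simp
  qed
  have "\<Inter>(range (\<lambda>n. cube (v n) (R n))) \<noteq> {}"
  proof (rule compact_nest)
    fix n
    have "cube (v n) (R n) = cbox (v n) (v n + (\<chi> i. R n))"
      unfolding cube_def by (auto simp: mem_box_cart)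
    then show "compact (cube (v n) (R n))" by simp
    show "cube (v n) (R n) \<noteq> {}" using R0[of n] by (auto simp: cube_def intro!: exI[of _ "v n"])
  next
    show "cube (v n) (R n) \<subseteq> cube (v m) (R m)" if "m \<le> n" for m n
      using that step by (rule lift_Suc_antimono_le[rotated])
  qed
  then obtain x where x: "\<And>n. x \<in> cube (v n) (R n)" by blast
  have "x \<notin> E i" for i
  proof
    assume "x \<in> E i"
    then have less: "d i < R (Suc n)" for n using hit[OF v(1)] x by blast
    have "(\<lambda>n. \<rho> * (1 / real N) ^ n) \<longlonglongrightarrow> 0"
      using N by (intro tendsto_mult_right_zero LIMSEQ_realpow_zero) auto
    then have "R \<longlonglongrightarrow> 0" unfolding R_def by (simp add: power_divide)
    then have "(\<lambda>n. R (Suc n)) \<longlonglongrightarrow> 0" by (rule LIMSEQ_Suc)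
    then have "d i \<le> 0" by (rule LIMSEQ_le_const) (use less in \<open>auto intro: order_less_imp_le\<close>)
    then show False using d[of i] by simp
  qed
  then show thesis
    using that[of x v] x v unfolding P_def S_def R_def by blast
qed

section \<open>Badly approximable points on the manifold\<close>

lemma max_dist_nonneg: "0 \<le> max_dist x y"
  by (simp add: max_dist_def infnorm_pos_le)

lemma max_dist_le_dist: "max_dist x y \<le> dist x y"
  by (simp add: max_dist_def infnorm_le_norm dist_norm)

lemma dist_le_max_dist: "dist x y \<le> sqrt (real CARD('d)) * max_dist x (y :: real ^ 'd)"
  using norm_le_infnorm[of "x - y"] by (simp add: max_dist_def dist_norm)

text \<open>The linear map T = D\<Phi>(v0) stretches by at least some B > 0. On a small ball \<Phi>
  - T is Lipschitz with constant B / 2, because the partial derivatives are continuous, so \<Phi>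
  still stretches by B / 2.\<close>

lemma lower_lipschitz:
  fixes \<Phi> :: "real ^ 'k::finite \<Rightarrow> real ^ 'd::finite"
  assumes sm: "smooth_on U \<Phi>" and U: "open U" and v0: "v0 \<in> U" and inj: "inj (frechet_derivative \<Phi> (at v0))"
  obtains r c where "0 < r" "0 < c" "ball v0 r \<subseteq> U"
    "\<And>x y i. x \<in> ball v0 r \<Longrightarrow> y \<in> ball v0 r \<Longrightarrow> c * \<bar>x $ i - y $ i\<bar> \<le> max_dist (\<Phi> x) (\<Phi> y)"
proof -
  define T where "T = frechet_derivative \<Phi> (at v0)"
  have der: "(\<Phi> has_derivative frechet_derivative \<Phi> (at x)) (at x)" if "x \<in> U" for x
    using smooth_on_differentiable_at[OF sm U that, of "[]"] frechet_derivative_works by auto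
  have blT: "bounded_linear T" unfolding T_def by (rule has_derivative_bounded_linear[OF der[OF v0]])
  obtain B where B: "0 < B" "\<And>h. B * norm h \<le> norm (T h)"
    using linear_inj_bounded_below_pos[OF bounded_linear.linear[OF blT]] inj unfolding T_def by metis
  define k where "k = real CARD('k)"
  have k: "0 < k" unfolding k_def by simp
  have "\<forall>i\<in>(UNIV :: 'k set). \<forall>\<^sub>F x in nhds v0. dist (partial_deriv i \<Phi> x) (partial_deriv i \<Phi> v0) < B / (2 * k)"
  proof
    fix i :: 'k
    have "isCont (iter_partial [i] \<Phi>) v0"
      using smooth_on_iter_continuous[OF sm U] U v0 continuous_on_eq_continuous_at by blast
    then show "\<forall>\<^sub>F x in nhds v0. dist (partial_deriv i \<Phi> x) (partial_deriv i \<Phi> v0) < B / (2 * k)"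
      unfolding isCont_def iter_partial_Cons iter_partial_Nil using B(1) k
      by (intro tendstoD) (auto simp: tendsto_at_iff_tendsto_nhds)
  qed
  then have "\<forall>\<^sub>F x in nhds v0. \<forall>i\<in>UNIV. dist (partial_deriv i \<Phi> x) (partial_deriv i \<Phi> v0) < B / (2 * k)"
    by (rule eventually_ball_finite[OF finite])
  then obtain r1 where r1: "0 < r1" "\<And>x i. dist x v0 < r1 \<Longrightarrow> dist (partial_deriv i \<Phi> x) (partial_deriv i \<Phi> v0) < B / (2 * k)"
    unfolding eventually_nhds_metric by blast
  obtain r2 where r2: "0 < r2" "ball v0 r2 \<subseteq> U" using U v0 open_contains_ball by blast
  define r where "r = min r1 r2"
  have rU: "ball v0 r \<subseteq> U" using r2 unfolding r_def by auto
  have low: "B / 2 * norm (x - y) \<le> norm (\<Phi> x - \<Phi> y)" if x: "x \<in> ball v0 r" and y: "y \<in> ball v0 r" for x y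
  proof -
    have "norm ((\<Phi> x - T x) - (\<Phi> y - T y)) \<le> B / 2 * norm (x - y)"
    proof (rule differentiable_bound[OF convex_ball _ _ x y])
      fix z assume z: "z \<in> ball v0 r"
      let ?F = "frechet_derivative \<Phi> (at z)"
      have dz: "(\<Phi> has_derivative ?F) (at z)" using der z rU by blast
      show "((\<lambda>x. \<Phi> x - T x) has_derivative (\<lambda>h. ?F h - T h)) (at z within ball v0 r)"
        by (intro has_derivative_diff has_derivative_at_withinI[OF dz] bounded_linear_imp_has_derivative blT)
      show "onorm (\<lambda>h. ?F h - T h) \<le> B / 2"
      proof (rule onorm_le)
        fix h
        have "?F h - T h = (\<Sum>i\<in>UNIV. (h $ i) *\<^sub>R (partial_deriv i \<Phi> z - partial_deriv i \<Phi> v0))"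
          using frechet_derivative_eq_sum_partial[OF dz, of h] frechet_derivative_eq_sum_partial[OF der[OF v0], of h]
          unfolding T_def by (simp add: sum_subtractf scaleR_diff_right)
        also have "norm \<dots> \<le> (\<Sum>i\<in>(UNIV :: 'k set). norm h * (B / (2 * k)))"
        proof (rule order_trans[OF norm_sum sum_mono])
          fix i
          have "dist (partial_deriv i \<Phi> z) (partial_deriv i \<Phi> v0) < B / (2 * k)"
            using r1(2)[of z i] z unfolding r_def by (simp add: dist_commute)
          then show "norm ((h $ i) *\<^sub>R (partial_deriv i \<Phi> z - partial_deriv i \<Phi> v0)) \<le> norm h * (B / (2 * k))"
            unfolding norm_scaleR using component_le_norm_cart[of h i] by (intro mult_mono) (auto simp: dist_norm)
        qed
        also have "\<dots> = B / 2 * norm h" using k unfolding k_def by simp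
        finally show "norm (?F h - T h) \<le> B / 2 * norm h" .
      qed
    qed
    moreover have "B * norm (x - y) \<le> norm (T x - T y)"
      using B(2)[of "x - y"] bounded_linear.linear[OF blT] by (simp add: linear_diff)
    moreover have "norm (T x - T y) \<le> norm (\<Phi> x - \<Phi> y) + norm ((\<Phi> x - T x) - (\<Phi> y - T y))"
      using norm_triangle_ineq4[of "\<Phi> x - \<Phi> y" "(\<Phi> x - T x) - (\<Phi> y - T y)"] by (simp add: algebra_simps)
    ultimately show ?thesis by (simp add: field_simps)
  qed
  define d where "d = sqrt (real CARD('d))"
  have d: "0 < d" unfolding d_def by simp
  show thesis
  proof (rule that[of r "B / (2 * d)"])
    show "0 < r" using r1 r2 unfolding r_def by simp
    show "0 < B / (2 * d)" using B d by simp
    show "ball v0 r \<subseteq> U" by (rule rU)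
    fix x y i assume xy: "x \<in> ball v0 r" "y \<in> ball v0 r"
    have "B / 2 * \<bar>x $ i - y $ i\<bar> \<le> B / 2 * norm (x - y)"
      using component_le_norm_cart[of "x - y" i] B by (intro mult_left_mono) auto
    also have "\<dots> \<le> d * max_dist (\<Phi> x) (\<Phi> y)"
      using low[OF xy] dist_le_max_dist[of "\<Phi> x" "\<Phi> y"] unfolding d_def dist_norm by linarith
    finally show "B / (2 * d) * \<bar>x $ i - y $ i\<bar> \<le> max_dist (\<Phi> x) (\<Phi> y)"
      using d by (simp add: field_simps)
  qed
qed

lemma separation_from_rest:
  fixes \<Phi> :: "real ^ 'k::finite \<Rightarrow> real ^ 'd::finite"
  assumes lp: "local_parameterization M U \<Phi>" and W: "open W" "W \<subseteq> U" and K: "compact K" "K \<subseteq> W"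
  obtains \<eta> where "0 < \<eta>" "\<And>x y. x \<in> K \<Longrightarrow> y \<in> M \<Longrightarrow> y \<notin> \<Phi> ` W \<Longrightarrow> \<eta> \<le> max_dist (\<Phi> x) y"
proof -
  obtain \<Theta> where hom: "homeomorphism U (\<Phi> ` U) \<Phi> \<Theta>" and U: "open U" and op: "openin (top_of_set M) (\<Phi> ` U)"
    using lp unfolding local_parameterization_def by blast
  have "openin (top_of_set U) W" using W U by (simp add: openin_open_eq)
  then have "openin (top_of_set (\<Phi> ` U)) (\<Phi> ` W)" by (rule homeomorphism_imp_open_map[OF hom])
  then have "openin (top_of_set M) (\<Phi> ` W)" using op openin_trans by blast
  then obtain T where T: "open T" "\<Phi> ` W = M \<inter> T" unfolding openin_open by blast
  have "continuous_on K \<Phi>" using hom K W unfolding homeomorphism_def by (meson continuous_on_subset order_trans)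
  then have "compact (\<Phi> ` K)" using K(1) compact_continuous_image by blast
  moreover have "\<Phi> ` K \<subseteq> T" using T(2) K by blast
  ultimately obtain e where e: "0 < e" "(\<Union>x\<in>\<Phi> ` K. ball x e) \<subseteq> T"
    using compact_subset_open_imp_ball_epsilon_subset[OF _ T(1)] by metis
  define d where "d = sqrt (real CARD('d))"
  have d: "0 < d" unfolding d_def by simp
  show thesis
  proof (rule that[of "e / d"])
    show "0 < e / d" using e d by simp
    fix x y assume x: "x \<in> K" and y: "y \<in> M" "y \<notin> \<Phi> ` W"
    have "y \<notin> ball (\<Phi> x) e" using e(2) T(2) x y by blast
    then have "e \<le> d * max_dist (\<Phi> x) y"
      using dist_le_max_dist[of "\<Phi> x" y] unfolding d_def by simp
    then show "e / d \<le> max_dist (\<Phi> x) y" using d by (simp add: field_simps)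
  qed
qed

lemma iter_partial_bounded:
  fixes \<Phi> :: "real ^ 'k::finite \<Rightarrow> real ^ 'd::finite"
  assumes "smooth_on U \<Phi>" "open U" "compact K" "K \<subseteq> U"
  obtains C where "0 \<le> C" "\<And>is x. length is \<le> m \<Longrightarrow> x \<in> K \<Longrightarrow> norm (iter_partial is \<Phi> x) \<le> C"
proof -
  have "\<exists>b. \<forall>x\<in>K. norm (iter_partial is \<Phi> x) \<le> b" for "is"
  proof -
    have "continuous_on K (iter_partial is \<Phi>)"
      using smooth_on_iter_continuous[OF assms(1,2)] assms(4) continuous_on_subset by blast
    then have "bounded (iter_partial is \<Phi> ` K)" using assms(3) compact_continuous_image compact_imp_bounded by blast
    then show ?thesis unfolding bounded_iff by auto
  qed
  then obtain b where b: "\<And>is x. x \<in> K \<Longrightarrow> norm (iter_partial is \<Phi> x) \<le> b is" by metis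
  let ?I = "{is :: 'k list. length is \<le> m}"
  have fin: "finite ?I" using finite_lists_length_le[of "UNIV :: 'k set" m] by simp
  show thesis
  proof (rule that[of "\<Sum>is\<in>?I. \<bar>b is\<bar>"])
    fix "is" :: "'k list" and x assume "length is \<le> m" "x \<in> K"
    then show "norm (iter_partial is \<Phi> x) \<le> (\<Sum>is\<in>?I. \<bar>b is\<bar>)"
      using b[of x "is"] member_le_sum[of "is" ?I "\<lambda>is. \<bar>b is\<bar>"] fin by fastforce
  qed (simp add: sum_nonneg)
qed

lemma psi_pos: "0 < t \<Longrightarrow> 0 < psi c t"
  by (simp add: psi_def)

lemma psi_le_1: "0 \<le> c \<Longrightarrow> 1 \<le> t \<Longrightarrow> psi c t \<le> 1"
  unfolding psi_def using powr_mono[of "-c" 0 t] by simp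

lemma c_kd_pos:
  assumes "1 \<le> k" "k \<le> d"
  shows "0 < c_kd k d"
  using kd_decomposition(3)[OF assms] by (simp add: c_kd_def)

text \<open>The simplex lemma with its height bound replaced by a comparison of the scale with
  \<open>psi\<close> of the height, the form needed when descending through scales.\<close>

lemma rational_points_on_hyperplane:
  fixes \<Phi> :: "real ^ 'k::finite \<Rightarrow> real ^ 'd::finite"
  assumes "smooth_on U \<Phi>" "open U" and kd: "CARD('k) \<le> CARD('d)" and "0 \<le> C0"
    and "\<And>is x j. x \<in> W \<Longrightarrow> length is \<le> Suc (n_kd CARD('k) CARD('d)) \<Longrightarrow> \<bar>iter_partial is \<Phi> x $ j\<bar> \<le> C0"
    and "W \<subseteq> U"
  obtains \<tau> where "0 < \<tau>"
    "\<And>v \<rho>. 0 < \<rho> \<Longrightarrow> 2 * \<rho> \<le> 1 \<Longrightarrow> sball v (2 * \<rho>) \<subseteq> W \<Longrightarrow>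
      \<exists>L b. norm L = 1 \<and> (\<forall>u\<in>sball v (2 * \<rho>). \<Phi> u \<in> rat_points \<longrightarrow>
        \<rho> \<le> \<tau> * psi (c_kd CARD('k) CARD('d)) (real (height (\<Phi> u))) \<longrightarrow> L \<bullet> \<Phi> u = b)"
proof -
  let ?N = "N_kd CARD('k) CARD('d)" and ?c = "c_kd CARD('k) CARD('d)"
  have k1: "1 \<le> CARD('k)" by (simp add: Suc_leI)
  have N1: "1 \<le> ?N" and c0: "0 < ?c" using kd_decomposition(3)[OF k1 kd] c_kd_pos[OF k1 kd] by auto
  obtain C where C: "C > 0"
    "\<And>v \<rho> T. 0 < \<rho> \<Longrightarrow> \<rho> \<le> 1 \<Longrightarrow> sball v \<rho> \<subseteq> W \<Longrightarrow> 0 \<le> T \<Longrightarrow>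
      C * \<rho> ^ ?N * T ^ Suc CARD('d) < 1 \<Longrightarrow>
      \<exists>L b. norm L = 1 \<and> (\<forall>u\<in>sball v \<rho>. \<Phi> u \<in> rat_points \<longrightarrow> real (height (\<Phi> u)) \<le> T \<longrightarrow> L \<bullet> \<Phi> u = b)"
    using simplex_lemma[OF assms] by metis
  \<comment> \<open>With 2 * \<tau> \<le> 1 and a positive exponent, C times the power of 2 * \<tau>
    is at most 2 * C * \<tau> \<le> 1 / 2. The factor 2 belongs to the radius 2 * \<rho>.\<close>
  define \<tau> where "\<tau> = min (1 / 2) (1 / (4 * C))"
  have \<tau>: "0 < \<tau>" "2 * \<tau> \<le> 1" unfolding \<tau>_def using C(1) by auto
  have C\<tau>: "C * (2 * \<tau>) ^ ?N < 1"
  proof -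
    have "(2 * \<tau>) ^ ?N \<le> (2 * \<tau>) ^ 1" using \<tau> N1 by (intro power_decreasing) auto
    then have "C * (2 * \<tau>) ^ ?N \<le> C * (2 * \<tau>)" using C(1) by simp
    also have "\<dots> \<le> C * (2 * (1 / (4 * C)))" unfolding \<tau>_def using C(1) by (intro mult_left_mono) auto
    also have "\<dots> < 1" using C(1) by simp
    finally show ?thesis .
  qed
  show thesis
  proof (rule that[OF \<tau>(1)])
    fix v \<rho> assume \<rho>: "0 < \<rho>" "2 * \<rho> \<le> 1" "sball v (2 * \<rho>) \<subseteq> W"
    \<comment> \<open>The largest height H with \<rho> \<le> \<tau> * \<open>psi ?c H\<close>. The
      choice of \<open>c_kd\<close> makes its power \<open>Suc CARD('d)\<close> equal to the power
      \<open>?N\<close> of \<tau> / \<rho>, so \<rho> cancels from the smallness condition.\<close>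
    define T where "T = (\<tau> / \<rho>) powr (1 / ?c)"
    have T0: "0 < T" unfolding T_def using \<tau> \<rho> by simp
    have "T ^ Suc CARD('d) = T powr real (Suc CARD('d))" by (rule powr_realpow[OF T0, symmetric])
    also have "\<dots> = (\<tau> / \<rho>) powr (real (Suc CARD('d)) / ?c)"
      unfolding T_def powr_powr by (simp only: times_divide_eq_left mult_1)
    also have "real (Suc CARD('d)) / ?c = real ?N"
    proof -
      have "a / (a / b) = b" if "a \<noteq> 0" "b \<noteq> 0" for a b :: real using that by simp
      from this[of "real (Suc CARD('d))" "real ?N"] show ?thesis
        using N1 unfolding c_kd_def of_nat_Suc by (simp add: add.commute)
    qed
    also have "(\<tau> / \<rho>) powr real ?N = (\<tau> / \<rho>) ^ ?N" using \<tau> \<rho> by (simp add: powr_realpow)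
    finally have "C * (2 * \<rho>) ^ ?N * T ^ Suc CARD('d) = C * (2 * \<tau>) ^ ?N"
      using \<rho>(1) by (simp add: power_mult_distrib power_divide)
    then have small: "C * (2 * \<rho>) ^ ?N * T ^ Suc CARD('d) < 1" using C\<tau> by linarith
    have "\<exists>L b. norm L = 1 \<and> (\<forall>u\<in>sball v (2 * \<rho>). \<Phi> u \<in> rat_points \<longrightarrow> real (height (\<Phi> u)) \<le> T \<longrightarrow> L \<bullet> \<Phi> u = b)"
      by (rule C(2)[OF _ \<rho>(2,3) _ small]) (use \<rho>(1) T0 in simp_all)
    then obtain L b where *: "norm L = 1 \<and> (\<forall>u\<in>sball v (2 * \<rho>). \<Phi> u \<in> rat_points \<longrightarrow> real (height (\<Phi> u)) \<le> T \<longrightarrow> L \<bullet> \<Phi> u = b)"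
      by (elim exE)
    have Lb: "norm L = 1" "\<And>u. u \<in> sball v (2 * \<rho>) \<Longrightarrow> \<Phi> u \<in> rat_points \<Longrightarrow> real (height (\<Phi> u)) \<le> T \<Longrightarrow> L \<bullet> \<Phi> u = b"
      using * by simp_all
    have le_T: "real (height y) \<le> T" if "y \<in> rat_points" "\<rho> \<le> \<tau> * psi ?c (real (height y))" for y :: "real ^ 'd"
    proof -
      let ?H = "real (height y)"
      have H: "0 < ?H" using height_pos[OF that(1)] by simp
      have "?H powr ?c \<le> \<tau> / \<rho>"
      proof -
        have "\<rho> \<le> \<tau> / ?H powr ?c" using that(2) unfolding psi_def powr_minus divide_inverse .
        then have "\<rho> * ?H powr ?c \<le> \<tau>" using H by (simp add: pos_le_divide_eq)
        then show ?thesis using \<rho>(1) by (simp add: pos_le_divide_eq mult.commute)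
      qed
      then have "(?H powr ?c) powr (1 / ?c) \<le> T"
        unfolding T_def using c0 by (intro powr_mono2) auto
      then show ?thesis using H c0 by (simp add: powr_powr)
    qed
    show "\<exists>L b. norm L = 1 \<and> (\<forall>u\<in>sball v (2 * \<rho>). \<Phi> u \<in> rat_points \<longrightarrow>
        \<rho> \<le> \<tau> * psi ?c (real (height (\<Phi> u))) \<longrightarrow> L \<bullet> \<Phi> u = b)"
      by (intro exI[of _ L] exI[of _ b] conjI ballI impI Lb le_T)
  qed
qed

lemma sball_subset_ball:
  fixes v :: "real ^ 'k::finite"
  assumes "real CARD('k) * t < r"
  shows "sball v t \<subseteq> ball v r"
proof
  fix x assume x: "x \<in> sball v t"
  have "dist v x \<le> (\<Sum>i\<in>UNIV. \<bar>(v - x) $ i\<bar>)"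
    unfolding dist_norm by (rule norm_le_l1_cart)
  also have "\<dots> \<le> (\<Sum>i\<in>(UNIV :: 'k set). t)"
    using x by (intro sum_mono) (auto simp: sball_def abs_minus_commute)
  finally show "x \<in> ball v r" using assms by simp
qed

text \<open>This is where s < k enters: the gain from choosing among the subcubes beats the loss
  factors 2 (forbidden subcubes) and \<open>3 ^ k\<close> (sets meeting several subcubes).\<close>

lemma large_branching:
  assumes "s < real k"
  shows "\<exists>N1 :: nat. \<forall>N\<ge>N1. 2 * 3 ^ k * real N powr s \<le> real N ^ k"
proof -
  define a where "a = real k - s"
  have a: "0 < a" unfolding a_def using assms by simp
  define c where "c = (2 * 3 ^ k :: real)"
  have c: "0 < c" unfolding c_def by simp
  define N1 where "N1 = nat \<lceil>c powr (1 / a)\<rceil> + 1"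
  have "c * real N powr s \<le> real N ^ k" if N: "N1 \<le> N" for N
  proof -
    have N0: "0 < real N" using N unfolding N1_def by linarith
    have "c powr (1 / a) \<le> real N" using N unfolding N1_def by linarith
    then have "(c powr (1 / a)) powr a \<le> real N powr a" using a by (intro powr_mono2) auto
    then have "c \<le> real N powr a" using a c by (simp add: powr_powr)
    then have "c * real N powr s \<le> real N powr a * real N powr s" by (intro mult_right_mono) auto
    also have "\<dots> = real N ^ k" using N0 by (simp add: a_def flip: powr_add powr_realpow)
    finally show ?thesis .
  qed
  then show ?thesis unfolding c_def by blast
qed

lemma nested_cubes_badly_approximable:
  fixes \<Phi> :: "real ^ 'k::finite \<Rightarrow> real ^ 'd::finite"
  assumes c: "0 < c" and c1: "0 < c1" and \<eta>: "0 < \<eta>" and \<tau>: "0 < \<tau>" and \<rho>: "0 < \<rho>" and N: "2 \<le> N"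
    and M: "\<Phi> ` W \<subseteq> M" and xW: "x \<in> W"
    and lip: "\<And>u i. u \<in> W \<Longrightarrow> c1 * \<bar>u $ i - x $ i\<bar> \<le> max_dist (\<Phi> x) (\<Phi> u)"
    and sep: "\<And>y. y \<in> M \<Longrightarrow> y \<notin> \<Phi> ` W \<Longrightarrow> \<eta> \<le> max_dist (\<Phi> x) y"
    and x: "\<And>n. x \<in> cube (v n) (\<rho> / real N ^ n)"
    and avoid: "\<And>n u. u \<in> sball (v n) (2 * (\<rho> / real N ^ n)) \<Longrightarrow> \<Phi> u \<in> rat_points \<Longrightarrow>
      \<rho> / real N ^ n \<le> \<tau> * psi c (real (height (\<Phi> u))) \<Longrightarrow> u \<notin> sball x (\<rho> / real N ^ Suc n)"
  shows "\<Phi> x \<in> BA M (psi c)"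
proof -
  define R where "R = (\<lambda>n. \<rho> / real N ^ n)"
  have R0: "0 < R n" for n unfolding R_def using \<rho> N by simp
  have RS: "R (Suc n) = R n / real N" for n unfolding R_def using N by simp
  have Rlim: "R \<longlonglongrightarrow> 0"
  proof -
    have "(\<lambda>n. \<rho> * (1 / real N) ^ n) \<longlonglongrightarrow> 0"
      using N by (intro tendsto_mult_right_zero LIMSEQ_realpow_zero) auto
    then show ?thesis unfolding R_def by (simp add: power_divide)
  qed
  define b where "b = min \<eta> (min (c1 * R 1) (c1 * \<tau> / (real N)\<^sup>2))"
  have b: "0 < b" unfolding b_def using \<eta> c1 R0 \<tau> N by simp
  have "b * psi c (real (height y)) \<le> max_dist (\<Phi> x) y" if y: "y \<in> rat_points" "y \<in> M" for y
  proof -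
    let ?H = "real (height y)"
    have H: "1 \<le> ?H" using height_pos[OF y(1)] by simp
    have psi: "0 < psi c ?H" "psi c ?H \<le> 1" using H c by (simp_all add: psi_pos psi_le_1)
    show ?thesis
    proof (cases "y \<in> \<Phi> ` W")
      case False
      have "b * psi c ?H \<le> b * 1" using psi b by (intro mult_left_mono) auto
      also have "\<dots> \<le> \<eta>" unfolding b_def by simp
      also have "\<dots> \<le> max_dist (\<Phi> x) y" by (rule sep[OF y(2) False])
      finally show ?thesis .
    next
      case True
      then obtain u where u: "u \<in> W" "y = \<Phi> u" by blast
      have "\<forall>\<^sub>F n in sequentially. R n < \<tau> * psi c ?H"
        using order_tendstoD(2)[OF Rlim] \<tau> psi by simp
      then have ex: "\<exists>n. R n \<le> \<tau> * psi c ?H"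
        by (meson eventually_sequentially order_less_imp_le order_refl)
      \<comment> \<open>The first scale at which the height of \<open>y\<close> is taken into account; its predecessor
        compares \<open>R n\<close> with \<open>psi c\<close> of the height.\<close>
      define n where "n = (LEAST n. R n \<le> \<tau> * psi c ?H)"
      have n: "R n \<le> \<tau> * psi c ?H" unfolding n_def using ex by (rule LeastI_ex)
      \<comment> \<open>As x lies in the n-th cube, a point this close to x lies in the doubled ball
        around \<open>v n\<close>, where \<open>avoid\<close> excludes it.\<close>
      have "u \<notin> sball x (R (Suc n))"
      proof
        assume ux: "u \<in> sball x (R (Suc n))"
        have "real N * R (Suc n) = R n" "1 * R (Suc n) \<le> real N * R (Suc n)"
          using N R0[of "Suc n"] RS[of n] by (simp, intro mult_right_mono, auto)
        then have RR: "R (Suc n) \<le> R n" by linarith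
        have "u \<in> sball (v n) (2 * R n)"
          unfolding sball_def
        proof (intro CollectI allI)
          fix i
          have "\<bar>u $ i - x $ i\<bar> \<le> R (Suc n)" using ux by (simp add: sball_def)
          moreover have "v n $ i \<le> x $ i" "x $ i \<le> v n $ i + R n"
            using x[of n] unfolding R_def cube_def by auto
          ultimately show "\<bar>u $ i - v n $ i\<bar> \<le> 2 * R n" using RR by linarith
        qed
        then show False using avoid[of u n] ux n y(1) u(2) unfolding R_def by blast
      qed
      then obtain i where "R (Suc n) < \<bar>u $ i - x $ i\<bar>" unfolding sball_def by (auto simp: not_le)
      then have "c1 * R (Suc n) \<le> c1 * \<bar>u $ i - x $ i\<bar>" using c1 by simp
      also have "\<dots> \<le> max_dist (\<Phi> x) y" unfolding u(2) by (rule lip[OF u(1)])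
      finally have far: "c1 * R (Suc n) \<le> max_dist (\<Phi> x) y" .
      show ?thesis
      proof (cases n)
        case 0
        have "b * psi c ?H \<le> b * 1" using psi b by (intro mult_left_mono) auto
        also have "\<dots> \<le> c1 * R 1" unfolding b_def by simp
        finally show ?thesis using far 0 by simp
      next
        case (Suc m)
        have "\<not> R m \<le> \<tau> * psi c ?H" unfolding n_def by (rule not_less_Least) (use Suc n_def in simp)
        then have "\<tau> * psi c ?H \<le> R m" by linarith
        then have "c1 / (real N)\<^sup>2 * (\<tau> * psi c ?H) \<le> c1 / (real N)\<^sup>2 * R m" using c1 by (intro mult_left_mono) auto
        also have "\<dots> = c1 * R (Suc n)" unfolding Suc RS by (simp add: power2_eq_square)
        finally have "c1 * \<tau> / (real N)\<^sup>2 * psi c ?H \<le> max_dist (\<Phi> x) y" using far by simp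
        moreover have "b * psi c ?H \<le> c1 * \<tau> / (real N)\<^sup>2 * psi c ?H"
          unfolding b_def using psi by (intro mult_right_mono) auto
        ultimately show ?thesis by linarith
      qed
    qed
  qed
  then show ?thesis unfolding BA_def using b M xW by blast
qed

text \<open>A quantitative form of positive s-dimensional content. The size bounds e are kept
  separate from the actual diameters so that they can be positive, as \<open>escape_cover\<close>
  demands.\<close>

theorem BA_not_covered:
  fixes M :: "(real ^ 'd::finite) set"
  assumes kd: "CARD('k::finite) \<le> CARD('d)" and nd: "nondegenerate TYPE('k) M"
    and s: "0 < s" "s < real CARD('k)"
  obtains \<delta> where "0 < \<delta>"
    "\<And>A e. (\<And>i :: nat. 0 < e i) \<Longrightarrow> (\<And>i x y. x \<in> A i \<Longrightarrow> y \<in> A i \<Longrightarrow> max_dist x y \<le> e i) \<Longrightarrow>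
      summable (\<lambda>i. e i powr s) \<Longrightarrow> (\<Sum>i. e i powr s) < \<delta> \<Longrightarrow>
      \<not> BA M (psi (c_kd CARD('k) CARD('d))) \<subseteq> (\<Union>i. A i)"
proof -
  let ?k = "real CARD('k)" and ?c = "c_kd CARD('k) CARD('d)"
  have k1: "1 \<le> CARD('k)" by (simp add: Suc_leI)
  have c0: "0 < ?c" by (rule c_kd_pos[OF k1 kd])
  obtain D U v0 and \<Phi> :: "real ^ 'k \<Rightarrow> real ^ 'd" where D: "1 \<le> D"
    and lp: "local_parameterization M U \<Phi>" and v0: "v0 \<in> U" and osc: "osculating_space D \<Phi> v0 = UNIV"
    using nd unfolding nondegenerate_def nondegenerate_at_def D_nondegenerate_at_def by blast
  have U: "open U" and sm: "smooth_on U \<Phi>" and inj: "inj (frechet_derivative \<Phi> (at v0))"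
    and UM: "\<Phi> ` U \<subseteq> M"
    using lp v0 unfolding local_parameterization_def by (auto dest: openin_imp_subset)
  obtain \<kappa> r1 where \<kappa>: "0 < \<kappa>" and r1: "0 < r1"
    and nd\<kappa>: "\<And>v L. dist v v0 < r1 \<Longrightarrow> norm L = 1 \<Longrightarrow>
      \<exists>is. 1 \<le> length is \<and> length is \<le> D \<and> \<kappa> \<le> \<bar>L \<bullet> iter_partial is \<Phi> v\<bar>"
    using nondegenerate_uniform[OF sm U v0 osc] by metis
  obtain r2 c1 where r2: "0 < r2" "ball v0 r2 \<subseteq> U" and c1: "0 < c1"
    and lip: "\<And>x y i. x \<in> ball v0 r2 \<Longrightarrow> y \<in> ball v0 r2 \<Longrightarrow> c1 * \<bar>x $ i - y $ i\<bar> \<le> max_dist (\<Phi> x) (\<Phi> y)"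
    using lower_lipschitz[OF sm U v0 inj] by metis
  \<comment> \<open>Halving keeps even the closed ball inside both neighbourhoods, so derivatives
    are bounded on it by compactness.\<close>
  define r where "r = min r1 r2 / 2"
  have r: "0 < r" "r < r1" "r < r2" unfolding r_def using r1 r2 by auto
  define W where "W = ball v0 r"
  have W: "open W" "W \<subseteq> ball v0 r2" "W \<subseteq> U" unfolding W_def using r r2(2) by (auto intro: subset_ball)
  have cU: "cball v0 r \<subseteq> U" using r r2(2) by (auto simp: subset_eq)
  define m where "m = max (Suc D) (Suc (n_kd CARD('k) CARD('d)))"
  obtain C where C: "0 \<le> C" "\<And>is x. length is \<le> m \<Longrightarrow> x \<in> cball v0 r \<Longrightarrow> norm (iter_partial is \<Phi> x) \<le> C"
    using iter_partial_bounded[OF sm U compact_cball cU] by metis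
  have CW: "norm (iter_partial is \<Phi> x) \<le> C" if "x \<in> W" "length is \<le> m" for "is" x
    using C(2)[OF that(2)] that(1) unfolding W_def by auto
  obtain \<tau> where \<tau>: "0 < \<tau>" and hyp: "\<And>v \<rho>. 0 < \<rho> \<Longrightarrow> 2 * \<rho> \<le> 1 \<Longrightarrow> sball v (2 * \<rho>) \<subseteq> W \<Longrightarrow>
      \<exists>L b. norm L = 1 \<and> (\<forall>u\<in>sball v (2 * \<rho>). \<Phi> u \<in> rat_points \<longrightarrow>
        \<rho> \<le> \<tau> * psi ?c (real (height (\<Phi> u))) \<longrightarrow> L \<bullet> \<Phi> u = b)"
  proof (rule rational_points_on_hyperplane[OF sm U kd C(1) _ W(3)])
    fix "is" :: "'k list" and x j assume "x \<in> W" "length is \<le> Suc (n_kd CARD('k) CARD('d))"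
    then have "norm (iter_partial is \<Phi> x) \<le> C" by (intro CW) (auto simp: m_def)
    then show "\<bar>iter_partial is \<Phi> x $ j\<bar> \<le> C" using component_le_norm_cart[of "iter_partial is \<Phi> x" j] by linarith
  qed blast
  obtain N1 where N1: "\<And>N. N \<ge> N1 \<Longrightarrow> 2 * 3 ^ CARD('k) * real N powr s \<le> real N ^ CARD('k)"
    using large_branching[OF s(2)] by blast
  obtain N \<rho>0 where N: "max 2 N1 \<le> N" and \<rho>0: "0 < \<rho>0"
    and few: "\<And>v \<rho> L b. 0 < \<rho> \<Longrightarrow> \<rho> \<le> \<rho>0 \<Longrightarrow> sball v (2 * \<rho>) \<subseteq> W \<Longrightarrow> norm L = 1 \<Longrightarrow>
      real (card {f \<in> grid N. \<exists>x\<in>cube (subcorner v \<rho> N f) (\<rho> / real N). \<exists>u\<in>sball v (2 * \<rho>).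
        L \<bullet> \<Phi> u = b \<and> u \<in> sball x (\<rho> / real N)}) \<le> 1 / 2 * real N ^ CARD('k)"
  proof (rule hyperplane_cells_few[OF sm U W(3) D _ \<kappa>, where Nmin = "max 2 N1" and \<epsilon> = "1 / 2" and C = C])
    show "norm (iter_partial is \<Phi> x) \<le> C" if "x \<in> W" "length is = Suc D" for "is" x
      using CW[OF that(1), of "is"] that(2) by (simp add: m_def)
    show "\<exists>is. 1 \<le> length is \<and> length is \<le> D \<and> \<kappa> \<le> \<bar>L \<bullet> iter_partial is \<Phi> v\<bar>"
      if "v \<in> W" "norm L = 1" for v L
      using nd\<kappa>[of v L] that r unfolding W_def by (simp add: dist_commute)
  qed (simp, blast)
  have N2: "2 \<le> N" and Ns: "2 * 3 ^ CARD('k) * real N powr s \<le> real N ^ CARD('k)" using N N1 by auto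
  \<comment> \<open>The bounds serve the cell count, the simplex lemma at radius 2 * \<rho>, and the
    inclusion of \<open>sball v0 (3 * \<rho>)\<close> in W. The radius 3 * \<rho> covers every
    doubled ball around a point of Q.\<close>
  define \<rho> where "\<rho> = min (min \<rho>0 (1 / 2)) (r / (4 * ?k))"
  have \<rho>: "0 < \<rho>" "\<rho> \<le> \<rho>0" "2 * \<rho> \<le> 1" unfolding \<rho>_def using \<rho>0 r by auto
  have \<rho>r: "?k * (3 * \<rho>) < r"
  proof -
    have "\<rho> \<le> r / (4 * ?k)" unfolding \<rho>_def by simp
    then have "?k * (4 * \<rho>) \<le> r" by (simp add: field_simps)
    moreover have "0 < ?k * \<rho>" using \<rho> by simp
    ultimately show ?thesis by linarith
  qed
  have s3: "sball v0 (3 * \<rho>) \<subseteq> W" unfolding W_def by (rule sball_subset_ball[OF \<rho>r])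
  define Q where "Q = cube v0 \<rho>"
  have QW: "Q \<subseteq> W"
  proof -
    have "Q \<subseteq> sball v0 (3 * \<rho>)"
    proof
      fix x assume x: "x \<in> Q"
      have "\<bar>x $ i - v0 $ i\<bar> \<le> 3 * \<rho>" for i
      proof -
        have "v0 $ i \<le> x $ i" "x $ i \<le> v0 $ i + \<rho>" using x unfolding Q_def cube_def by auto
        then show ?thesis using \<rho>(1) by linarith
      qed
      then show "x \<in> sball v0 (3 * \<rho>)" by (simp add: sball_def)
    qed
    then show ?thesis using s3 by blast
  qed
  have Qbox: "Q = cbox v0 (v0 + (\<chi> i. \<rho>))" unfolding Q_def cube_def by (auto simp: mem_box_cart)
  obtain \<eta> where \<eta>: "0 < \<eta>" and sep: "\<And>x y. x \<in> Q \<Longrightarrow> y \<in> M \<Longrightarrow> y \<notin> \<Phi> ` W \<Longrightarrow> \<eta> \<le> max_dist (\<Phi> x) y"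
    using separation_from_rest[OF lp W(1,3) _ QW] unfolding Qbox using compact_cbox by blast
  have sub: "sball v (2 * t) \<subseteq> W" if t: "0 < t" "t \<le> \<rho>" and v: "cube v t \<subseteq> Q" for v t
  proof -
    have "v \<in> cube v t" using t by (simp add: cube_def)
    then have v': "v \<in> Q" using v by blast
    have "sball v (2 * t) \<subseteq> sball v0 (3 * \<rho>)"
    proof
      fix x assume x: "x \<in> sball v (2 * t)"
      have "\<bar>x $ i - v0 $ i\<bar> \<le> 3 * \<rho>" for i
      proof -
        have "v0 $ i \<le> v $ i" "v $ i \<le> v0 $ i + \<rho>" using v' unfolding Q_def cube_def by auto
        moreover have "\<bar>x $ i - v $ i\<bar> \<le> 2 * t" using x by (simp add: sball_def)
        ultimately show ?thesis using t by linarith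
      qed
      then show "x \<in> sball v0 (3 * \<rho>)" by (simp add: sball_def)
    qed
    then show ?thesis using s3 by blast
  qed
  define R where "R = (\<lambda>n. \<rho> / real N ^ n)"
  have Rn: "R n = \<rho> / real N ^ n" for n by (simp add: R_def)
  have R: "0 < R n" "R n \<le> \<rho>" for n
  proof -
    have "1 \<le> real N ^ n" using N2 by simp
    moreover from this have "0 < real N ^ n" by linarith
    ultimately show "0 < R n" "R n \<le> \<rho>" unfolding R_def using \<rho>(1) by (simp_all add: divide_le_eq)
  qed
  \<comment> \<open>The cells containing a point within one subcube side of a rational point of
    relevant height. Membership avoids L and b, which depend on n and v; they are used only to count
    these cells.\<close>
  define bad where "bad = (\<lambda>n v. {f \<in> grid N. \<exists>x\<in>cube (subcorner v (R n) N f) (R n / real N). \<exists>u\<in>sball v (2 * R n).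
      \<Phi> u \<in> rat_points \<and> R n \<le> \<tau> * psi ?c (real (height (\<Phi> u))) \<and> u \<in> sball x (R n / real N)})"
  have bad: "real (card (bad n v)) \<le> real N ^ CARD('k) / 2" if v: "cube v (R n) \<subseteq> Q" for n v
  proof -
    have W': "sball v (2 * R n) \<subseteq> W" by (rule sub[OF R v])
    have "2 * R n \<le> 1" using R(2)[of n] \<rho>(3) by linarith
    from hyp[OF R(1) this W'] obtain L b where *: "norm L = 1 \<and> (\<forall>u\<in>sball v (2 * R n). \<Phi> u \<in> rat_points \<longrightarrow>
        R n \<le> \<tau> * psi ?c (real (height (\<Phi> u))) \<longrightarrow> L \<bullet> \<Phi> u = b)"
      by (elim exE)
    have Lb: "norm L = 1" "\<And>u. u \<in> sball v (2 * R n) \<Longrightarrow> \<Phi> u \<in> rat_points \<Longrightarrow>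
        R n \<le> \<tau> * psi ?c (real (height (\<Phi> u))) \<Longrightarrow> L \<bullet> \<Phi> u = b"
      using * by simp_all
    let ?B = "{f \<in> grid N. \<exists>x\<in>cube (subcorner v (R n) N f) (R n / real N). \<exists>u\<in>sball v (2 * R n).
        L \<bullet> \<Phi> u = b \<and> u \<in> sball x (R n / real N)}"
    have "card (bad n v) \<le> card ?B"
    proof (rule card_mono)
      show "finite ?B" by (rule finite_subset[OF _ finite_grid[of N]]) auto
      show "bad n v \<subseteq> ?B" unfolding bad_def using Lb(2) by blast
    qed
    moreover have "real (card ?B) \<le> 1 / 2 * real N ^ CARD('k)"
      by (rule few[OF R(1) _ W' Lb(1)]) (use R(2)[of n] \<rho>(2) in linarith)
    ultimately show ?thesis by linarith
  qed
  \<comment> \<open>Pulling a set of size e back through \<Phi> enlarges it at most to e / c1, and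
    \<open>escape_cover\<close> starts from the s-th power of \<rho> / N.\<close>
  define \<delta> where "\<delta> = (c1 * (\<rho> / real N)) powr s"
  show thesis
  proof (rule that[of \<delta>])
    show "0 < \<delta>" unfolding \<delta>_def using c1 \<rho> N2 by simp
    fix A :: "nat \<Rightarrow> (real ^ 'd) set" and e
    assume e: "\<And>i. 0 < e i" "\<And>i x y. x \<in> A i \<Longrightarrow> y \<in> A i \<Longrightarrow> max_dist x y \<le> e i"
      and sm: "summable (\<lambda>i. e i powr s)" "(\<Sum>i. e i powr s) < \<delta>"
    define E where "E = (\<lambda>i. {x \<in> W. \<Phi> x \<in> A i})"
    define d where "d = (\<lambda>i. e i / c1)"
    have dpow: "d i powr s = e i powr s / c1 powr s" for i
      unfolding d_def using e(1)[of i] c1 by (simp add: powr_divide)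
    have diam: "\<bar>x $ j - y $ j\<bar> \<le> d i" if "x \<in> E i" "y \<in> E i" for i x y j
    proof -
      have "c1 * \<bar>x $ j - y $ j\<bar> \<le> e i"
        using lip[of x y j] e(2)[of "\<Phi> x" i "\<Phi> y"] that W(2) unfolding E_def by fastforce
      then show ?thesis unfolding d_def using c1 by (simp add: field_simps)
    qed
    have d0: "0 < d i" for i unfolding d_def using e(1) c1 by simp
    have dsum: "summable (\<lambda>i. d i powr s)" unfolding dpow by (rule summable_divide[OF sm(1)])
    have dlt: "(\<Sum>i. d i powr s) < (\<rho> / real N) powr s"
    proof -
      have "(\<Sum>i. d i powr s) = (\<Sum>i. e i powr s) / c1 powr s"
        unfolding dpow by (rule suminf_divide[OF sm(1)])
      also have "\<dots> < \<delta> / c1 powr s" using sm(2) c1 by (intro divide_strict_right_mono) auto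
      also have "\<dots> = (\<rho> / real N) powr s"
        unfolding \<delta>_def powr_mult using c1 by simp
      finally show ?thesis .
    qed
    have badsub: "bad n v \<subseteq> grid N" for n v unfolding bad_def by blast
    obtain x v where x: "\<And>n. x \<in> cube (v n) (\<rho> / real N ^ n)" "\<And>i. x \<notin> E i"
      and vQ: "\<And>n. cube (v n) (\<rho> / real N ^ n) \<subseteq> cube v0 \<rho>"
      and step: "\<And>n. \<exists>f\<in>grid N - bad n (v n). v (Suc n) = subcorner (v n) (\<rho> / real N ^ n) N f"
    proof (rule escape_cover[OF s(1) N2 Ns \<rho>(1) d0 diam dsum dlt, where bad = bad and E = E and ?v0.0 = v0])
      show "real (card (bad n v)) \<le> real N ^ CARD('k) / 2" if "cube v (\<rho> / real N ^ n) \<subseteq> cube v0 \<rho>" for n v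
        using bad that unfolding R_def Q_def .
    qed (assumption, assumption, rule badsub, rule that)
    have xQ: "x \<in> Q" using x(1)[of 0] vQ[of 0] unfolding Q_def by blast
    have "\<Phi> x \<in> BA M (psi ?c)"
    proof (rule nested_cubes_badly_approximable[OF c0 c1 \<eta> \<tau> \<rho>(1) N2, where W = W and v = v])
      show "\<eta> \<le> max_dist (\<Phi> x) y" if "y \<in> M" "y \<notin> \<Phi> ` W" for y by (rule sep[OF xQ that])
      show "x \<in> cube (v n) (\<rho> / real N ^ n)" for n by (rule x(1))
      show "\<Phi> ` W \<subseteq> M" using UM W(3) by blast
      show "x \<in> W" using xQ QW by blast
      then show "c1 * \<bar>u $ i - x $ i\<bar> \<le> max_dist (\<Phi> x) (\<Phi> u)" if "u \<in> W" for u i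
        using lip[OF subsetD[OF W(2)] subsetD[OF W(2) that], of x i] by (simp add: abs_minus_commute)
      fix n u
      assume u: "u \<in> sball (v n) (2 * (\<rho> / real N ^ n))" "\<Phi> u \<in> rat_points"
        "\<rho> / real N ^ n \<le> \<tau> * psi ?c (real (height (\<Phi> u)))"
      obtain f where f: "f \<in> grid N" "f \<notin> bad n (v n)" "v (Suc n) = subcorner (v n) (R n) N f"
        using step[of n] unfolding R_def by blast
      have "x \<in> cube (subcorner (v n) (R n) N f) (R n / real N)"
        using x(1)[of "Suc n"] f(3) by (simp add: R_def mult.commute)
      then have "u \<notin> sball x (R n / real N)"
        using f(1,2) u[folded Rn] unfolding bad_def by blast
      then show "u \<notin> sball x (\<rho> / real N ^ Suc n)" by (simp add: R_def mult.commute)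
    qed
    moreover have "\<Phi> x \<notin> (\<Union>i. A i)" using x(2) xQ QW unfolding E_def by blast
    ultimately show "\<not> BA M (psi ?c) \<subseteq> (\<Union>i. A i)" by blast
  qed
qed

section \<open>Hausdorff dimension and Dirichlet functions\<close>

lemma ediam_le_ennreal:
  assumes "0 \<le> e" "\<And>x y. x \<in> A \<Longrightarrow> y \<in> A \<Longrightarrow> \<delta> x y \<le> e"
  shows "ediam \<delta> A \<le> ennreal e"
  unfolding ediam_def using assms by (intro SUP_least ennreal_leI) auto

text \<open>Finiteness is essential, because \<open>enn2real\<close> sends infinity to 0.\<close>

lemma le_enn2real_ediam:
  assumes "ediam \<delta> A < top" "0 \<le> \<delta> x y" "x \<in> A" "y \<in> A"
  shows "\<delta> x y \<le> enn2real (ediam \<delta> A)"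
proof -
  have "ennreal (\<delta> x y) \<le> ediam \<delta> A"
    unfolding ediam_def using assms(3,4) by (intro SUP_upper2[of x] SUP_upper2[of y]) auto
  then have "enn2real (ennreal (\<delta> x y)) \<le> enn2real (ediam \<delta> A)"
    using assms(1) by (rule enn2real_mono)
  then show ?thesis using assms(2) by simp
qed

lemma BA_hausdorff_measure_nonzero:
  fixes M :: "(real ^ 'd::finite) set"
  assumes kd: "CARD('k::finite) \<le> CARD('d)" and nd: "nondegenerate TYPE('k) M"
    and s: "0 < s" "s < real CARD('k)"
  shows "hausdorff_measure max_dist s (BA M (psi (c_kd CARD('k) CARD('d)))) \<noteq> 0"
proof
  let ?A = "BA M (psi (c_kd CARD('k) CARD('d)))"
  assume zero: "hausdorff_measure max_dist s ?A = 0"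
  obtain \<delta> where \<delta>: "0 < \<delta>"
    and unc: "\<And>A e. (\<And>i :: nat. 0 < e i) \<Longrightarrow> (\<And>i x y. x \<in> A i \<Longrightarrow> y \<in> A i \<Longrightarrow> max_dist x y \<le> e i) \<Longrightarrow>
      summable (\<lambda>i. e i powr s) \<Longrightarrow> (\<Sum>i. e i powr s) < \<delta> \<Longrightarrow> \<not> ?A \<subseteq> (\<Union>i. A i)"
    using BA_not_covered[OF kd nd s] by metis
  \<comment> \<open>A single scale suffices, as \<open>BA_not_covered\<close> puts no limit on the
    individual sizes. The scale 1 only makes the diameters finite.\<close>
  have "hausdorff_content max_dist s 1 ?A \<le> hausdorff_measure max_dist s ?A"
    unfolding hausdorff_measure_def by (rule SUP_upper) simp
  then have "hausdorff_content max_dist s 1 ?A < ennreal (\<delta> / 2)" using zero \<delta> by simp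
  then obtain U where U: "?A \<subseteq> (\<Union>n. U n)" "\<And>n. ediam max_dist (U n) \<le> ennreal 1"
    and small: "(\<Sum>n. ennreal (enn2real (ediam max_dist (U n)) powr s)) < ennreal (\<delta> / 2)"
    unfolding hausdorff_content_def INF_less_iff by blast
  define a where "a = (\<lambda>n. enn2real (ediam max_dist (U n)) powr s)"
  have a0: "0 \<le> a n" for n unfolding a_def by simp
  have sma: "summable a"
    using small by (intro summable_suminf_not_top a0) (auto simp: a_def)
  have "ennreal (suminf a) < ennreal (\<delta> / 2)"
    using small suminf_ennreal2[OF a0 sma] by (simp add: a_def)
  then have suma: "suminf a < \<delta> / 2" using ennreal_less_iff[OF suminf_nonneg[OF sma a0]] by simp
  \<comment> \<open>Sets of diameter \<open>0\<close> have weight \<open>0\<close>, so all weights are made positive.\<close>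
  define b where "b = (\<lambda>n. a n + \<delta> / 4 * (1 / 2) ^ n)"
  have b0: "0 < b n" for n unfolding b_def using a0[of n] \<delta> by (intro add_nonneg_pos) auto
  have smb: "summable b" "suminf b < \<delta>"
  proof -
    have g: "summable (\<lambda>n. \<delta> / 4 * (1 / 2 :: real) ^ n)" by (intro summable_mult summable_geometric) simp
    have "(\<Sum>n. \<delta> / 4 * (1 / 2 :: real) ^ n) = \<delta> / 2"
      by (subst suminf_mult) (simp_all add: suminf_geometric summable_geometric)
    then show "summable b" "suminf b < \<delta>"
      unfolding b_def using suminf_add[OF sma g] summable_add[OF sma g] suma by simp_all
  qed
  define e where "e = (\<lambda>n. b n powr (1 / s))"
  have es: "e n powr s = b n" for n unfolding e_def using s b0[of n] by (simp add: powr_powr)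
  have "\<not> ?A \<subseteq> (\<Union>i. U i)"
  proof (rule unc[of e])
    show "0 < e i" for i unfolding e_def using b0[of i] by simp
    show "summable (\<lambda>i. e i powr s)" "(\<Sum>i. e i powr s) < \<delta>" unfolding es using smb by auto
    fix i x y assume xy: "x \<in> U i" "y \<in> U i"
    have fin: "ediam max_dist (U i) < top" using U(2)[of i] by (rule le_less_trans) simp
    have "max_dist x y \<le> enn2real (ediam max_dist (U i))"
      by (rule le_enn2real_ediam[OF fin max_dist_nonneg xy])
    also have "\<dots> = a i powr (1 / s)" unfolding a_def using s by (simp add: powr_powr)
    also have "\<dots> \<le> e i" unfolding e_def b_def using a0[of i] s \<delta> by (intro powr_mono2) auto
    finally show "max_dist x y \<le> e i" .
  qed
  then show False using U(1) by blast
qed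

section \<open>Null sets and the upper bound for the dimension\<close>

lemma hausdorff_null_if_covered:
  assumes "\<And>\<epsilon> \<eta>. 0 < \<epsilon> \<Longrightarrow> 0 < \<eta> \<Longrightarrow> \<exists>U :: nat \<Rightarrow> 'a set. A \<subseteq> (\<Union>n. U n) \<and> (\<forall>n. ediam \<delta> (U n) \<le> ennreal \<epsilon>) \<and>
      (\<Sum>n. ennreal (enn2real (ediam \<delta> (U n)) powr s)) \<le> ennreal \<eta>"
  shows "hausdorff_measure \<delta> s A = 0"
proof -
  have "hausdorff_content \<delta> s \<epsilon> A = 0" if \<epsilon>: "0 < \<epsilon>" for \<epsilon>
  proof -
    have "hausdorff_content \<delta> s \<epsilon> A \<le> 0 + ennreal \<eta>" if \<eta>: "0 < \<eta>" for \<eta>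
    proof -
      from assms[OF \<epsilon> \<eta>] obtain U :: "nat \<Rightarrow> 'a set" where U: "A \<subseteq> (\<Union>n. U n) \<and> (\<forall>n. ediam \<delta> (U n) \<le> ennreal \<epsilon>) \<and>
        (\<Sum>n. ennreal (enn2real (ediam \<delta> (U n)) powr s)) \<le> ennreal \<eta>"
        by (elim exE)
      have "hausdorff_content \<delta> s \<epsilon> A \<le> (\<Sum>n. ennreal (enn2real (ediam \<delta> (U n)) powr s))"
        unfolding hausdorff_content_def by (rule INF_lower) (use U in simp)
      also have "\<dots> \<le> 0 + ennreal \<eta>" using U by simp
      finally show ?thesis .
    qed
    then have "hausdorff_content \<delta> s \<epsilon> A \<le> 0" by (rule ennreal_le_epsilon)
    then show ?thesis by (simp only: le_zero_eq)
  qed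
  then have "hausdorff_measure \<delta> s A \<le> 0"
    unfolding hausdorff_measure_def by (intro SUP_least) (simp only: greaterThan_iff order_refl)
  then show ?thesis by (simp only: le_zero_eq)
qed

lemma hausdorff_null_mono:
  assumes "hausdorff_measure \<delta> s B = 0" "A \<subseteq> B"
  shows "hausdorff_measure \<delta> s A = 0"
proof -
  have "hausdorff_content \<delta> s \<epsilon> A \<le> hausdorff_content \<delta> s \<epsilon> B" for \<epsilon>
    unfolding hausdorff_content_def by (rule INF_superset_mono[OF _ order_refl]) (use assms(2) in blast)
  then have "hausdorff_measure \<delta> s A \<le> hausdorff_measure \<delta> s B"
    unfolding hausdorff_measure_def by (rule SUP_mono')
  then show ?thesis using assms(1) by simp
qed

lemma hausdorff_null_cover:
  assumes "hausdorff_measure \<delta> s A = 0" "0 < \<epsilon>" "0 < \<eta>"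
  obtains U :: "nat \<Rightarrow> 'a set" where "A \<subseteq> (\<Union>n. U n)" "\<And>n. ediam \<delta> (U n) \<le> ennreal \<epsilon>"
    "(\<Sum>n. ennreal (enn2real (ediam \<delta> (U n)) powr s)) < ennreal \<eta>"
proof -
  have "hausdorff_content \<delta> s \<epsilon> A \<le> hausdorff_measure \<delta> s A"
    unfolding hausdorff_measure_def using assms(2) by (intro SUP_upper) simp
  then have "hausdorff_content \<delta> s \<epsilon> A < ennreal \<eta>" using assms by simp
  then show thesis unfolding hausdorff_content_def INF_less_iff using that by blast
qed

lemma hausdorff_null_UN:
  fixes A :: "nat \<Rightarrow> 'a set"
  assumes "\<And>m. hausdorff_measure \<delta> s (A m) = 0"
  shows "hausdorff_measure \<delta> s (\<Union>m. A m) = 0"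
proof (rule hausdorff_null_if_covered)
  fix \<epsilon> \<eta> :: real assume pos: "0 < \<epsilon>" "0 < \<eta>"
  have "\<exists>U :: nat \<Rightarrow> 'a set. A m \<subseteq> (\<Union>n. U n) \<and> (\<forall>n. ediam \<delta> (U n) \<le> ennreal \<epsilon>) \<and>
      (\<Sum>n. ennreal (enn2real (ediam \<delta> (U n)) powr s)) < ennreal (\<eta> / 2 * (1 / 2) ^ m)" for m
    by (rule hausdorff_null_cover[OF assms pos(1), of "\<eta> / 2 * (1 / 2) ^ m" m]) (use pos in auto)
  then obtain U where U: "\<And>m. A m \<subseteq> (\<Union>n. U m n)" "\<And>m n. ediam \<delta> (U m n) \<le> ennreal \<epsilon>"
    "\<And>m. (\<Sum>n. ennreal (enn2real (ediam \<delta> (U m n)) powr s)) < ennreal (\<eta> / 2 * (1 / 2) ^ m)"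
    by metis
  define V where "V = (\<lambda>j. case prod_decode j of (m, n) \<Rightarrow> U m n)"
  have "(\<Union>m. A m) \<subseteq> (\<Union>j. V j)"
  proof
    fix x assume "x \<in> (\<Union>m. A m)"
    then obtain m n where "x \<in> U m n" using U(1) by blast
    then have "x \<in> V (prod_encode (m, n))" unfolding V_def by simp
    then show "x \<in> (\<Union>j. V j)" by blast
  qed
  moreover have "\<forall>j. ediam \<delta> (V j) \<le> ennreal \<epsilon>"
    unfolding V_def using U(2) by (auto split: prod.split)
  moreover have "(\<Sum>j. ennreal (enn2real (ediam \<delta> (V j)) powr s)) \<le> ennreal \<eta>"
  proof -
    have "(\<Sum>j. ennreal (enn2real (ediam \<delta> (V j)) powr s)) =
        (\<Sum>j. (\<lambda>(m, n). ennreal (enn2real (ediam \<delta> (U m n)) powr s)) (prod_decode j))"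
      unfolding V_def by (intro suminf_cong) (simp split: prod.split)
    also have "\<dots> = (\<Sum>m. \<Sum>n. ennreal (enn2real (ediam \<delta> (U m n)) powr s))"
      by (rule suminf_ennreal_2dimen) simp
    also have "\<dots> \<le> (\<Sum>m. ennreal (\<eta> / 2 * (1 / 2) ^ m))"
      by (intro suminf_le) (use U(3) in \<open>auto intro: order_less_imp_le\<close>)
    also have "\<dots> = ennreal (\<Sum>m. \<eta> / 2 * (1 / 2) ^ m)"
      by (rule suminf_ennreal2) (use pos in \<open>auto intro!: summable_mult summable_geometric\<close>)
    also have "(\<Sum>m. \<eta> / 2 * (1 / 2 :: real) ^ m) = \<eta>"
      by (subst suminf_mult) (simp_all add: suminf_geometric summable_geometric)
    finally show ?thesis .
  qed
  ultimately show "\<exists>V :: nat \<Rightarrow> 'a set. (\<Union>m. A m) \<subseteq> (\<Union>n. V n) \<and> (\<forall>n. ediam \<delta> (V n) \<le> ennreal \<epsilon>) \<and>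
      (\<Sum>n. ennreal (enn2real (ediam \<delta> (V n)) powr s)) \<le> ennreal \<eta>"
    by blast
qed

lemma cube_subset_subcubes:
  fixes v :: "real ^ 'k::finite"
  assumes "0 < \<rho>" "0 < N"
  shows "cube v \<rho> \<subseteq> (\<Union>f\<in>grid N. cube (subcorner v \<rho> N f) (\<rho> / real N))"
proof
  fix x assume x: "x \<in> cube v \<rho>"
  define \<delta> where "\<delta> = \<rho> / real N"
  have \<delta>: "0 < \<delta>" "real N * \<delta> = \<rho>" unfolding \<delta>_def using assms by auto
  \<comment> \<open>The minimum assigns points on an upper face to the last cell, where the integer
    part would be N.\<close>
  define f where "f = (\<lambda>i. min (N - 1) (nat \<lfloor>(x $ i - v $ i) / \<delta>\<rfloor>))"
  have "f \<in> grid N" unfolding f_def grid_def using assms(2) by auto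
  moreover have "x \<in> cube (subcorner v \<rho> N f) \<delta>"
    unfolding cube_def
  proof (intro CollectI allI)
    fix i
    let ?t = "(x $ i - v $ i) / \<delta>"
    have xi: "v $ i \<le> x $ i" "x $ i \<le> v $ i + \<rho>" using x unfolding cube_def by auto
    have t: "0 \<le> ?t" "?t \<le> real N" using xi \<delta> by (simp_all add: pos_divide_le_eq)
    have "real (f i) \<le> ?t" "?t \<le> real (f i) + 1"
      using t assms(2) unfolding f_def min_def by (simp_all add: of_nat_diff) linarith+
    then have "real (f i) * \<delta> \<le> x $ i - v $ i" "x $ i - v $ i \<le> (real (f i) + 1) * \<delta>"
      using \<delta>(1) by (simp_all add: pos_divide_le_eq pos_le_divide_eq)
    then show "subcorner v \<rho> N f $ i \<le> x $ i \<and> x $ i \<le> subcorner v \<rho> N f $ i + \<delta>"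
      unfolding subcorner_def \<delta>_def[symmetric] by (simp add: algebra_simps)
  qed
  ultimately show "x \<in> (\<Union>f\<in>grid N. cube (subcorner v \<rho> N f) (\<rho> / real N))"
    unfolding \<delta>_def by blast
qed

text \<open>The images of the N^k subcubes have diameter at most L * \<rho> / N, so their total
  weight is a constant times N^(k - s), which tends to 0.\<close>

lemma lipschitz_cube_null:
  fixes \<Phi> :: "real ^ 'k::finite \<Rightarrow> real ^ 'd::finite"
  assumes \<rho>: "0 < \<rho>" and L: "0 < L" and s: "real CARD('k) < s"
    and lip: "\<And>x y t. x \<in> cube v \<rho> \<Longrightarrow> y \<in> cube v \<rho> \<Longrightarrow> (\<And>i. \<bar>x $ i - y $ i\<bar> \<le> t) \<Longrightarrow> max_dist (\<Phi> x) (\<Phi> y) \<le> L * t"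
  shows "hausdorff_measure max_dist s (\<Phi> ` cube v \<rho>) = 0"
proof (rule hausdorff_null_if_covered)
  fix \<epsilon> \<eta> :: real assume pos: "0 < \<epsilon>" "0 < \<eta>"
  let ?k = "CARD('k)"
  have s0: "0 < s" using s by (meson of_nat_0_le_iff le_less_trans)
  have lim1: "(\<lambda>N. L * \<rho> / real N) \<longlonglongrightarrow> 0" by (rule lim_const_over_n)
  have lim2: "(\<lambda>N. (L * \<rho>) powr s * (real N powr (real ?k - s))) \<longlonglongrightarrow> 0"
    by (intro tendsto_mult_right_zero tendsto_neg_powr filterlim_real_sequentially) (use s in simp)
  have "\<forall>\<^sub>F N in sequentially. L * \<rho> / real N < \<epsilon> \<and> (L * \<rho>) powr s * (real N powr (real ?k - s)) < \<eta> \<and> 0 < N"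
    using order_tendstoD(2)[OF lim1 pos(1)] order_tendstoD(2)[OF lim2 pos(2)] eventually_gt_at_top[of 0]
    by eventually_elim simp
  then obtain N where N: "L * \<rho> / real N < \<epsilon>" "(L * \<rho>) powr s * (real N powr (real ?k - s)) < \<eta>" "0 < N"
    unfolding eventually_sequentially by blast
  define c where "c = L * \<rho> / real N"
  have c: "0 < c" unfolding c_def using L \<rho> N by simp
  let ?n = "card (grid N :: ('k \<Rightarrow> nat) set)"
  obtain h where h: "bij_betw h {0..<?n} (grid N :: ('k \<Rightarrow> nat) set)"
    using ex_bij_betw_nat_finite[OF finite_grid] by blast
  \<comment> \<open>Covers are infinite sequences, so the finite family is padded with empty sets.
    Their diameter is a supremum over the empty set, hence 0, and so is their weight.\<close>
  define U where "U = (\<lambda>j. if j < ?n then \<Phi> ` (cube (subcorner v \<rho> N (h j)) (\<rho> / real N)) else {})"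
  have hj: "h j \<in> grid N" if "j < ?n" for j using bij_betwE[OF h] that by simp
  have "\<Phi> ` cube v \<rho> \<subseteq> (\<Union>j. U j)"
  proof
    fix y assume "y \<in> \<Phi> ` cube v \<rho>"
    then obtain f where f: "f \<in> grid N" "y \<in> \<Phi> ` cube (subcorner v \<rho> N f) (\<rho> / real N)"
      using cube_subset_subcubes[OF \<rho> N(3), of v] by blast
    have "f \<in> h ` {0..<?n}" unfolding bij_betw_imp_surj_on[OF h] by (rule f(1))
    then obtain j where "j < ?n" "h j = f" by auto
    then have "y \<in> U j" unfolding U_def using f by simp
    then show "y \<in> (\<Union>j. U j)" by blast
  qed
  moreover have dU: "ediam max_dist (U j) \<le> ennreal c" for j
  proof (rule ediam_le_ennreal)
    fix y z assume yz: "y \<in> U j" "z \<in> U j"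
    then have j: "j < ?n" unfolding U_def by (auto split: if_splits)
    obtain x x' where x: "x \<in> cube (subcorner v \<rho> N (h j)) (\<rho> / real N)" "y = \<Phi> x"
      and x': "x' \<in> cube (subcorner v \<rho> N (h j)) (\<rho> / real N)" "z = \<Phi> x'"
      using yz j unfolding U_def by auto
    have sub: "cube (subcorner v \<rho> N (h j)) (\<rho> / real N) \<subseteq> cube v \<rho>"
      by (rule subcell_subset_cube[OF \<rho> N(3) hj[OF j]])
    have "max_dist (\<Phi> x) (\<Phi> x') \<le> L * (\<rho> / real N)"
    proof (rule lip)
      show "\<bar>x $ i - x' $ i\<bar> \<le> \<rho> / real N" for i
      proof -
        have "subcorner v \<rho> N (h j) $ i \<le> x $ i" "x $ i \<le> subcorner v \<rho> N (h j) $ i + \<rho> / real N"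
          "subcorner v \<rho> N (h j) $ i \<le> x' $ i" "x' $ i \<le> subcorner v \<rho> N (h j) $ i + \<rho> / real N"
          using x(1) x'(1) unfolding cube_def by auto
        then show ?thesis by linarith
      qed
    qed (use x x' sub in auto)
    then show "max_dist y z \<le> c" unfolding c_def x(2) x'(2) by simp
  qed (use c in simp)
  then have "\<forall>j. ediam max_dist (U j) \<le> ennreal \<epsilon>"
    using N(1) unfolding c_def by (meson ennreal_leI order_less_imp_le order_trans)
  moreover have "(\<Sum>j. ennreal (enn2real (ediam max_dist (U j)) powr s)) \<le> ennreal \<eta>"
  proof -
    have "(\<Sum>j. ennreal (enn2real (ediam max_dist (U j)) powr s)) = (\<Sum>j<?n. ennreal (enn2real (ediam max_dist (U j)) powr s))"
      by (rule suminf_finite) (auto simp: U_def ediam_def bot_ennreal)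
    also have "\<dots> \<le> (\<Sum>j<?n. ennreal (c powr s))"
    proof (intro sum_mono ennreal_leI powr_mono2)
      show "enn2real (ediam max_dist (U j)) \<le> c" for j
        using dU[of j] c by (simp add: enn2real_leI)
    qed (use s0 in auto)
    also have "\<dots> = ennreal (real ?n * c powr s)"
      by (simp add: ennreal_of_nat_eq_real_of_nat ennreal_mult)
    also have "real ?n * c powr s = (L * \<rho>) powr s * (real N powr (real ?k - s))"
      unfolding c_def card_grid using N(3) L \<rho> by (simp add: powr_divide powr_diff powr_realpow)
    also have "ennreal \<dots> \<le> ennreal \<eta>" using N(2) by (intro ennreal_leI) simp
    finally show ?thesis .
  qed
  ultimately show "\<exists>U :: nat \<Rightarrow> (real ^ 'd) set. \<Phi> ` cube v \<rho> \<subseteq> (\<Union>n. U n) \<and> (\<forall>n. ediam max_dist (U n) \<le> ennreal \<epsilon>) \<and>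
      (\<Sum>n. ennreal (enn2real (ediam max_dist (U n)) powr s)) \<le> ennreal \<eta>"
    by blast
qed

lemma hausdorff_null_empty: "hausdorff_measure \<delta> s {} = 0"
proof (rule hausdorff_null_if_covered)
  fix \<epsilon> \<eta> :: real
  show "\<exists>U :: nat \<Rightarrow> 'a set. {} \<subseteq> (\<Union>n. U n) \<and> (\<forall>n. ediam \<delta> (U n) \<le> ennreal \<epsilon>) \<and>
      (\<Sum>n. ennreal (enn2real (ediam \<delta> (U n)) powr s)) \<le> ennreal \<eta>"
    by (intro exI[of _ "\<lambda>_. {}"]) (simp add: ediam_def bot_ennreal)
qed

lemma local_parameterization_null_nbhd:
  fixes \<Phi> :: "real ^ 'k::finite \<Rightarrow> real ^ 'd::finite"
  assumes lp: "local_parameterization M U \<Phi>" and v: "v \<in> U" and s: "real CARD('k) < s"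
  obtains T where "openin (top_of_set M) T" "\<Phi> v \<in> T" "hausdorff_measure max_dist s T = 0"
proof -
  let ?k = "real CARD('k)" and ?d = "real CARD('d)"
  obtain \<Theta> where hom: "homeomorphism U (\<Phi> ` U) \<Phi> \<Theta>" and U: "open U" and sm: "smooth_on U \<Phi>"
    and op: "openin (top_of_set M) (\<Phi> ` U)"
    using lp unfolding local_parameterization_def by blast
  obtain r where r: "0 < r" "cball v r \<subseteq> U" using U v open_contains_cball by blast
  obtain C where C: "0 \<le> C" "\<And>is x. length is \<le> 1 \<Longrightarrow> x \<in> cball v r \<Longrightarrow> norm (iter_partial is \<Phi> x) \<le> C"
    using iter_partial_bounded[OF sm U compact_cball r(2)] by metis
  define \<rho> where "\<rho> = r / ?k"
  have \<rho>: "0 < \<rho>" unfolding \<rho>_def using r by simp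
  \<comment> \<open>The shift puts v in the middle of the cube, so that the open box below is a
    neighbourhood of v.\<close>
  define w where "w = v - (\<chi> i. \<rho> / 2)"
  have cube: "cube w \<rho> \<subseteq> cball v r"
  proof -
    have "\<bar>x $ i - v $ i\<bar> \<le> \<rho> / 2" if x: "x \<in> cube w \<rho>" for x i
    proof -
      have "w $ i \<le> x $ i" "x $ i \<le> w $ i + \<rho>" using x unfolding cube_def by auto
      moreover have "w $ i = v $ i - \<rho> / 2" unfolding w_def by simp
      ultimately show ?thesis by linarith
    qed
    then have "cube w \<rho> \<subseteq> sball v (\<rho> / 2)" unfolding sball_def by blast
    moreover have "sball v (\<rho> / 2) \<subseteq> ball v r"
      by (rule sball_subset_ball) (use r in \<open>simp add: \<rho>_def\<close>)
    ultimately show ?thesis by force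
  qed
  have comp: "\<bar>\<Phi> x $ j - \<Phi> y $ j\<bar> \<le> C * (\<Sum>i\<in>UNIV. \<bar>x $ i - y $ i\<bar>)"
    if "x \<in> cube w \<rho>" "y \<in> cube w \<rho>" for x y j
  proof (rule abs_diff_le_partial[OF convex_cube that])
    fix z assume "z \<in> cube w \<rho>"
    then have z: "z \<in> cball v r" "z \<in> U" using cube r(2) by auto
    have smj: "smooth_on U (\<lambda>x. \<Phi> x $ j)" using smooth_on_bounded_linear[OF bounded_linear_vec_nth sm U] by simp
    show "(\<lambda>x. \<Phi> x $ j) differentiable at z" using smooth_on_differentiable_at[OF smj U z(2), of "[]"] by simp
    fix i
    have "partial_deriv i (\<lambda>x. \<Phi> x $ j) z = iter_partial [i] \<Phi> z $ j"
      using iter_partial_bounded_linear[OF bounded_linear_vec_nth sm U z(2), of "[i]"] by (simp add: iter_partial_Cons)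
    then show "\<bar>partial_deriv i (\<lambda>x. \<Phi> x $ j) z\<bar> \<le> C"
      using C(2)[OF _ z(1), of "[i]"] component_le_norm_cart[of "iter_partial [i] \<Phi> z" j] by simp
  qed
  \<comment> \<open>The bound C may be 0; adding 1 makes the Lipschitz constant positive.\<close>
  define L where "L = ?d * (C * ?k) + 1"
  have L: "0 < L" unfolding L_def using C(1) by (intro add_nonneg_pos) auto
  have null: "hausdorff_measure max_dist s (\<Phi> ` cube w \<rho>) = 0"
  proof (rule lipschitz_cube_null[OF \<rho> L s])
    fix x y t assume xy: "x \<in> cube w \<rho>" "y \<in> cube w \<rho>" and t: "\<And>i. \<bar>x $ i - y $ i\<bar> \<le> t"
    have t0: "0 \<le> t" using t[of undefined] by linarith
    have "max_dist (\<Phi> x) (\<Phi> y) \<le> norm (\<Phi> x - \<Phi> y)"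
      using max_dist_le_dist[of "\<Phi> x" "\<Phi> y"] by (simp add: dist_norm)
    also have "\<dots> \<le> (\<Sum>j\<in>UNIV. \<bar>(\<Phi> x - \<Phi> y) $ j\<bar>)" by (rule norm_le_l1_cart)
    also have "\<dots> \<le> (\<Sum>j\<in>(UNIV :: 'd set). C * (?k * t))"
    proof (rule sum_mono)
      fix j
      have "(\<Sum>i\<in>UNIV. \<bar>x $ i - y $ i\<bar>) \<le> (\<Sum>i\<in>(UNIV :: 'k set). t)" by (rule sum_mono[OF t])
      then have "C * (\<Sum>i\<in>UNIV. \<bar>x $ i - y $ i\<bar>) \<le> C * (?k * t)" using C(1) by (intro mult_left_mono) auto
      then show "\<bar>(\<Phi> x - \<Phi> y) $ j\<bar> \<le> C * (?k * t)" using comp[OF xy, of j] by simp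
    qed
    also have "\<dots> \<le> L * t" unfolding L_def using t0 by (simp add: algebra_simps)
    finally show "max_dist (\<Phi> x) (\<Phi> y) \<le> L * t" .
  qed
  define B where "B = box w (w + (\<chi> i. \<rho>))"
  have Bc: "B \<subseteq> cube w \<rho>" unfolding B_def cube_def by (auto simp: mem_box_cart order_less_imp_le)
  have vB: "v \<in> B" unfolding B_def w_def using \<rho> by (simp add: mem_box_cart)
  have "B \<subseteq> U" using Bc cube r(2) by blast
  then have "openin (top_of_set U) B" using U unfolding B_def by (simp add: openin_open_eq open_box)
  then have "openin (top_of_set (\<Phi> ` U)) (\<Phi> ` B)" by (rule homeomorphism_imp_open_map[OF hom])
  then have "openin (top_of_set M) (\<Phi> ` B)" using op openin_trans by blast
  moreover have "\<Phi> v \<in> \<Phi> ` B" using vB by blast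
  moreover have "hausdorff_measure max_dist s (\<Phi> ` B) = 0"
    by (rule hausdorff_null_mono[OF null]) (use Bc in blast)
  ultimately show thesis by (rule that)
qed

text \<open>Every point has a relatively open null neighbourhood, and by the Lindelof property
  countably many of them cover M.\<close>

lemma smooth_submanifold_null:
  fixes M :: "(real ^ 'd::finite) set"
  assumes M: "smooth_submanifold TYPE('k::finite) M" and s: "real CARD('k) < s"
  shows "hausdorff_measure max_dist s M = 0"
proof -
  define F where "F = {T. openin (top_of_set M) T \<and> hausdorff_measure max_dist s T = 0}"
  obtain F' where F': "F' \<subseteq> F" "countable F'" "\<Union>F' = \<Union>F"
    using Lindelof_openin[of F M] unfolding F_def by blast
  have "M \<subseteq> \<Union>F"
  proof
    fix x assume "x \<in> M"
    then obtain U and \<Phi> :: "real ^ 'k \<Rightarrow> real ^ 'd" and v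
      where lp: "local_parameterization M U \<Phi>" and v: "v \<in> U" "x = \<Phi> v"
      using M unfolding smooth_submanifold_def by blast
    obtain T where "openin (top_of_set M) T" "\<Phi> v \<in> T" "hausdorff_measure max_dist s T = 0"
      by (rule local_parameterization_null_nbhd[OF lp v(1) s])
    then show "x \<in> \<Union>F" unfolding F_def v(2) by blast
  qed
  then have sub: "M \<subseteq> \<Union>F'" using F'(3) by simp
  have "hausdorff_measure max_dist s (\<Union>F') = 0"
  proof (cases "F' = {}")
    case True
    then show ?thesis by (simp add: hausdorff_null_empty)
  next
    case False
    then have ran: "range (from_nat_into F') = F'" using F'(2) by (rule range_from_nat_into)
    have "hausdorff_measure max_dist s (\<Union>m. from_nat_into F' m) = 0"
    proof (rule hausdorff_null_UN)
      fix m
      have "from_nat_into F' m \<in> F" using F'(1) from_nat_into[OF False] by blast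
      then show "hausdorff_measure max_dist s (from_nat_into F' m) = 0" unfolding F_def by blast
    qed
    then show ?thesis unfolding ran by simp
  qed
  then show ?thesis using sub by (rule hausdorff_null_mono)
qed

section \<open>Consequences for Dirichlet functions\<close>

lemma BA_irrational:
  assumes "x \<in> BA M (psi c)"
  shows "x \<notin> rat_points"
proof
  assume x: "x \<in> rat_points"
  obtain b where b: "0 < b" "\<forall>r\<in>rat_points \<inter> M. b * psi c (real (height r)) \<le> max_dist x r" and "x \<in> M"
    using assms unfolding BA_def by blast
  then have "b * psi c (real (height x)) \<le> max_dist x x" using x by blast
  also have "\<dots> = 0" by (simp add: max_dist_def infnorm_0)
  finally have "b * psi c (real (height x)) \<le> 0" .
  moreover have "0 < b * psi c (real (height x))"
    using b(1) height_pos[OF x] by (simp add: psi_pos)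
  ultimately show False by linarith
qed

lemma height_tendsto_infinity:
  fixes x :: "real ^ 'd::finite"
  assumes r: "\<And>n. r n \<in> rat_points" "r \<longlonglongrightarrow> x" and x: "x \<notin> rat_points"
  shows "filterlim (\<lambda>n. real (height (r n))) at_top sequentially"
  unfolding filterlim_at_top
proof
  fix Z :: real
  define m where "m = nat \<lceil>Z\<rceil>"
  define F where "F = real (fact m)"
  have F: "0 < F" unfolding F_def by simp
  \<comment> \<open>A closed set that contains all rational points of height at most \<open>m\<close>.\<close>
  define S where "S = {y :: real ^ 'd. \<forall>i. F * y $ i \<in> \<int>}"
  have "closed S"
    unfolding S_def
  proof (rule closed_Collect_all)
    fix i
    have "continuous_on UNIV (\<lambda>y :: real ^ 'd. F * y $ i)" by (intro continuous_intros)
    from continuous_closed_preimage[OF this closed_UNIV closed_Ints]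
    show "closed {y :: real ^ 'd. F * y $ i \<in> \<int>}" by (simp add: vimage_def)
  qed
  moreover have "x \<notin> S"
  proof
    assume "x \<in> S"
    have "x $ i \<in> \<rat>" for i
    proof -
      have "F * x $ i \<in> \<rat>" using \<open>x \<in> S\<close> Ints_subset_Rats unfolding S_def by blast
      moreover have "F \<in> \<rat>" unfolding F_def by (rule Rats_of_nat)
      ultimately have "F * x $ i / F \<in> \<rat>" by (rule Rats_divide)
      then show ?thesis using F by simp
    qed
    then show False using x unfolding rat_points_def by blast
  qed
  ultimately have "\<forall>\<^sub>F n in sequentially. r n \<in> - S"
    by (intro topological_tendstoD[OF r(2)]) (simp_all add: open_Compl)
  then show "\<forall>\<^sub>F n in sequentially. Z \<le> real (height (r n))"
  proof (rule eventually_mono)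
    fix n assume nS: "r n \<in> - S"
    show "Z \<le> real (height (r n))"
    proof (rule ccontr)
      assume "\<not> Z \<le> real (height (r n))"
      then have "height (r n) \<le> m" unfolding m_def by linarith
      moreover have "1 \<le> height (r n)" using height_pos[OF r(1), of n] by linarith
      ultimately have "height (r n) dvd fact m" by (intro dvd_fact)
      then obtain q where "fact m = height (r n) * q" by (elim dvdE)
      then have Fq: "F = real (height (r n)) * real q" unfolding F_def by (simp only: of_nat_mult)
      have "F * r n $ i \<in> \<int>" for i
      proof -
        have "F * r n $ i = real q * (real (height (r n)) * r n $ i)"
          unfolding Fq by (simp only: mult_ac)
        then show ?thesis using height_mult_Ints[OF r(1), of n i] by (simp only: Ints_mult Ints_of_nat)
      qed
      then show False using nS unfolding S_def by blast
    qed
  qed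
qed

text \<open>Along the approximating sequence the lower bound from \<open>BA\<close> and the upper
  bound from \<phi> give b \<le> C * \<phi>(H) / \<open>psi c H\<close>. As x is irrational, the
  heights H tend to infinity and the right side tends to 0.\<close>

lemma no_faster_dirichlet_function:
  fixes M :: "(real ^ 'd::finite) set"
  assumes x: "x \<in> BA M (psi c)" and \<phi>: "dirichlet_function M \<phi>"
    and lim: "((\<lambda>t. \<phi> t / psi c t) \<longlongrightarrow> 0) at_top"
  shows False
proof -
  obtain b where b: "0 < b" "\<And>y. y \<in> rat_points \<inter> M \<Longrightarrow> b * psi c (real (height y)) \<le> max_dist x y" and xM: "x \<in> M"
    using x unfolding BA_def by blast
  obtain C r where r: "\<And>n. r n \<in> rat_points \<inter> M" "r \<longlonglongrightarrow> x"
    "\<And>n :: nat. max_dist x (r n) \<le> C * \<phi> (real (height (r n)))"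
    using \<phi> xM unfolding dirichlet_function_def by blast
  have "filterlim (\<lambda>n. real (height (r n))) at_top sequentially"
    by (rule height_tendsto_infinity[OF _ r(2) BA_irrational[OF x]]) (use r(1) in blast)
  from filterlim_compose[OF lim this]
  have "(\<lambda>n. C * (\<phi> (real (height (r n))) / psi c (real (height (r n))))) \<longlonglongrightarrow> C * 0"
    by (intro tendsto_mult_left)
  moreover have "b \<le> C * (\<phi> (real (height (r n))) / psi c (real (height (r n))))" for n
  proof -
    have H: "0 < psi c (real (height (r n)))" using height_pos[of "r n"] r(1) by (intro psi_pos) auto
    have "b * psi c (real (height (r n))) \<le> C * \<phi> (real (height (r n)))"
      using b(2)[OF r(1)] r(3) order_trans by blast
    then show ?thesis using H by (simp add: pos_le_divide_eq)
  qed
  ultimately have "b \<le> C * 0" by (intro LIMSEQ_le_const) auto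
  then show False using b(1) by simp
qed

theorem hausdorff_dim_BA:
  fixes M :: "(real ^ 'd::finite) set"
  assumes kd: "CARD('k::finite) \<le> CARD('d)" and sm: "smooth_submanifold TYPE('k) M" and nd: "nondegenerate TYPE('k) M"
  shows "hausdorff_dim max_dist (BA M (psi (c_kd CARD('k) CARD('d)))) = ereal (real CARD('k))"
proof (rule antisym)
  let ?A = "BA M (psi (c_kd CARD('k) CARD('d)))" and ?k = "real CARD('k)"
  show "ereal ?k \<le> hausdorff_dim max_dist ?A"
    unfolding hausdorff_dim_def
  proof (rule Inf_greatest)
    fix t assume "t \<in> {ereal s |s. 0 < s \<and> hausdorff_measure max_dist s ?A = 0}"
    then obtain s where s: "t = ereal s" "0 < s" "hausdorff_measure max_dist s ?A = 0" by auto
    have "\<not> s < ?k"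
    proof
      assume "s < ?k"
      from BA_hausdorff_measure_nonzero[OF kd nd s(2) this] s(3) show False by (rule notE)
    qed
    then show "ereal ?k \<le> t" unfolding s(1) by simp
  qed
  show "hausdorff_dim max_dist ?A \<le> ereal ?k"
  proof (rule ccontr)
    assume "\<not> hausdorff_dim max_dist ?A \<le> ereal ?k"
    then have "ereal ?k < hausdorff_dim max_dist ?A" by (simp only: not_le)
    \<comment> \<open>Nullity is available only for exponents strictly above k, so one is inserted
      below the supposed dimension.\<close>
    from ereal_dense2[OF this] obtain s where s: "ereal ?k < ereal s" "ereal s < hausdorff_dim max_dist ?A"
      by (elim exE conjE)
    have "BA M f \<subseteq> M" for f by (auto simp: BA_def)
    moreover have "hausdorff_measure max_dist s M = 0"
      by (rule smooth_submanifold_null[OF sm]) (use s(1) in simp)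
    ultimately have null: "hausdorff_measure max_dist s ?A = 0" by (rule hausdorff_null_mono[rotated])
    have "0 \<le> ?k" by simp
    also have "?k < s" using s(1) by simp
    finally have "hausdorff_dim max_dist ?A \<le> ereal s"
      unfolding hausdorff_dim_def using null by (intro Inf_lower CollectI exI[of _ s] conjI refl)
    then show False using s(2) by simp
  qed
qed

theorem theorem1p3:
  fixes M :: "(real ^ 'd) set"
  assumes "CARD('k::finite) \<le> CARD('d)"
    and "smooth_submanifold TYPE('k) M"
    and "nondegenerate TYPE('k) M"
  shows "hausdorff_dim max_dist (BA M (psi (c_kd CARD('k) CARD('d)))) = ereal (real CARD('k)) \<and>
    \<not> (\<exists>\<phi>. dirichlet_function M \<phi> \<and>
         ((\<lambda>t. \<phi> t / psi (c_kd CARD('k) CARD('d)) t) \<longlongrightarrow> 0) at_top)"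
proof (intro conjI notI)
  let ?A = "BA M (psi (c_kd CARD('k) CARD('d)))"
  show dim: "hausdorff_dim max_dist ?A = ereal (real CARD('k))"
    by (rule hausdorff_dim_BA[OF assms])
  assume "\<exists>\<phi>. dirichlet_function M \<phi> \<and> ((\<lambda>t. \<phi> t / psi (c_kd CARD('k) CARD('d)) t) \<longlongrightarrow> 0) at_top"
  then obtain \<phi> where \<phi>: "dirichlet_function M \<phi>" "((\<lambda>t. \<phi> t / psi (c_kd CARD('k) CARD('d)) t) \<longlongrightarrow> 0) at_top"
    by blast
  \<comment> \<open>Only a point of \<open>BA\<close> is wanted. The exponent 1 / 2 lies below k for
    every k, and the empty set is null.\<close>
  have "hausdorff_measure max_dist (1 / 2) ?A \<noteq> 0"
  proof (rule BA_hausdorff_measure_nonzero[OF assms(1,3)])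
    have "1 \<le> CARD('k)" by (simp add: Suc_leI)
    then show "1 / 2 < real CARD('k)" by linarith
  qed simp
  then have "?A \<noteq> {}" using hausdorff_null_empty by metis
  then obtain x where "x \<in> ?A" by blast
  then show False using \<phi> by (rule no_faster_dirichlet_function)
qed

end
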